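(* Let $C_{d,n}$ denote the expected number of (real) critical points of a random polynomial of degree at most $d$ in $n$ variables, and $E_{d,n}$ its expected number of local minima. Let $P_n$ be the probability that a matrix in the Gaussian Orthogonal Ensemble of $n\times n$ real symmetric matrices is positive definite. Then: (i) For every $n\ge 2$, $$C_{2,n}=1\quad\text{and}\quad E_{2,n}=P_n .$$ (ii) For every $n\ge 2$ and every $d\ge 3$, $$C_{d,n}\le \sqrt{\frac{2}{d}}\,(d-1)^{(n+2)/2}\quad\text{and}\quad E_{d,n}\le \sqrt{\frac{2}{d}}\,(d-1)^{(n+2)/2}\,P_n .$$ (iii) When $n=1$, for every $d\ge 2$, $$C_{d,1}=2E_{d,1}=\frac{2\sqrt{d-1}}{\pi}\int_0^\infty \frac{\sqrt{d(d-1)r^4+2dr^2+2}}{(dr^2+1)(r^2+1)}\,dr\ \le\ 1+\sqrt{d-2}.$$ Moreover, $$\frac{C_{d,1}}{1+\sqrt{d-2}}\longrightarrow 1\quad\text{as } d\to\infty .$$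
   Context: Let $n\ge1$ and $d\ge2$ be integers. A random polynomial of degree at most $d$ in $n$ variables is $f(x)=\sum_{|\alpha|\le d} f_\alpha x^\alpha$, $x\in\mathbb{R}^n$, where $\alpha=(\alpha_1,\dots,\alpha_n)\in\mathbb{N}^n$, $|\alpha|=\alpha_1+\dots+\alpha_n$, $x^\alpha=x_1^{\alpha_1}\cdots x_n^{\alpha_n}$, and the coefficients $f_\alpha$ are independent centered real Gaussian random variables, $f_\alpha$ having variance $\binom{d}{\alpha}=\frac{d!}{\alpha_1!\cdots\alpha_n!\,(d-|\alpha|)!}$. A critical point of $f$ is a point $x\in\mathbb{R}^n$ with $Df(x)=0$. With probability one all critical points are nondegenerate, so that the local minima are the $x\in\mathbb{R}^n$ with $Df(x)=0$ and $D^2f(x)$ positive definite. The Gaussian Orthogonal Ensemble is the space of $n\times n$ real symmetric matrices with the probability measure $\frac{e^{-\|S\|^2/2}}{2^{n/2}\pi^{n(n+1)/4}}\prod_{1\le i\le j\le n}dS_{ij}$, where $\|S\|^2=\sum_{1\le i,j\le n}S_{ij}^2$; that is, the entries $S_{ij}$, $i\le j$, are independent centered Gaussians with variance $1$ on the diagonal and variance $1/2$ off the diagonal. *)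

theory Defs
  imports "HOL-Probability.Probability"
begin

definition multi_indices :: "nat \<Rightarrow> ('n::finite \<Rightarrow> nat) set" where
  "multi_indices d = {\<alpha>. (\<Sum>i\<in>UNIV. \<alpha> i) \<le> d}"

definition multinomial :: "nat \<Rightarrow> ('n::finite \<Rightarrow> nat) \<Rightarrow> real" where
  "multinomial d \<alpha> = fact d / ((\<Prod>i\<in>UNIV. fact (\<alpha> i)) * fact (d - (\<Sum>i\<in>UNIV. \<alpha> i)))"

definition poly_fun :: "nat \<Rightarrow> (('n::finite \<Rightarrow> nat) \<Rightarrow> real) \<Rightarrow> real ^ 'n \<Rightarrow> real" where
  "poly_fun d f x = (\<Sum>\<alpha>\<in>multi_indices d. f \<alpha> * (\<Prod>i\<in>UNIV. (x $ i) ^ \<alpha> i))"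

text \<open>The law of the coefficient family. The second parameter of \<^const>\<open>normal_density\<close> is
  the standard deviation.\<close>

definition random_coeffs :: "nat \<Rightarrow> (('n::finite \<Rightarrow> nat) \<Rightarrow> real) measure" where
  "random_coeffs d =
     (\<Pi>\<^sub>M \<alpha>\<in>multi_indices d. density lborel (normal_density 0 (sqrt (multinomial d \<alpha>))))"

definition critical_point :: "(real ^ 'n::finite \<Rightarrow> real) \<Rightarrow> real ^ 'n \<Rightarrow> bool" where
  "critical_point f x \<longleftrightarrow> (f has_derivative (\<lambda>_. 0)) (at x)"

definition local_minimum :: "(real ^ 'n::finite \<Rightarrow> real) \<Rightarrow> real ^ 'n \<Rightarrow> bool" where
  "local_minimum f x \<longleftrightarrow> (\<forall>\<^sub>F y in nhds x. f x \<le> f y)"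

text \<open>Points are counted with \<^const>\<open>count_space\<close>, so that an infinite set counts as
  \<open>\<infinity>\<close>, and expectations are nonnegative integrals, so that they are meaningful before
  finiteness is known. The dimension is \<open>n = CARD('n)\<close>.\<close>

definition expected_critical_points :: "'n::finite itself \<Rightarrow> nat \<Rightarrow> ennreal" where
  "expected_critical_points _ d =
     (\<integral>\<^sup>+ f. emeasure (count_space UNIV) {x :: real ^ 'n. critical_point (poly_fun d f) x}
        \<partial>random_coeffs d)"

definition expected_local_minima :: "'n::finite itself \<Rightarrow> nat \<Rightarrow> ennreal" where
  "expected_local_minima _ d =
     (\<integral>\<^sup>+ f. emeasure (count_space UNIV) {x :: real ^ 'n. local_minimum (poly_fun d f) x}
        \<partial>random_coeffs d)"

definition positive_definite :: "real ^ 'n ^ 'n::finite \<Rightarrow> bool" where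
  "positive_definite S \<longleftrightarrow> transpose S = S \<and> (\<forall>v. v \<noteq> 0 \<longrightarrow> v \<bullet> (S *v v) > 0)"

text \<open>A symmetric matrix is given by its entries indexed by the unordered pairs \<open>{i, j}\<close>,
  where \<open>i = j\<close> is allowed; these stand for the pairs \<open>i \<le> j\<close>, as the index type
  carries no order.\<close>

definition index_pairs :: "'n::finite set set" where
  "index_pairs = {{i, j} | i j. True}"

definition sym_matrix :: "('n::finite set \<Rightarrow> real) \<Rightarrow> real ^ 'n ^ 'n" where
  "sym_matrix s = (\<chi> i j. s {i, j})"

text \<open>The Gaussian Orthogonal Ensemble. The norm on \<open>real ^ 'n ^ 'n\<close> is the Frobenius norm.\<close>

definition GOE :: "(real ^ 'n ^ 'n::finite) measure" where
  "GOE = distr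
     (density (\<Pi>\<^sub>M e\<in>index_pairs. lborel)
        (\<lambda>s. exp (- (norm (sym_matrix s :: real ^ 'n ^ 'n))\<^sup>2 / 2) /
              (2 powr (real CARD('n) / 2) * pi powr (real CARD('n) * (real CARD('n) + 1) / 4))))
     borel sym_matrix"

definition GOE_positive_definite_prob :: "'n::finite itself \<Rightarrow> real" where
  "GOE_positive_definite_prob _ = measure (GOE :: (real ^ 'n ^ 'n) measure) {S. positive_definite S}"

end

theory Submission
  imports Defs
begin

text \<open>
  Write \<open>f(x) = g(x) + b \<cdot> x\<close>, where \<open>b\<close> collects the coefficients of degree one; \<open>b / \<surd>d\<close> is a standard
  Gaussian vector independent of \<open>g\<close>. A point \<open>x\<close> is critical iff \<open>b = - Dg(x)\<close>, so that the area formula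
  and Sard's theorem applied to \<open>- Dg\<close> express the expected number of critical points as
  \<open>\<integral> E (\<bar>det D\<^sup>2g(x)\<bar> \<phi>(Dg(x))) dx\<close> with \<open>\<phi>\<close> the density of \<open>b\<close>; for local minima the integrand is restricted to
  positive semidefinite Hessians.

  With \<open>r = 1 + \<bar>x\<bar>\<^sup>2\<close>, \<open>m = 1 + d \<bar>x\<bar>\<^sup>2\<close> and \<open>s = \<surd>(d (d - 1) / (2 m))\<close>, characteristic functions show that the law of
  \<open>D\<^sup>2g(x)\<close> weighted by \<open>\<phi>(Dg(x))\<close> is a multiple of the law of \<open>c D (G + s \<xi> x x\<^sup>T) D\<close>, where \<open>G\<close> is a GOE matrix,
  \<open>\<xi>\<close> an independent standard Gaussian and \<open>D\<close> a rank-one perturbation of the identity. The integrand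
  becomes \<open>((d - 1) / (\<pi> r))\<^bsup>n/2\<^esup> (r m)\<^bsup>-1/2\<^esup> E \<bar>det (G + s \<xi> x x\<^sup>T)\<bar>\<close>.

  On symmetric matrices, \<open>\<bar>det\<bar>\<close> is convex along rank-one directions, also after multiplication by the
  indicator of the semidefinite ones, so this expectation increases with \<open>s\<close>. After the substitution
  \<open>x = y / \<surd>(d - 1)\<close> this bounds the integrand for \<open>d\<close> pointwise by \<open>\<surd>(2/d) (d - 1)\<^bsup>(n+2)/2\<^esup>\<close> times the one
  for \<open>d = 2\<close>. For \<open>d = 2\<close> the polynomial is quadratic with Hessian \<open>2 G\<close>, which is almost surely
  nonsingular, so that there is exactly one critical point, and it is a minimum with probability \<open>P\<^sub>n\<close>.

  For \<open>n = 1\<close> the integrand is explicit and proportional to \<open>\<surd>(A\<^sup>2 / (d r\<^sup>2 + 1)\<^sup>2 + B\<^sup>2 / (r\<^sup>2 + 1)\<^sup>2)\<close> with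
  \<open>A\<^sup>2 = d / (d - 1)\<close> and \<open>B\<^sup>2 = (d - 2) / (d - 1)\<close>; it lies between its second term and the sum of both,
  and these integrate to \<open>\<surd>(d - 2)\<close> and \<open>1 + \<surd>(d - 2)\<close>.
\<close>

subsection \<open>The covariance kernel\<close>

text \<open>The variances \<open>multinomial d \<alpha>\<close> are exactly those for which
  \<open>f(x)\<close> and \<open>f(y)\<close> have covariance
  \<open>(1 + x \<bullet> y) ^ d\<close>. Every covariance of gradient and Hessian entries is
  therefore a derivative of one explicit kernel. Conditioning on the null event that
  \<open>x\<close> is critical never occurs: the Hessian law is weighted by a Gaussian density
  instead, which gives a finite measure, and finite measures are identified by characteristic
  functions, which linear algebra computes. The comparison is made with \<open>d = 2\<close> because
  the integral need not be evaluated there: it is the expected count for a quadratic polynomial,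
  known directly. The factor in (ii) is the product of three elementary losses,
  \<open>(d-1)^(n/2)\<close>, \<open>sqrt (d-1)\<close> and \<open>sqrt (2(d-1)/d)\<close>; the
  expected determinant contributes none. Minima are handled through semidefinite Hessians because
  this condition is closed, and both the measurability of the counts and the area formula rest on
  compactness.\<close>

definition subset_multi_indices :: "'n set \<Rightarrow> nat \<Rightarrow> ('n::finite \<Rightarrow> nat) set" where
  "subset_multi_indices A d = {\<alpha>. (\<forall>i. i \<notin> A \<longrightarrow> \<alpha> i = 0) \<and> (\<Sum>i\<in>A. \<alpha> i) \<le> d}"

lemma finite_subset_multi_indices: "finite (subset_multi_indices A d)"
proof (rule finite_subset)
  show "subset_multi_indices A d \<subseteq> PiE UNIV (\<lambda>_. {..d})"
  proof
    fix \<alpha> assume a: "\<alpha> \<in> subset_multi_indices A d"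
    have "\<alpha> i \<le> d" for i
    proof (cases "i \<in> A")
      case True
      then have "\<alpha> i \<le> (\<Sum>i\<in>A. \<alpha> i)" by (intro member_le_sum) auto
      then show ?thesis using a by (simp add: subset_multi_indices_def)
    qed (use a in \<open>simp add: subset_multi_indices_def\<close>)
    then show "\<alpha> \<in> PiE UNIV (\<lambda>_. {..d})" by auto
  qed
qed (simp add: finite_PiE)

lemma multi_indices_eq: "multi_indices d = subset_multi_indices UNIV d"
  by (simp add: multi_indices_def subset_multi_indices_def)

lemma finite_multi_indices [simp]: "finite (multi_indices d)"
  by (simp add: multi_indices_eq finite_subset_multi_indices)

lemma multinomial_theorem_subset:
  fixes t :: "'n::finite \<Rightarrow> real"
  shows "(c + (\<Sum>i\<in>A. t i)) ^ d =
    (\<Sum>\<alpha>\<in>subset_multi_indices A d.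
       fact d / ((\<Prod>i\<in>A. fact (\<alpha> i)) * fact (d - (\<Sum>i\<in>A. \<alpha> i))) *
       c ^ (d - (\<Sum>i\<in>A. \<alpha> i)) * (\<Prod>i\<in>A. t i ^ \<alpha> i))"
  using finite[of A]
proof (induction A arbitrary: c rule: finite_induct)
  case empty
  have "subset_multi_indices {} d = {\<lambda>_::'n. 0}"
    by (auto simp: subset_multi_indices_def)
  then show ?case by simp
next
  case (insert a A)
  let ?s = "\<lambda>\<beta>. d - (\<Sum>i\<in>A. \<beta> i)"
  let ?G = "\<lambda>\<beta> k. fact d / ((\<Prod>i\<in>A. fact (\<beta> i)) * (fact k * fact (?s \<beta> - k))) *
       c ^ (?s \<beta> - k) * (t a ^ k * (\<Prod>i\<in>A. t i ^ \<beta> i))"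
  have "(c + (\<Sum>i\<in>insert a A. t i)) ^ d = ((c + t a) + (\<Sum>i\<in>A. t i)) ^ d"
    using insert.hyps by (simp add: add.assoc)
  also have "\<dots> = (\<Sum>\<beta>\<in>subset_multi_indices A d.
       fact d / ((\<Prod>i\<in>A. fact (\<beta> i)) * fact (?s \<beta>)) * (c + t a) ^ ?s \<beta> * (\<Prod>i\<in>A. t i ^ \<beta> i))"
    by (rule insert.IH)
  also have "\<dots> = (\<Sum>\<beta>\<in>subset_multi_indices A d. \<Sum>k\<le>?s \<beta>. ?G \<beta> k)"
  proof (intro sum.cong refl)
    fix \<beta>
    have "(c + t a) ^ ?s \<beta> = (\<Sum>k\<le>?s \<beta>. fact (?s \<beta>) / (fact k * fact (?s \<beta> - k)) * t a ^ k
        * c ^ (?s \<beta> - k))"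
      unfolding add.commute[of c] binomial_ring by (intro sum.cong) (auto simp: binomial_fact)
    then show "fact d / ((\<Prod>i\<in>A. fact (\<beta> i)) * fact (?s \<beta>)) * (c + t a) ^ ?s \<beta> * (\<Prod>i\<in>A. t i ^ \<beta> i)
      = (\<Sum>k\<le>?s \<beta>. ?G \<beta> k)"
      by (simp add: sum_distrib_left sum_distrib_right) (intro sum.cong; simp add: field_simps)
  qed
  also have "\<dots> = (\<Sum>(\<beta>, k)\<in>Sigma (subset_multi_indices A d) (\<lambda>\<beta>. {..?s \<beta>}). ?G \<beta> k)"
    by (intro sum.Sigma) (auto simp: finite_subset_multi_indices)
  also have "\<dots> = (\<Sum>\<alpha>\<in>subset_multi_indices (insert a A) d.
       fact d / ((\<Prod>i\<in>insert a A. fact (\<alpha> i)) * fact (d - (\<Sum>i\<in>insert a A. \<alpha> i))) *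
       c ^ (d - (\<Sum>i\<in>insert a A. \<alpha> i)) * (\<Prod>i\<in>insert a A. t i ^ \<alpha> i))"
  proof (rule sum.reindex_bij_witness[where i = "\<lambda>\<alpha>. (\<alpha>(a := 0), \<alpha> a)" and j = "\<lambda>(\<beta>, k).
      \<beta>(a := k)"])
    fix p assume p: "p \<in> Sigma (subset_multi_indices A d) (\<lambda>\<beta>. {..?s \<beta>})"
    obtain \<beta> k where [simp]: "p = (\<beta>, k)" by (cases p)
    have sA: "sum (\<beta>(a := k)) A = sum \<beta> A" "(\<Prod>i\<in>A. fact ((\<beta>(a := k)) i))
        = (\<Prod>i\<in>A. fact (\<beta> i) :: real)"
      "(\<Prod>i\<in>A. t i ^ (\<beta>(a := k)) i) = (\<Prod>i\<in>A. t i ^ \<beta> i)"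
      using insert.hyps by (auto intro!: sum.cong prod.cong)
    from p insert.hyps show "(case p of (\<beta>, k) \<Rightarrow> \<beta>(a := k)) \<in> subset_multi_indices (insert a A) d"
      using sA by (auto simp: subset_multi_indices_def)
    from p insert.hyps show "((case p of (\<beta>, k) \<Rightarrow> \<beta>(a := k))(a := 0), (case p of (\<beta>, k) \<Rightarrow> \<beta>(a := k))
        a) = p"
      by (auto simp: subset_multi_indices_def fun_eq_iff)
    show "fact d / ((\<Prod>i\<in>insert a A. fact ((case p of (\<beta>, k) \<Rightarrow> \<beta>(a := k)) i))
        * fact (d - (\<Sum>i\<in>insert a A. (case p of (\<beta>, k) \<Rightarrow> \<beta>(a := k)) i))) *
       c ^ (d - (\<Sum>i\<in>insert a A. (case p of (\<beta>, k) \<Rightarrow> \<beta>(a := k)) i)) *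
         (\<Prod>i\<in>insert a A. t i ^ (case p of (\<beta>, k) \<Rightarrow> \<beta>(a := k)) i)
      = (case p of (\<beta>, k) \<Rightarrow> ?G \<beta> k)"
      using insert.hyps sA by (simp add: algebra_simps)
  next
    fix \<alpha> assume \<alpha>: "\<alpha> \<in> subset_multi_indices (insert a A) d"
    have "sum (\<alpha>(a := 0)) A = sum \<alpha> A"
      using insert.hyps by (auto intro!: sum.cong)
    then show "(\<alpha>(a := 0), \<alpha> a) \<in> Sigma (subset_multi_indices A d) (\<lambda>\<beta>. {..?s \<beta>})"
      using \<alpha> insert.hyps by (auto simp: subset_multi_indices_def)
  qed (simp add: fun_eq_iff)
  finally show ?case .
qed

section \<open>Derivatives of monomials\<close>

definition monom_fun :: "('n::finite \<Rightarrow> nat) \<Rightarrow> real^'n \<Rightarrow> real" where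
  "monom_fun \<alpha> x = (\<Prod>i\<in>UNIV. x $ i ^ \<alpha> i)"

text \<open>If \<open>\<alpha> i = 0\<close>, the truncated exponent \<open>\<alpha> i - 1\<close>
  is only a default value; the factor \<open>real (\<alpha> i)\<close> makes the entry vanish, as it
  should.\<close>

definition monom_grad :: "('n::finite \<Rightarrow> nat) \<Rightarrow> real^'n \<Rightarrow> real^'n" where
  "monom_grad \<alpha> x = (\<chi> i. real (\<alpha> i) * monom_fun (\<alpha>(i := \<alpha> i - 1)) x)"

definition monom_hess :: "('n::finite \<Rightarrow> nat) \<Rightarrow> real^'n \<Rightarrow> real^'n^'n" where
  "monom_hess \<alpha> x = (\<chi> i. real (\<alpha> i) *\<^sub>R monom_grad (\<alpha>(i := \<alpha> i - 1)) x)"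

definition outer :: "real^'n \<Rightarrow> real^'m \<Rightarrow> real^'m^'n" where
  "outer u v = (\<chi> i j. u $ i * v $ j)"

lemma has_derivative_vec_inner:
  fixes f :: "real^'n \<Rightarrow> real^'m::finite"
  assumes "\<And>i. ((\<lambda>x. f x $ i) has_derivative (\<lambda>h. A $ i \<bullet> h)) (at x)"
  shows "(f has_derivative (\<lambda>h. A *v h)) (at x)"
proof (subst has_derivative_componentwise_within, intro ballI)
  fix b :: "real^'m" assume "b \<in> Basis"
  then obtain i where b: "b = axis i 1" by (auto simp: Basis_vec_def)
  show "((\<lambda>x. f x \<bullet> b) has_derivative (\<lambda>h. (A *v h) \<bullet> b)) (at x)"
    using assms[of i] by (simp add: b inner_axis matrix_vector_mul_component)
qed

lemma monom_fun_derivative: "(monom_fun \<alpha> has_derivative (\<lambda>h. monom_grad \<alpha> x \<bullet> h)) (at x)"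
proof -
  have "((\<lambda>x. \<Prod>i\<in>UNIV. x $ i ^ \<alpha> i) has_derivative
    (\<lambda>h. \<Sum>i\<in>UNIV. (of_nat (\<alpha> i) * h $ i * x $ i ^ (\<alpha> i - 1)) * (\<Prod>j\<in>UNIV - {i}. x $ j ^ \<alpha> j)))
      (at x)"
    by (intro has_derivative_prod has_derivative_power bounded_linear_imp_has_derivative
      bounded_linear_vec_nth)
  moreover have "monom_fun (\<alpha>(i := \<alpha> i - 1)) x = x $ i ^ (\<alpha> i - 1) * (\<Prod>j\<in>UNIV - {i}. x $ j ^ \<alpha> j)"
      for i
  proof -
    have "(\<Prod>j\<in>UNIV - {i}. x $ j ^ (\<alpha>(i := \<alpha> i - 1)) j) = (\<Prod>j\<in>UNIV - {i}. x $ j ^ \<alpha> j)"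
      by (intro prod.cong) auto
    then show ?thesis
      unfolding monom_fun_def by (subst prod.remove[of _ i]) auto
  qed
  moreover have "monom_fun \<alpha> = (\<lambda>x. \<Prod>i\<in>UNIV. x $ i ^ \<alpha> i)"
    by (simp add: fun_eq_iff monom_fun_def)
  ultimately show ?thesis
    by (simp add: monom_grad_def inner_vec_def mult_ac)
qed

lemma monom_grad_derivative: "(monom_grad \<alpha> has_derivative (\<lambda>h. monom_hess \<alpha> x *v h)) (at x)"
proof (rule has_derivative_vec_inner)
  fix i
  have "((\<lambda>x. real (\<alpha> i) * monom_fun (\<alpha>(i := \<alpha> i - 1)) x) has_derivative
     (\<lambda>h. real (\<alpha> i) * (monom_grad (\<alpha>(i := \<alpha> i - 1)) x \<bullet> h))) (at x)"
    by (intro has_derivative_mult_right monom_fun_derivative)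
  then show "((\<lambda>x. monom_grad \<alpha> x $ i) has_derivative (\<lambda>h. monom_hess \<alpha> x $ i \<bullet> h)) (at x)"
    by (simp add: monom_grad_def monom_hess_def)
qed

lemma transpose_monom_hess: "transpose (monom_hess \<alpha> x) = monom_hess \<alpha> x"
proof -
  have "monom_hess \<alpha> x $ i $ j = monom_hess \<alpha> x $ j $ i" for i j
    by (cases "i = j") (auto simp: monom_hess_def monom_grad_def fun_upd_twist)
  then show ?thesis by (simp add: vec_eq_iff transpose_def)
qed

lemma continuous_on_monom_fun [continuous_intros]: "continuous_on S (monom_fun \<alpha>)"
  unfolding monom_fun_def by (intro continuous_intros)

lemma continuous_on_monom_grad [continuous_intros]: "continuous_on S (monom_grad \<alpha>)"
  unfolding monom_grad_def by (intro continuous_intros)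

lemma continuous_on_monom_hess [continuous_intros]: "continuous_on S (monom_hess \<alpha>)"
  unfolding monom_hess_def by (intro continuous_intros)

lemma outer_mult_vec: "outer u v *v h = (v \<bullet> h) *\<^sub>R u"
  by (simp add: vec_eq_iff outer_def matrix_vector_mult_def inner_vec_def sum_distrib_left mult_ac)

text \<open>The Frobenius product makes a bilinear form linear in the matrix, so that continuity,
  the Cauchy-Schwarz inequality and characteristic functions apply to it.\<close>

lemma inner_outer: "T \<bullet> outer u v = u \<bullet> (T *v v)"
  by (simp add: outer_def inner_vec_def matrix_vector_mult_def sum_distrib_left mult_ac)

lemma sum_matrix_vector_mult: "(\<Sum>i\<in>A. M i :: real^'n^'m) *v h = (\<Sum>i\<in>A. M i *v h)"
  by (induction A rule: infinite_finite_induct) (auto simp: matrix_vector_mult_add_rdistrib)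

lemma symmetric_inner:
  assumes "transpose T = T"
  shows "(T *v y) \<bullet> h = y \<bullet> (T *v (h :: real^'n))"
  by (metis assms dot_lmul_matrix vector_transpose_matrix)

text \<open>The left side is the expectation of \<open>f(y) f(x)\<close>, the coefficients being
  independent with variances \<open>multinomial d \<alpha>\<close>; the multinomial theorem with
  constant term 1 sums it.\<close>

lemma kernel:
  "(\<Sum>\<alpha>\<in>multi_indices d. multinomial d \<alpha> * monom_fun \<alpha> y * monom_fun \<alpha> x) = (1 + x \<bullet> y) ^ d"
proof -
  have "(1 + x \<bullet> y) ^ d = (1 + (\<Sum>i\<in>UNIV. x $ i * y $ i)) ^ d"
    by (simp add: inner_vec_def)
  also have "\<dots> = (\<Sum>\<alpha>\<in>multi_indices d. multinomial d \<alpha> * (\<Prod>i\<in>UNIV. (x $ i * y $ i) ^ \<alpha> i))"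
    unfolding multinomial_theorem_subset by (simp add: multi_indices_eq multinomial_def)
  finally show ?thesis
    by (simp add: monom_fun_def power_mult_distrib prod.distrib mult_ac)
qed

text \<open>Obtained by differentiating both sides of \<open>kernel\<close> in \<open>x\<close>;
  \<open>kernel_hess\<close> repeats this once more. Probabilistically these are the covariances of
  \<open>f(y)\<close> with \<open>Df(x)\<close> and with \<open>D\<^sup>2f(x)\<close>.\<close>

lemma kernel_grad:
  "(\<Sum>\<alpha>\<in>multi_indices d. (multinomial d \<alpha> * monom_fun \<alpha> y) *\<^sub>R monom_grad \<alpha> x)
    = (real d * (1 + x \<bullet> y) ^ (d - 1)) *\<^sub>R y" (is "?g = ?r")
proof -
  have "((\<lambda>x. \<Sum>\<alpha>\<in>multi_indices d. multinomial d \<alpha> * monom_fun \<alpha> y * monom_fun \<alpha> x)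
     has_derivative (\<lambda>h. \<Sum>\<alpha>\<in>multi_indices d. multinomial d \<alpha> * monom_fun \<alpha> y *
       (monom_grad \<alpha> x \<bullet> h))) (at x)"
    by (intro has_derivative_sum has_derivative_mult_right monom_fun_derivative)
  moreover have "((\<lambda>x. (1 + x \<bullet> y) ^ d) has_derivative (\<lambda>h. ?r \<bullet> h)) (at x)"
    by (auto intro!: derivative_eq_intros simp: inner_commute fun_eq_iff)
  ultimately have "(\<lambda>h. \<Sum>\<alpha>\<in>multi_indices d. multinomial d \<alpha> * monom_fun \<alpha> y * (monom_grad \<alpha> x \<bullet> h))
      = (\<lambda>h. ?r \<bullet> h)"
    unfolding kernel by (rule has_derivative_unique)
  then have "\<forall>h. ?g \<bullet> h = ?r \<bullet> h"
    by (simp add: inner_sum_left fun_eq_iff)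
  then show ?thesis
    by (simp only: vector_eq_rdot)
qed

lemma kernel_hess:
  "(\<Sum>\<alpha>\<in>multi_indices d. (multinomial d \<alpha> * monom_fun \<alpha> y) *\<^sub>R monom_hess \<alpha> x)
    = (real d * real (d - 1) * (1 + x \<bullet> y) ^ (d - 2)) *\<^sub>R outer y y" (is "?g = ?r")
proof -
  have "((\<lambda>x. \<Sum>\<alpha>\<in>multi_indices d. (multinomial d \<alpha> * monom_fun \<alpha> y) *\<^sub>R monom_grad \<alpha> x)
     has_derivative (\<lambda>h. \<Sum>\<alpha>\<in>multi_indices d. (multinomial d \<alpha> * monom_fun \<alpha> y) *\<^sub>R
       (monom_hess \<alpha> x *v h))) (at x)"
    by (intro has_derivative_sum has_derivative_scaleR_right monom_grad_derivative)
  moreover have "((\<lambda>x. (real d * (1 + x \<bullet> y) ^ (d - 1)) *\<^sub>R y) has_derivative (\<lambda>h. ?r *v h)) (at x)"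
    by (auto intro!: derivative_eq_intros simp: inner_commute fun_eq_iff
      scaleR_matrix_vector_assoc[symmetric] outer_mult_vec numeral_2_eq_2)
  ultimately have "(\<lambda>h. \<Sum>\<alpha>\<in>multi_indices d. (multinomial d \<alpha>
      * monom_fun \<alpha> y) *\<^sub>R (monom_hess \<alpha> x *v h)) = (\<lambda>h. ?r *v h)"
    unfolding kernel_grad by (rule has_derivative_unique)
  then have "?g *v h = ?r *v h" for h
    by (simp add: fun_eq_iff sum_matrix_vector_mult scaleR_matrix_vector_assoc)
  then show ?thesis
    by (simp add: matrix_eq)
qed

text \<open>The sum is the variance of the linear functional
  \<open>z \<bullet> Df(x) + T \<bullet> D\<^sup>2f(x)\<close> of the coefficients. It is found by
  applying the functional to both arguments of the kernel: once in \<open>x\<close>, then the result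
  is differentiated as a function of \<open>y\<close> and evaluated at \<open>y = x\<close>. The
  factor \<open>r\<^sup>2\<close> clears the powers \<open>r ^ (d - 3)\<close> and
  \<open>r ^ (d - 4)\<close>, whose exponents are truncated for small \<open>d\<close>.\<close>

lemma functional_variance:
  fixes x z :: "real^'n::finite" and T :: "real^'n^'n"
  assumes T: "transpose T = T" and d: "d \<ge> 2"
  defines "r \<equiv> 1 + x \<bullet> x" and "\<tau> \<equiv> x \<bullet> (T *v x)"
  shows "r\<^sup>2 * (\<Sum>\<alpha>\<in>multi_indices d. multinomial d \<alpha> * (z \<bullet> monom_grad \<alpha> x + T \<bullet> monom_hess \<alpha> x)\<^sup>2)
   = real d * r ^ (d - 2) * (r ^ 3 * (z \<bullet> z) + real (d - 1) * r\<^sup>2 * (z \<bullet> x)\<^sup>2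
      + 4 * real (d - 1) * r\<^sup>2 * (z \<bullet> (T *v x)) + 2 * real (d - 1) * (real d - 2) * r * \<tau> * (z \<bullet> x)
      + 2 * real (d - 1) * r\<^sup>2 * (T \<bullet> T) + 4 * real (d - 1) * (real d - 2) * r *
        ((T *v x) \<bullet> (T *v x))
      + real (d - 1) * (real d - 2) * (real d - 3) * \<tau>\<^sup>2)"
proof -
  define c where "c \<alpha> = z \<bullet> monom_grad \<alpha> x + T \<bullet> monom_hess \<alpha> x" for \<alpha>
  let ?w = "\<lambda>\<alpha>. multinomial d \<alpha> * c \<alpha>"
  let ?u = "\<lambda>y. 1 + x \<bullet> y"
  let ?d1 = "real d" and ?d2 = "real d * real (d - 1)"
      and ?d3 = "real d * real (d - 1) * real (d - 2)"
    and ?d4 = "real d * real (d - 1) * real (d - 2) * real (d - 3)"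
  have symT: "(T *v y) \<bullet> h = y \<bullet> (T *v h)" for y h
    using T by (rule symmetric_inner)
  have Th: "y \<bullet> (T *v h) = h \<bullet> (T *v y)" and Th': "(T *v y) \<bullet> h = h \<bullet> (T *v y)" for y h
    using symT[of y h] by (simp_all add: inner_commute)
  \<comment> \<open>Covariance of the functional with \<open>f(y)\<close>; \<open>P1\<close> and
    \<open>P2\<close> below are its gradient and Hessian in \<open>y\<close>.\<close>
  have P0: "(\<Sum>\<alpha>\<in>multi_indices d. ?w \<alpha> * monom_fun \<alpha> y)
    = ?d1 * ?u y ^ (d - 1) * (z \<bullet> y) + ?d2 * ?u y ^ (d - 2) * (y \<bullet> (T *v y))" for y
  proof -
    have "(\<Sum>\<alpha>\<in>multi_indices d. ?w \<alpha> * monom_fun \<alpha> y)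
      = z \<bullet> (\<Sum>\<alpha>\<in>multi_indices d. (multinomial d \<alpha> * monom_fun \<alpha> y) *\<^sub>R monom_grad \<alpha> x)
      + T \<bullet> (\<Sum>\<alpha>\<in>multi_indices d. (multinomial d \<alpha> * monom_fun \<alpha> y) *\<^sub>R monom_hess \<alpha> x)"
      by (simp add: inner_sum_right c_def sum.distrib[symmetric] algebra_simps)
    then show ?thesis
      unfolding kernel_grad kernel_hess by (simp add: inner_outer)
  qed
  let ?G = "\<lambda>y. (?d1 * ?u y ^ (d - 1)) *\<^sub>R z + (?d2 * ?u y ^ (d - 2) * (z \<bullet> y)) *\<^sub>R x
    + (2 * ?d2 * ?u y ^ (d - 2)) *\<^sub>R (T *v y) + (?d3 * ?u y ^ (d - 3) * (y \<bullet> (T *v y))) *\<^sub>R x"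
  have linT: "((\<lambda>y. T *v y) has_derivative (\<lambda>h. T *v h)) (at y)" for y
    by (intro bounded_linear_imp_has_derivative matrix_vector_mul_bounded_linear)
  have P1: "(\<Sum>\<alpha>\<in>multi_indices d. ?w \<alpha> *\<^sub>R monom_grad \<alpha> y) = ?G y" for y
  proof -
    have D1: "((\<lambda>y. \<Sum>\<alpha>\<in>multi_indices d. ?w \<alpha> * monom_fun \<alpha> y)
       has_derivative (\<lambda>h. \<Sum>\<alpha>\<in>multi_indices d. ?w \<alpha> * (monom_grad \<alpha> y \<bullet> h))) (at y)"
      by (intro has_derivative_sum has_derivative_mult_right monom_fun_derivative)
    have D2: "((\<lambda>y. ?d1 * ?u y ^ (d - 1) * (z \<bullet> y) + ?d2 * ?u y ^ (d - 2) * (y \<bullet> (T *v y)))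
       has_derivative (\<lambda>h. ?G y \<bullet> h)) (at y)"
    proof (rule has_derivative_eq_rhs)
      show "((\<lambda>y. ?d1 * ?u y ^ (d - 1) * (z \<bullet> y) + ?d2 * ?u y ^ (d - 2) * (y \<bullet> (T *v y)))
       has_derivative (\<lambda>h. ?d1 * ?u y ^ (d - 1) * (z \<bullet> h) + ?d1 *
         (real (d - 1) * (x \<bullet> h) * ?u y ^ (d - 2)) * (z \<bullet> y)
         + (?d2 * ?u y ^ (d - 2) * (y \<bullet> (T *v h) + h \<bullet> (T *v y))
           + ?d2 * (real (d - 2) * (x \<bullet> h) * ?u y ^ (d - 3)) * (y \<bullet> (T *v y))))) (at y)"
        by (auto intro!: derivative_eq_intros linT simp: fun_eq_iff numeral_2_eq_2 numeral_3_eq_3)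
    next
      show "(\<lambda>h. ?d1 * ?u y ^ (d - 1) * (z \<bullet> h) + ?d1 * (real (d - 1) * (x \<bullet> h) * ?u y ^ (d - 2))
          * (z \<bullet> y)
         + (?d2 * ?u y ^ (d - 2) * (y \<bullet> (T *v h) + h \<bullet> (T *v y))
           + ?d2 * (real (d - 2) * (x \<bullet> h) * ?u y ^ (d - 3)) * (y \<bullet> (T *v y)))) = (\<lambda>h. ?G y \<bullet> h)"
      proof
        fix h
        have "y \<bullet> (T *v h) = h \<bullet> (T *v y)" "(T *v y) \<bullet> h = h \<bullet> (T *v y)"
          by (rule Th Th')+
        then show "?d1 * ?u y ^ (d - 1) * (z \<bullet> h) + ?d1 * (real (d - 1) * (x \<bullet> h) * ?u y ^ (d - 2))
            * (z \<bullet> y)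
         + (?d2 * ?u y ^ (d - 2) * (y \<bullet> (T *v h) + h \<bullet> (T *v y))
           + ?d2 * (real (d - 2) * (x \<bullet> h) * ?u y ^ (d - 3)) * (y \<bullet> (T *v y))) = ?G y \<bullet> h"
          by (simp add: inner_add_left algebra_simps)
      qed
    qed
    have "(\<lambda>h. \<Sum>\<alpha>\<in>multi_indices d. ?w \<alpha> * (monom_grad \<alpha> y \<bullet> h)) = (\<lambda>h. ?G y \<bullet> h)"
      by (rule has_derivative_unique[OF D1[unfolded P0] D2])
    then have "\<forall>h. (\<Sum>\<alpha>\<in>multi_indices d. ?w \<alpha> *\<^sub>R monom_grad \<alpha> y) \<bullet> h = ?G y \<bullet> h"
      unfolding inner_sum_left fun_eq_iff by simp
    then show ?thesis
      by (simp only: vector_eq_rdot)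
  qed
  let ?H = "\<lambda>y. (?d2 * ?u y ^ (d - 2)) *\<^sub>R outer z x + (?d2 * ?u y ^ (d - 2)) *\<^sub>R outer x z
    + (?d3 * ?u y ^ (d - 3) * (z \<bullet> y)) *\<^sub>R outer x x
    + (2 * ?d2 * ?u y ^ (d - 2)) *\<^sub>R T + (2 * ?d3 * ?u y ^ (d - 3)) *\<^sub>R outer (T *v y) x
    + (2 * ?d3 * ?u y ^ (d - 3)) *\<^sub>R outer x (T *v y)
    + (?d4 * ?u y ^ (d - 4) * (y \<bullet> (T *v y))) *\<^sub>R outer x x"
  have P2: "(\<Sum>\<alpha>\<in>multi_indices d. ?w \<alpha> *\<^sub>R monom_hess \<alpha> y) = ?H y" for y
  proof -
    have D1: "((\<lambda>y. \<Sum>\<alpha>\<in>multi_indices d. ?w \<alpha> *\<^sub>R monom_grad \<alpha> y)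
       has_derivative (\<lambda>h. \<Sum>\<alpha>\<in>multi_indices d. ?w \<alpha> *\<^sub>R (monom_hess \<alpha> y *v h))) (at y)"
      by (intro has_derivative_sum has_derivative_scaleR_right monom_grad_derivative)
    have D2: "(?G has_derivative (\<lambda>h. ?H y *v h)) (at y)"
    proof (rule has_derivative_eq_rhs)
      show "(?G has_derivative (\<lambda>h. (?d1 * (real (d - 1) * (x \<bullet> h) * ?u y ^ (d - 2))) *\<^sub>R z
        + (?d2 * ?u y ^ (d - 2) * (z \<bullet> h) + ?d2 * (real (d - 2) * (x \<bullet> h) * ?u y ^ (d - 3)) *
          (z \<bullet> y)) *\<^sub>R x
        + ((2 * ?d2 * ?u y ^ (d - 2)) *\<^sub>R (T *v h) +
          (2 * ?d2 * (real (d - 2) * (x \<bullet> h) * ?u y ^ (d - 3))) *\<^sub>R (T *v y))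
        + (?d3 * ?u y ^ (d - 3) * (y \<bullet> (T *v h) + h \<bullet> (T *v y)) + ?d3 *
          (real (d - 3) * (x \<bullet> h) * ?u y ^ (d - 4)) * (y \<bullet> (T *v y))) *\<^sub>R x)) (at y)"
        by (auto intro!: derivative_eq_intros linT simp: fun_eq_iff numeral_2_eq_2 numeral_3_eq_3
          eval_nat_numeral)
    next
      show "(\<lambda>h. (?d1 * (real (d - 1) * (x \<bullet> h) * ?u y ^ (d - 2))) *\<^sub>R z
        + (?d2 * ?u y ^ (d - 2) * (z \<bullet> h) + ?d2 * (real (d - 2) * (x \<bullet> h) * ?u y ^ (d - 3)) *
          (z \<bullet> y)) *\<^sub>R x
        + ((2 * ?d2 * ?u y ^ (d - 2)) *\<^sub>R (T *v h) +
          (2 * ?d2 * (real (d - 2) * (x \<bullet> h) * ?u y ^ (d - 3))) *\<^sub>R (T *v y))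
        + (?d3 * ?u y ^ (d - 3) * (y \<bullet> (T *v h) + h \<bullet> (T *v y)) + ?d3 *
          (real (d - 3) * (x \<bullet> h) * ?u y ^ (d - 4)) * (y \<bullet> (T *v y))) *\<^sub>R x) = (\<lambda>h. ?H y *v h)"
      proof
        fix h
        have *: "y \<bullet> (T *v h) = h \<bullet> (T *v y)" "(T *v y) \<bullet> h = h \<bullet> (T *v y)"
          by (rule Th Th')+
        show "(?d1 * (real (d - 1) * (x \<bullet> h) * ?u y ^ (d - 2))) *\<^sub>R z
        + (?d2 * ?u y ^ (d - 2) * (z \<bullet> h) + ?d2 * (real (d - 2) * (x \<bullet> h) * ?u y ^ (d - 3)) *
          (z \<bullet> y)) *\<^sub>R x
        + ((2 * ?d2 * ?u y ^ (d - 2)) *\<^sub>R (T *v h) +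
          (2 * ?d2 * (real (d - 2) * (x \<bullet> h) * ?u y ^ (d - 3))) *\<^sub>R (T *v y))
        + (?d3 * ?u y ^ (d - 3) * (y \<bullet> (T *v h) + h \<bullet> (T *v y)) + ?d3 *
          (real (d - 3) * (x \<bullet> h) * ?u y ^ (d - 4)) * (y \<bullet> (T *v y))) *\<^sub>R x = ?H y *v h"
          unfolding matrix_vector_mult_add_rdistrib scaleR_matrix_vector_assoc[symmetric]
            outer_mult_vec *
          by (simp add: algebra_simps)
      qed
    qed
    have "(\<lambda>h. \<Sum>\<alpha>\<in>multi_indices d. ?w \<alpha> *\<^sub>R (monom_hess \<alpha> y *v h)) = (\<lambda>h. ?H y *v h)"
      by (rule has_derivative_unique[OF D1[unfolded P1] D2])
    then have "(\<Sum>\<alpha>\<in>multi_indices d. ?w \<alpha> *\<^sub>R monom_hess \<alpha> y) *v h = ?H y *v h" for h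
      by (simp add: fun_eq_iff sum_matrix_vector_mult scaleR_matrix_vector_assoc)
    then show ?thesis
      by (simp add: matrix_eq)
  qed
  have zx: "(T *v z) \<bullet> x = (T *v x) \<bullet> z"
    using symT[of z x] by (simp add: inner_commute)
  have "(\<Sum>\<alpha>\<in>multi_indices d. multinomial d \<alpha> * (c \<alpha>)\<^sup>2)
    = z \<bullet> (\<Sum>\<alpha>\<in>multi_indices d. ?w \<alpha> *\<^sub>R monom_grad \<alpha> x) + T \<bullet>
      (\<Sum>\<alpha>\<in>multi_indices d. ?w \<alpha> *\<^sub>R monom_hess \<alpha> x)"
    by (simp add: inner_sum_right sum.distrib[symmetric])
      (intro sum.cong refl; simp add: c_def power2_eq_square algebra_simps)
  also have "\<dots> = ?d1 * r ^ (d - 1) * (z \<bullet> z) + ?d2 * r ^ (d - 2) * (z \<bullet> x)\<^sup>2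
     + 4 * ?d2 * r ^ (d - 2) * (z \<bullet> (T *v x)) + 2 * ?d3 * r ^ (d - 3) * \<tau> * (z \<bullet> x)
     + 2 * ?d2 * r ^ (d - 2) * (T \<bullet> T) + 4 * ?d3 * r ^ (d - 3) * ((T *v x) \<bullet> (T *v x))
     + ?d4 * r ^ (d - 4) * \<tau>\<^sup>2"
    unfolding P1 P2 r_def \<tau>_def
    by (simp add: inner_add_right inner_outer zx symT[symmetric] inner_commute[of x z]
        power2_eq_square algebra_simps)
  finally have V: "(\<Sum>\<alpha>\<in>multi_indices d. multinomial d \<alpha> * (c \<alpha>)\<^sup>2) = \<dots>" .
  have p1: "r ^ (d - 1) = r ^ (d - 2) * r"
    using d by (auto dest!: le_Suc_ex simp: mult.commute)
  \<comment> \<open>For \<open>d = 2\<close> the exponent \<open>d - 3\<close> is truncated to 0,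
    but the factor \<open>d - 2\<close> vanishes; \<open>p4\<close> handles \<open>d = 2\<close> and
    \<open>d = 3\<close> likewise.\<close>
  have p3: "real (d - 2) * r ^ (d - 3) * r = (real d - 2) * r ^ (d - 2)"
  proof (cases "d = 2")
    case False
    then obtain k where "d = k + 3" using d
        by (metis add.commute le_antisym less_eqE not_less_eq_eq numeral_2_eq_2 numeral_3_eq_3)
    then show ?thesis by simp
  qed simp
  have p4: "real (d - 2) * real (d - 3) * r ^ (d - 4) * r\<^sup>2
      = (real d - 2) * (real d - 3) * r ^ (d - 2)"
  proof -
    consider "d = 2" | "d = 3" | "d \<ge> 4" using d by linarith
    then show ?thesis
    proof cases
      case 3
      then obtain k where "d = k + 4" by (metis add.commute le_iff_add)
      then show ?thesis by (simp add: power_add power2_eq_square)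
    qed auto
  qed
  define A B C where "A = r ^ (d - 2)" and "B = real (d - 2) * r ^ (d - 3)"
    and "C = real (d - 2) * real (d - 3) * r ^ (d - 4)"
  let ?D = "real d" and ?E = "real (d - 1)"
  have B: "B * r = (?D - 2) * A" and C: "C * r\<^sup>2 = (?D - 2) * (?D - 3) * A"
    using p3 p4 by (simp_all add: A_def B_def C_def)
  have "r\<^sup>2 * (\<Sum>\<alpha>\<in>multi_indices d. multinomial d \<alpha> * (c \<alpha>)\<^sup>2)
    = r\<^sup>2 * (?D * A * r * (z \<bullet> z) + ?D * ?E * A * (z \<bullet> x)\<^sup>2 + 4 * ?D * ?E * A * (z \<bullet> (T *v x))
      + 2 * ?D * ?E * A * (T \<bullet> T)) + ?D * ?E * r * (B * r) *
        (2 * \<tau> * (z \<bullet> x) + 4 * ((T *v x) \<bullet> (T *v x)))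
      + ?D * ?E * (C * r\<^sup>2) * \<tau>\<^sup>2"
    unfolding V p1 by (simp add: A_def B_def C_def algebra_simps power2_eq_square)
  also have "\<dots> = ?D * A * (r ^ 3 * (z \<bullet> z) + ?E * r\<^sup>2 * (z \<bullet> x)\<^sup>2
      + 4 * ?E * r\<^sup>2 * (z \<bullet> (T *v x)) + 2 * ?E * (?D - 2) * r * \<tau> * (z \<bullet> x)
      + 2 * ?E * r\<^sup>2 * (T \<bullet> T) + 4 * ?E * (?D - 2) * r * ((T *v x) \<bullet> (T *v x))
      + ?E * (?D - 2) * (?D - 3) * \<tau>\<^sup>2)"
    unfolding B C by (simp add: power2_eq_square power3_eq_cube) algebra
  finally show ?thesis
    by (simp only: c_def A_def)
qed

subsection \<open>Gaussian measures and uniqueness of characteristic functions\<close>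

lemma PiM_density_lborel:
  fixes f :: "'i \<Rightarrow> real \<Rightarrow> real"
  assumes I: "finite I" and [measurable]: "\<And>i. f i \<in> borel_measurable borel"
    and f: "\<And>i x. 0 \<le> f i x"
    and sf: "\<And>i. sigma_finite_measure (density lborel (f i))"
  shows "PiM I (\<lambda>i. density lborel (f i)) = density (PiM I (\<lambda>_. lborel)) (\<lambda>x. \<Prod>i\<in>I. f i (x i))"
proof -
  interpret L: product_sigma_finite "\<lambda>_::'i. lborel :: real measure"
    by standard
  interpret D: product_sigma_finite "\<lambda>i. density lborel (f i)"
    using sf by (rule product_sigma_finite.intro)
  show ?thesis
  proof (rule D.PiM_eqI[OF I, symmetric])
    show "sets (density (PiM I (\<lambda>_. lborel)) (\<lambda>x. \<Prod>i\<in>I. f i (x i)))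
        = sets (PiM I (\<lambda>i. density lborel (f i)))"
      unfolding sets_density by (rule sets_PiM_cong) auto
    fix A assume A: "\<And>i. i \<in> I \<Longrightarrow> A i \<in> sets (density lborel (f i))"
    have [measurable]: "Pi\<^sub>E I A \<in> sets (PiM I (\<lambda>_. lborel))"
      using A I by (intro sets_PiM_I_finite) auto
    have "emeasure (density (PiM I (\<lambda>_. lborel)) (\<lambda>x. \<Prod>i\<in>I. f i (x i))) (Pi\<^sub>E I A)
      = (\<integral>\<^sup>+ x. ennreal (\<Prod>i\<in>I. f i (x i)) * indicator (Pi\<^sub>E I A) x \<partial>PiM I (\<lambda>_. lborel))"
      by (intro emeasure_density) auto
    also have "\<dots> = (\<integral>\<^sup>+ x. (\<Prod>i\<in>I. ennreal (f i (x i)) * indicator (A i) (x i)) \<partial>PiM I (\<lambda>_. lborel))"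
    proof (intro nn_integral_cong)
      fix x assume "x \<in> space (PiM I (\<lambda>_. lborel :: real measure))"
      then have "x \<in> extensional I" by (simp add: space_PiM PiE_def)
      then have "indicator (Pi\<^sub>E I A) x = (\<Prod>i\<in>I. indicator (A i) (x i) :: ennreal)"
        using I by (auto simp: indicator_def PiE_def Pi_def prod_zero_iff)
      then show "ennreal (\<Prod>i\<in>I. f i (x i)) * indicator (Pi\<^sub>E I A) x
          = (\<Prod>i\<in>I. ennreal (f i (x i)) * indicator (A i) (x i))"
        using f by (simp add: prod.distrib prod_ennreal)
    qed
    also have "\<dots> = (\<Prod>i\<in>I. emeasure (density lborel (f i)) (A i))"
      using A by (subst L.product_nn_integral_prod[OF I])
        (auto intro!: prod.cong simp: emeasure_density)
    finally show "emeasure (density (PiM I (\<lambda>_. lborel)) (\<lambda>x. \<Prod>i\<in>I. f i (x i))) (Pi\<^sub>E I A)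
      = (\<Prod>i\<in>I. emeasure (density lborel (f i)) (A i))" .
  qed
qed

lemma borel_measurable_cis [measurable]: "cis \<in> borel_measurable borel"
  by (intro borel_measurable_continuous_onI continuous_on_cis continuous_on_id)

lemma prob_space_std_normal: "prob_space std_normal_distribution"
  by (rule prob_space_normal_density) simp

lemma normal_density_scale:
  assumes "\<sigma> > 0"
  shows "density lborel (normal_density 0 \<sigma>) = distr std_normal_distribution borel (\<lambda>x. \<sigma> * x)"
proof -
  interpret prob_space std_normal_distribution by (rule prob_space_std_normal)
  have "distributed std_normal_distribution lborel (\<lambda>x. x) (normal_density 0 1)"
    by (simp add: distributed_def distr_id2 sets_borel)
  from normal_density_affine[OF this, of \<sigma> 0] assms
  have "density lborel (normal_density 0 \<sigma>) = distr std_normal_distribution lborel (\<lambda>x. \<sigma> * x)"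
    by (simp add: distributed_def)
  also have "\<dots> = distr std_normal_distribution borel (\<lambda>x. \<sigma> * x)"
    by (rule distr_cong) auto
  finally show ?thesis .
qed

lemma cis_normal:
  assumes "\<sigma> > 0"
  shows "(\<integral>x. cis (c * x) \<partial>density lborel (normal_density 0 \<sigma>)) = of_real (exp (- (\<sigma>\<^sup>2 * c\<^sup>2) / 2))"
proof -
  have "(\<integral>x. cis (c * x) \<partial>density lborel (normal_density 0 \<sigma>))
      = (\<integral>x. cis ((c * \<sigma>) * x) \<partial>std_normal_distribution)"
    unfolding normal_density_scale[OF assms] by (subst integral_distr) (auto simp: mult_ac)
  also have "\<dots> = char std_normal_distribution (c * \<sigma>)"
    by (simp add: char_def cis_conv_exp)
  finally show ?thesis
    by (simp add: char_std_normal_distribution power_mult_distrib mult_ac)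
qed

lemma cis_PiM_normal:
  assumes I: "finite I" and \<sigma>: "\<And>i. \<sigma> i > 0"
  shows "(\<integral>f. cis (\<Sum>i\<in>I. c i * f i) \<partial>PiM I (\<lambda>i. density lborel (normal_density 0 (\<sigma> i))))
    = of_real (exp (- (\<Sum>i\<in>I. (\<sigma> i)\<^sup>2 * (c i)\<^sup>2) / 2))"
proof -
  interpret D: product_sigma_finite "\<lambda>i. density lborel (normal_density 0 (\<sigma> i))"
    using prob_space_normal_density[OF \<sigma>]
      by (intro product_sigma_finite.intro prob_space_imp_sigma_finite)
  have int: "integrable (density lborel (normal_density 0 (\<sigma> i))) (\<lambda>x. cis (c i * x))" for i
  proof -
    interpret prob_space "density lborel (normal_density 0 (\<sigma> i))"
      by (rule prob_space_normal_density[OF \<sigma>])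
    show ?thesis by (intro integrable_const_bound[of _ 1]) auto
  qed
  have cis_sum: "cis (\<Sum>i\<in>I. g i) = (\<Prod>i\<in>I. cis (g i))" for g
    using I by (induction I rule: finite_induct) (auto simp: cis_mult[symmetric])
  have "(\<integral>f. cis (\<Sum>i\<in>I. c i * f i) \<partial>PiM I (\<lambda>i. density lborel (normal_density 0 (\<sigma> i))))
    = (\<Prod>i\<in>I. \<integral>x. cis (c i * x) \<partial>density lborel (normal_density 0 (\<sigma> i)))"
    unfolding cis_sum by (rule D.product_integral_prod[OF I int])
  also have "\<dots> = (\<Prod>i\<in>I. of_real (exp (- ((\<sigma> i)\<^sup>2 * (c i)\<^sup>2) / 2)))"
    by (simp add: cis_normal \<sigma>)
  also have "\<dots> = of_real (exp (- (\<Sum>i\<in>I. (\<sigma> i)\<^sup>2 * (c i)\<^sup>2) / 2))"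
    by (simp add: exp_sum I sum_divide_distrib sum_negf[symmetric] del: sum_negf)
  finally show ?thesis .
qed

section \<open>The standard Gaussian measure on a Euclidean space\<close>

definition std_gaussian_density :: "'a::euclidean_space \<Rightarrow> real" where
  "std_gaussian_density x = (2 * pi) powr (- real DIM('a) / 2) * exp (- (norm x)\<^sup>2 / 2)"

definition std_gaussian :: "'a::euclidean_space measure" where
  "std_gaussian = density lborel std_gaussian_density"

lemma borel_measurable_std_gaussian_density [measurable]:
  "(std_gaussian_density :: 'a::euclidean_space \<Rightarrow> real) \<in> borel_measurable borel"
  unfolding std_gaussian_density_def by measurable

lemma std_gaussian_density_nonneg: "0 \<le> std_gaussian_density x"
  by (simp add: std_gaussian_density_def)

lemma sets_std_gaussian [simp, measurable_cong]: "sets std_gaussian = sets borel"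
  by (simp add: std_gaussian_def)

lemma space_std_gaussian [simp]: "space std_gaussian = UNIV"
  by (simp add: std_gaussian_def)

lemma std_gaussian_density_prod:
  "std_gaussian_density (x :: 'a::euclidean_space) = (\<Prod>b\<in>Basis. std_normal_density (x \<bullet> b))"
proof -
  have "(\<Prod>b\<in>Basis. std_normal_density (x \<bullet> b))
      = (1 / sqrt (2 * pi)) ^ DIM('a) * (\<Prod>b\<in>(Basis :: 'a set). exp (- (x \<bullet> b)\<^sup>2 / 2))"
    unfolding std_normal_density_def prod.distrib by simp
  also have "(\<Prod>b\<in>(Basis :: 'a set). exp (- (x \<bullet> b)\<^sup>2 / 2)) = exp (- (norm x)\<^sup>2 / 2)"
    by (simp add: exp_sum[symmetric] norm_eq_sqrt_inner euclidean_inner[of x x] power2_eq_square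
      sum_nonneg
        sum_divide_distrib[symmetric] sum_negf)
  also have "(1 / sqrt (2 * pi)) ^ DIM('a) = (2 * pi) powr (- real DIM('a) / 2)"
  proof -
    have "1 / sqrt (2 * pi) = (2 * pi) powr (- 1 / 2)"
      by (simp add: powr_half_sqrt[symmetric] powr_minus_divide)
    then show ?thesis
      by (simp add: powr_realpow[symmetric] powr_powr)
  qed
  finally show ?thesis by (simp add: std_gaussian_density_def)
qed

text \<open>The density factors over an orthonormal basis, so the coordinates are independent
  standard normals; in this form one-dimensional facts about products and characteristic functions
  carry over.\<close>

lemma std_gaussian_eq_distr:
  "(std_gaussian :: 'a::euclidean_space measure)
    = distr (PiM Basis (\<lambda>_. std_normal_distribution)) borel (\<lambda>f. \<Sum>b\<in>Basis. f b *\<^sub>R b)"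
proof -
  have m [measurable]: "(\<lambda>f. \<Sum>b\<in>Basis. f b *\<^sub>R (b::'a)) \<in> PiM Basis (\<lambda>_. lborel) \<rightarrow>\<^sub>M borel"
    by measurable
  have coord: "(\<Sum>b\<in>Basis. f b *\<^sub>R b) \<bullet> c = f c" if "c \<in> Basis" for f :: "'a \<Rightarrow> real" and c
    using that by (simp add: inner_sum_left inner_Basis if_distrib sum.delta cong: if_cong)
  have "PiM (Basis :: 'a set) (\<lambda>_. std_normal_distribution)
    = density (PiM Basis (\<lambda>_. lborel)) (\<lambda>f. \<Prod>b\<in>Basis. std_normal_density (f b))"
    by (rule PiM_density_lborel)
      (auto intro!: prob_space_imp_sigma_finite prob_space_std_normal)
  also have "\<dots> = density (PiM Basis (\<lambda>_. lborel))
      (\<lambda>f. std_gaussian_density (\<Sum>b\<in>Basis. f b *\<^sub>R (b::'a)))"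
    unfolding std_gaussian_density_prod
      by (intro arg_cong2[where f = density] refl ext) (simp add: coord)
  finally show ?thesis
    unfolding std_gaussian_def lborel_eq[where 'a = 'a]
    by (subst density_distr[OF _ m]) auto
qed

lemma prob_space_std_gaussian: "prob_space std_gaussian"
proof -
  have "prob_space (PiM (Basis :: 'a set) (\<lambda>_. std_normal_distribution))"
    by (rule prob_space_PiM) (rule prob_space_std_normal)
  then show ?thesis
    unfolding std_gaussian_eq_distr by (rule prob_space.prob_space_distr) measurable
qed

lemma cis_std_gaussian:
  fixes t :: "'a::euclidean_space"
  shows "(\<integral>x. cis (t \<bullet> x) \<partial>std_gaussian) = of_real (exp (- (norm t)\<^sup>2 / 2))"
proof -
  have "(\<integral>x. cis (t \<bullet> x) \<partial>std_gaussian)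
     = (\<integral>f. cis (\<Sum>b\<in>Basis. (t \<bullet> b) * f b) \<partial>PiM (Basis :: 'a set)
       (\<lambda>b. density lborel (normal_density 0 ((\<lambda>_. 1) b))))"
    unfolding std_gaussian_eq_distr
    by (subst integral_distr) (auto simp: inner_sum_right mult.commute)
  also have "\<dots> = of_real (exp (- (\<Sum>b\<in>Basis. 1\<^sup>2 * (t \<bullet> b)\<^sup>2) / 2))"
    by (rule cis_PiM_normal) auto
  finally show ?thesis
    by (simp add: norm_eq_sqrt_inner euclidean_inner[of t t] power2_eq_square sum_nonneg)
qed

lemma integrable_std_gaussian_density: "integrable lborel std_gaussian_density"
proof -
  interpret prob_space "std_gaussian :: 'a measure" by (rule prob_space_std_gaussian)
  have "integrable (std_gaussian :: 'a measure) (\<lambda>_. 1 :: real)" by simp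
  then show ?thesis
    unfolding std_gaussian_def
      by (subst (asm) integrable_density) (auto simp: std_gaussian_density_nonneg)
qed

text \<open>Adding Gaussian noise to a law \<open>M\<close> gives a density that involves
  \<open>M\<close> only through its characteristic function: the Gaussian kernel is itself the
  characteristic function of a Gaussian, and Fubini moves the integral over \<open>M\<close>
  inside.\<close>

lemma gaussian_smoothing:
  fixes M :: "'a::euclidean_space measure"
  assumes M: "finite_measure M" and sets [measurable_cong]: "sets M = sets borel"
    and \<sigma>: "\<sigma> > 0" and [measurable]: "h \<in> borel_measurable borel"
  shows "(\<integral>\<^sup>+ x. (\<integral>\<^sup>+ w. h (x + \<sigma> *\<^sub>R w) \<partial>std_gaussian) \<partial>M)
    = (\<integral>\<^sup>+ y. h y * ennreal ((2 * pi) powr (- real DIM('a) / 2) / \<sigma> ^ DIM('a) *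
        Re (\<integral>z. cis ((y /\<^sub>R \<sigma>) \<bullet> z) * cnj (\<integral>x. cis ((z /\<^sub>R \<sigma>) \<bullet> x) \<partial>M) \<partial>std_gaussian)) \<partial>lborel)"
proof -
  interpret M: finite_measure M by fact
  interpret G: prob_space "std_gaussian :: 'a measure" by (rule prob_space_std_gaussian)
  interpret pair_sigma_finite M lborel
    by (simp add: pair_sigma_finite.intro M.sigma_finite_measure_axioms sigma_finite_lborel)
  interpret MG: pair_sigma_finite "std_gaussian :: 'a measure" M
    by (simp add: pair_sigma_finite.intro M.sigma_finite_measure_axioms
      G.sigma_finite_measure_axioms)
  have spM: "space M = UNIV" using sets_eq_imp_space_eq[OF sets] by simp
  let ?C = "(2 * pi) powr (- real DIM('a) / 2) / \<sigma> ^ DIM('a)"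
  let ?K = "\<lambda>y x :: 'a. exp (- (norm ((y - x) /\<^sub>R \<sigma>))\<^sup>2 / 2)"
  have inner: "(\<integral>\<^sup>+ w. h (x + \<sigma> *\<^sub>R w) \<partial>std_gaussian)
      = (\<integral>\<^sup>+ y. h y * ennreal (?C * ?K y x) \<partial>lborel)" for x
  proof -
    have "(\<integral>\<^sup>+ y. h y * ennreal (?C * ?K y x) \<partial>lborel)
      = (\<integral>\<^sup>+ y. h y * ennreal (?C * ?K y x) \<partial>density (distr lborel borel (\<lambda>w. x + \<sigma> *\<^sub>R w))
        (\<lambda>_. \<bar>\<sigma>\<bar> ^ DIM('a)))"
      using lborel_affine[of \<sigma> x] \<sigma> by simp
    also have "\<dots> = (\<integral>\<^sup>+ w. ennreal (\<sigma> ^ DIM('a))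
        * (h (x + \<sigma> *\<^sub>R w) * ennreal (?C * ?K (x + \<sigma> *\<^sub>R w) x)) \<partial>lborel)"
      using \<sigma> by (simp add: nn_integral_density nn_integral_distr del: add_diff_cancel_left'
        scaleR_scaleR)
    also have "\<dots> = (\<integral>\<^sup>+ w. ennreal (std_gaussian_density w) * h (x + \<sigma> *\<^sub>R w) \<partial>lborel)"
    proof (intro nn_integral_cong)
      fix w :: 'a
      have "ennreal (\<sigma> ^ DIM('a)) * ennreal (?C * ?K (x + \<sigma> *\<^sub>R w) x)
          = ennreal (std_gaussian_density w)"
        using \<sigma> by (subst ennreal_mult[symmetric]) (auto simp: std_gaussian_density_def)
      then show "ennreal (\<sigma> ^ DIM('a)) * (h (x + \<sigma> *\<^sub>R w) * ennreal (?C * ?K (x + \<sigma> *\<^sub>R w) x))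
          = ennreal (std_gaussian_density w) * h (x + \<sigma> *\<^sub>R w)"
        by (metis (no_types, lifting) mult.left_commute mult.commute)
    qed
    also have "\<dots> = (\<integral>\<^sup>+ w. h (x + \<sigma> *\<^sub>R w) \<partial>std_gaussian)"
      unfolding std_gaussian_def by (subst nn_integral_density) auto
    finally show ?thesis ..
  qed
  have outer: "(\<integral>\<^sup>+ x. ennreal (?C * ?K y x) \<partial>M) = ennreal (?C *
        Re (\<integral>z. cis ((y /\<^sub>R \<sigma>) \<bullet> z) * cnj (\<integral>x. cis ((z /\<^sub>R \<sigma>) \<bullet> x) \<partial>M) \<partial>std_gaussian))" for y
  proof -
    have K: "complex_of_real (?K y x)
        = (\<integral>z. cis ((y /\<^sub>R \<sigma>) \<bullet> z) * cnj (cis ((z /\<^sub>R \<sigma>) \<bullet> x)) \<partial>std_gaussian)" for x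
    proof -
      have "complex_of_real (?K y x) = (\<integral>z. cis (((y - x) /\<^sub>R \<sigma>) \<bullet> z) \<partial>std_gaussian)"
        by (rule cis_std_gaussian[symmetric])
      also have "\<dots> = (\<integral>z. cis ((y /\<^sub>R \<sigma>) \<bullet> z) * cnj (cis ((z /\<^sub>R \<sigma>) \<bullet> x)) \<partial>std_gaussian)"
        by (intro Bochner_Integration.integral_cong refl)
          (simp add: cis_cnj cis_mult inner_diff_left inner_commute algebra_simps)
      finally show ?thesis .
    qed
    have int: "integrable (std_gaussian \<Otimes>\<^sub>M M) (\<lambda>(z, x). cis ((y /\<^sub>R \<sigma>) \<bullet> z)
        * cnj (cis ((z /\<^sub>R \<sigma>) \<bullet> x)))"
    proof -
      interpret P: finite_measure "(std_gaussian :: 'a measure) \<Otimes>\<^sub>M M"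
        by (intro finite_measure_pair_measure M G.finite_measure_axioms)
      show ?thesis
        by (intro P.integrable_const_bound[of _ 1]) (auto simp: norm_mult split_beta' cis_cnj)
    qed
    have "complex_of_real (\<integral>x. ?K y x \<partial>M) = (\<integral>x. complex_of_real (?K y x) \<partial>M)"
      by simp
    also have "\<dots> = (\<integral>z. (\<integral>x. cis ((y /\<^sub>R \<sigma>) \<bullet> z) * cnj (cis ((z /\<^sub>R \<sigma>) \<bullet> x)) \<partial>M) \<partial>std_gaussian)"
      unfolding K by (rule MG.Fubini_integral[OF int])
    also have "\<dots> = (\<integral>z. cis ((y /\<^sub>R \<sigma>) \<bullet> z) * cnj (\<integral>x. cis ((z /\<^sub>R \<sigma>) \<bullet> x) \<partial>M) \<partial>std_gaussian)"
      by simp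
    finally have "(\<integral>x. ?K y x \<partial>M)
        = Re (\<integral>z. cis ((y /\<^sub>R \<sigma>) \<bullet> z) * cnj (\<integral>x. cis ((z /\<^sub>R \<sigma>) \<bullet> x) \<partial>M) \<partial>std_gaussian)"
      by (metis Re_complex_of_real)
    moreover have "integrable M (\<lambda>x. ?K y x)"
      by (intro M.integrable_const_bound[of _ 1]) auto
    ultimately show ?thesis
      using \<sigma> by (subst nn_integral_eq_integral) auto
  qed
  have "(\<integral>\<^sup>+ x. (\<integral>\<^sup>+ w. h (x + \<sigma> *\<^sub>R w) \<partial>std_gaussian) \<partial>M)
    = (\<integral>\<^sup>+ x. (\<integral>\<^sup>+ y. h y * ennreal (?C * ?K y x) \<partial>lborel) \<partial>M)"
    by (simp only: inner)
  also have "\<dots> = (\<integral>\<^sup>+ y. (\<integral>\<^sup>+ x. h y * ennreal (?C * ?K y x) \<partial>M) \<partial>lborel)"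
    by (rule Fubini'[symmetric]) measurable
  also have "\<dots> = (\<integral>\<^sup>+ y. h y * (\<integral>\<^sup>+ x. ennreal (?C * ?K y x) \<partial>M) \<partial>lborel)"
    by (intro nn_integral_cong nn_integral_cmult) measurable
  finally show ?thesis
    by (simp only: outer)
qed

text \<open>By \<open>gaussian_smoothing\<close> the two measures agree after noise of size
  \<open>1 / Suc n\<close> is added. Letting the noise vanish gives equal integrals of continuous
  functions with values in the unit interval; these increase to indicators of open sets, which
  generate the Borel sets.\<close>

lemma measure_eqI_cis:
  fixes M N :: "'a::euclidean_space measure"
  assumes M: "finite_measure M" "sets M = sets borel"
    and N: "finite_measure N" "sets N = sets borel"
    and eq: "\<And>t. (\<integral>x. cis (t \<bullet> x) \<partial>M) = (\<integral>x. cis (t \<bullet> x) \<partial>N)"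
  shows "M = N"
proof -
  interpret G: prob_space "std_gaussian :: 'a measure" by (rule prob_space_std_gaussian)
  note [measurable_cong] = M(2) N(2)
  have smooth: "(\<integral>\<^sup>+ x. (\<integral>\<^sup>+ w. h (x + (1 / real (Suc n)) *\<^sub>R w) \<partial>std_gaussian) \<partial>M)
     = (\<integral>\<^sup>+ x. (\<integral>\<^sup>+ w. h (x + (1 / real (Suc n)) *\<^sub>R w) \<partial>std_gaussian) \<partial>N)"
    if "h \<in> borel_measurable borel" for h n
  proof -
    have pos: "1 / real (Suc n) > 0" by simp
    show ?thesis
      by (simp only: gaussian_smoothing[OF M pos that] gaussian_smoothing[OF N pos that] eq)
  qed
  have lim: "(\<lambda>n. \<integral>\<^sup>+ x. (\<integral>\<^sup>+ w. ennreal (h (x + (1 / real (Suc n)) *\<^sub>R w)) \<partial>std_gaussian)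
      \<partial>P) \<longlonglongrightarrow> (\<integral>\<^sup>+ x. ennreal (h x) \<partial>P)"
    if P: "finite_measure P" "sets P = sets borel"
        and h: "continuous_on UNIV h" "\<And>x. 0 \<le> h x" "\<And>x. h x \<le> 1"
    for P :: "'a measure" and h :: "'a \<Rightarrow> real"
  proof -
    interpret P: finite_measure P by fact
    note [measurable_cong] = P(2)
    interpret PG: finite_measure "P \<Otimes>\<^sub>M (std_gaussian :: 'a measure)"
      by (intro finite_measure_pair_measure P(1) G.finite_measure_axioms)
    interpret pair_sigma_finite P "std_gaussian :: 'a measure"
      by (simp add: pair_sigma_finite.intro P.sigma_finite_measure_axioms
        G.sigma_finite_measure_axioms)
    have [measurable]: "h \<in> borel_measurable borel"
      using h(1) by (rule borel_measurable_continuous_onI)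
    have "(\<lambda>n. \<integral>p. h (fst p + (1 / real (Suc n)) *\<^sub>R snd p) \<partial>(P \<Otimes>\<^sub>M std_gaussian)) \<longlonglongrightarrow> (\<integral>p. h (fst p)
        \<partial>(P \<Otimes>\<^sub>M (std_gaussian :: 'a measure)))"
    proof (rule Bochner_Integration.integral_dominated_convergence[where w = "\<lambda>_. 1"])
      show "AE p in P \<Otimes>\<^sub>M std_gaussian. (\<lambda>n. h (fst p + (1 / real (Suc n)) *\<^sub>R snd p)) \<longlonglongrightarrow> h (fst p)"
      proof (intro AE_I2)
        fix p :: "'a \<times> 'a"
        have "(\<lambda>n. fst p + (1 / real (Suc n)) *\<^sub>R snd p) \<longlonglongrightarrow> fst p + 0 *\<^sub>R snd p"
          by (intro tendsto_intros LIMSEQ_Suc[OF lim_1_over_n])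
        then show "(\<lambda>n. h (fst p + (1 / real (Suc n)) *\<^sub>R snd p)) \<longlonglongrightarrow> h (fst p)"
          using h(1) by (intro isCont_tendsto_compose[of "fst p" h])
            (auto simp: continuous_on_eq_continuous_at)
      qed
      show "AE p in P \<Otimes>\<^sub>M (std_gaussian :: 'a measure). norm (h (fst p
          + (1 / real (Suc n)) *\<^sub>R snd p)) \<le> 1" for n
        using h by auto
    qed auto
    moreover have "(\<integral>\<^sup>+ x. (\<integral>\<^sup>+ w. ennreal (h (x + c *\<^sub>R w)) \<partial>std_gaussian) \<partial>P)
      = ennreal (\<integral>p. h (fst p + c *\<^sub>R snd p) \<partial>(P \<Otimes>\<^sub>M std_gaussian))" for c
    proof -
      have "(\<integral>\<^sup>+ x. (\<integral>\<^sup>+ w. ennreal (h (x + c *\<^sub>R w)) \<partial>std_gaussian) \<partial>P)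
        = (\<integral>\<^sup>+ p. ennreal (h (fst p + c *\<^sub>R snd p)) \<partial>(P \<Otimes>\<^sub>M std_gaussian))"
        by (subst G.nn_integral_fst[symmetric]) auto
      also have "\<dots> = ennreal (\<integral>p. h (fst p + c *\<^sub>R snd p) \<partial>(P \<Otimes>\<^sub>M std_gaussian))"
        using h by (intro nn_integral_eq_integral PG.integrable_const_bound[of _ 1]) auto
      finally show ?thesis .
    qed
    from this this[of 0] have
      "(\<integral>\<^sup>+ x. (\<integral>\<^sup>+ w. ennreal (h (x + c *\<^sub>R w)) \<partial>std_gaussian) \<partial>P)
      = ennreal (\<integral>p. h (fst p + c *\<^sub>R snd p) \<partial>(P \<Otimes>\<^sub>M std_gaussian))"
      "(\<integral>\<^sup>+ x. ennreal (h x) \<partial>P) = ennreal (\<integral>p. h (fst p) \<partial>(P \<Otimes>\<^sub>M (std_gaussian :: 'a measure)))"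
        for c
      using G.emeasure_space_1 by (auto simp: nn_integral_const)
    ultimately show ?thesis
      using h by (auto intro!: tendsto_ennrealI)
  qed
  have cont: "(\<integral>\<^sup>+ x. ennreal (h x) \<partial>M) = (\<integral>\<^sup>+ x. ennreal (h x) \<partial>N)"
    if h: "continuous_on UNIV h" "\<And>x. 0 \<le> h x" "\<And>x. h x \<le> 1" for h :: "'a \<Rightarrow> real"
  proof -
    have "(\<lambda>x. ennreal (h x)) \<in> borel_measurable borel"
      using borel_measurable_continuous_onI[OF h(1)] by measurable
    from LIMSEQ_unique[OF lim[OF M h] lim[OF N h, folded smooth[OF this]]] show ?thesis .
  qed
  have open_eq: "emeasure M U = emeasure N U" if U: "open U" for U
  \<comment> \<open>\<open>infdist\<close> to the empty set is 0 by convention, so the approximation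
    by the distance to \<open>- U\<close> would fail for the whole space.\<close>
  proof (cases "U = UNIV")
    case True
    then show ?thesis using cont[of "\<lambda>_. 1"] sets_eq_imp_space_eq[OF M(2)]
        sets_eq_imp_space_eq[OF N(2)] by simp
  next
    case False
    define h where "h k x = min 1 (real k * infdist x (- U))" for k x
    have hc: "continuous_on UNIV (h k)" for k
      unfolding h_def by (intro continuous_intros)
    have h0: "0 \<le> h k x" "h k x \<le> 1" for k x
      by (auto simp: h_def infdist_nonneg)
    have [measurable]: "h k \<in> borel_measurable borel" for k
      using hc by (rule borel_measurable_continuous_onI)
    have ind: "(SUP k. ennreal (h k x)) = indicator U x" for x
    proof (cases "x \<in> U")
      case True
      have "infdist x (- U) > 0"
        using True False U in_closed_iff_infdist_zero[of "- U" x] infdist_nonneg[of x "- U"]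
          by force
      then obtain k :: nat where "1 \<le> real k * infdist x (- U)"
        using reals_Archimedean3 less_imp_le by metis
      then have "h k x = 1" by (simp add: h_def)
      have "(SUP k. ennreal (h k x)) = 1"
      proof (rule antisym)
        show "(SUP k. ennreal (h k x)) \<le> 1" using h0 by (intro SUP_least) simp
        show "1 \<le> (SUP k. ennreal (h k x))" using \<open>h k x = 1\<close> by (intro SUP_upper2[of k]) auto
      qed
      then show ?thesis using True by simp
    next
      case False
      then show ?thesis by (simp add: h_def infdist_zero)
    qed
    have inc: "incseq (\<lambda>k x. ennreal (h k x))"
      by (auto simp: incseq_def le_fun_def h_def intro!: ennreal_leI min.mono mult_right_mono
        infdist_nonneg)
    have "emeasure P U = (SUP k. \<integral>\<^sup>+ x. ennreal (h k x) \<partial>P)" if "sets P = sets borel"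
        for P :: "'a measure"
    proof -
      note [measurable_cong] = that
      have "emeasure P U = (\<integral>\<^sup>+ x. (SUP k. ennreal (h k x)) \<partial>P)"
        using U that by (simp add: ind)
      also have "\<dots> = (SUP k. \<integral>\<^sup>+ x. ennreal (h k x) \<partial>P)"
        by (rule nn_integral_monotone_convergence_SUP[OF inc]) measurable
      finally show ?thesis .
    qed
    then show ?thesis
      using M(2) N(2) cont[OF hc h0] by simp
  qed
  show ?thesis
  proof (rule measure_eqI_generator_eq[where E = "{U. open U}" and \<Omega> = UNIV and A = "\<lambda>_. UNIV"])
    show "Int_stable {U :: 'a set. open U}" by (auto simp: Int_stable_def)
    show "sets M = sigma_sets UNIV {U. open U}" "sets N = sigma_sets UNIV {U. open U}"
      using M(2) N(2) by (simp_all add: borel_def)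
    show "emeasure M UNIV \<noteq> \<infinity>"
      using finite_measure.emeasure_finite[OF M(1)] by simp
  qed (auto simp: open_eq)
qed

subsection \<open>The area formula\<close>

text \<open>Continuous images of Borel sets need not be Borel. Sigma-compact sets are stable under
  continuous images and finite intersections, include the open and the closed sets, and are Borel;
  all pieces in the area formula are of this kind.\<close>

definition sigma_compact :: "'a::topological_space set \<Rightarrow> bool" where
  "sigma_compact S \<longleftrightarrow> (\<exists>K :: nat \<Rightarrow> 'a set. (\<forall>n. compact (K n)) \<and> S = (\<Union>n. K n))"

lemma sigma_compact_closed:
  fixes S :: "'a::heine_borel set"
  assumes "closed S"
  shows "sigma_compact S"
proof -
  define K where "K n = S \<inter> cball (SOME x. True) (real n)" for n
  have "compact (K n)" for n
    unfolding K_def using assms by (simp add: closed_Int_compact)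
  moreover have "S = (\<Union>n. K n)"
    by (auto simp: K_def intro: real_arch_simple)
  ultimately show ?thesis
    unfolding sigma_compact_def by blast
qed

lemma sigma_compact_open:
  fixes S :: "'a::euclidean_space set"
  assumes "open S"
  shows "sigma_compact S"
proof -
  obtain C where "\<And>n. compact (C n)" "\<Union>(range (C :: nat \<Rightarrow> _)) = S"
    by (rule open_Union_compact_subsets[OF assms]) blast
  then show ?thesis
    unfolding sigma_compact_def by blast
qed

lemma sigma_compact_Int:
  fixes S T :: "'a::t2_space set"
  assumes "sigma_compact S" "sigma_compact T"
  shows "sigma_compact (S \<inter> T)"
proof -
  obtain K L where K: "\<And>n::nat. compact (K n)" "S = (\<Union>n. K n)"
    and L: "\<And>n::nat. compact (L n)" "T = (\<Union>n. L n)"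
    using assms unfolding sigma_compact_def by metis
  have "S \<inter> T = (\<Union>n. K (fst (prod_decode n)) \<inter> L (snd (prod_decode n)))"
  proof -
    have "\<exists>n. x \<in> K (fst (prod_decode n)) \<and> x \<in> L (snd (prod_decode n))"
      if "x \<in> K i" "x \<in> L j" for x i j
      using that by (intro exI[of _ "prod_encode (i, j)"]) auto
    then show ?thesis by (auto simp: K L)
  qed
  moreover have "compact (K (fst (prod_decode n)) \<inter> L (snd (prod_decode n)))" for n
    using K L by (simp add: compact_Int)
  ultimately show ?thesis
    unfolding sigma_compact_def
    by (intro exI[of _ "\<lambda>n. K (fst (prod_decode n)) \<inter> L (snd (prod_decode n))"]) simp
qed

lemma sigma_compact_image:
  assumes "sigma_compact S" "continuous_on S f"
  shows "sigma_compact (f ` S)"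
proof -
  obtain K where K: "\<And>n::nat. compact (K n)" "S = (\<Union>n. K n)"
    using assms unfolding sigma_compact_def by metis
  have "compact (f ` K n)" for n
    using K assms(2) by (metis Sup_upper compact_continuous_image continuous_on_subset rangeI)
  moreover have "f ` S = (\<Union>n. f ` K n)"
    by (auto simp: K)
  ultimately show ?thesis
    unfolding sigma_compact_def by (intro exI[of _ "\<lambda>n. f ` K n"]) simp
qed

lemma sigma_compact_borel:
  fixes S :: "'a::t2_space set"
  assumes "sigma_compact S"
  shows "S \<in> sets borel"
proof -
  obtain K where K: "\<And>n::nat. compact (K n)" "S = (\<Union>n. K n)"
    using assms unfolding sigma_compact_def by metis
  then show ?thesis
    using borel_compact by (auto intro!: sets.countable_UN)
qed

lemma emeasure_count_UN_disjoint:
  assumes "disjoint_family (A :: nat \<Rightarrow> 'a set)" "\<And>n. finite (X \<inter> A n) \<and> card (X \<inter> A n) \<le> 1"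
    "X \<subseteq> (\<Union>n. A n)"
  shows "emeasure (count_space UNIV) X = (\<Sum>n. if X \<inter> A n = {} then 0 else 1)"
proof -
  have "emeasure (count_space UNIV) X = emeasure (count_space UNIV) (\<Union>n. X \<inter> A n)"
    using assms(3) by (intro arg_cong2[where f = emeasure]) auto
  also have "\<dots> = (\<Sum>n. emeasure (count_space UNIV) (X \<inter> A n))"
    using assms(1) by (intro suminf_emeasure[symmetric]) (auto simp: disjoint_family_on_def)
  also have "\<dots> = (\<Sum>n. if X \<inter> A n = {} then 0 else 1)"
  proof (intro suminf_cong)
    fix n
    have "card (X \<inter> A n) = 0 \<or> card (X \<inter> A n) = 1"
      using assms(2)[of n] by linarith
    then show "emeasure (count_space UNIV) (X \<inter> A n) = (if X \<inter> A n = {} then 0 else 1)"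
      using assms(2)[of n] by (auto simp: emeasure_count_space_finite)
  qed
  finally show ?thesis .
qed

lemma Sard_AE:
  fixes F :: "real^'m::{finite,wellorder} \<Rightarrow> real^'m::_"
  assumes F: "\<And>x. (F has_derivative (\<lambda>h. F' x *v h)) (at x)"
  shows "AE b in lborel. \<forall>x. F x = b \<longrightarrow> det (F' x) \<noteq> 0"
proof -
  have "negligible (F ` {x. det (F' x) = 0})"
  proof (rule baby_Sard)
    fix x assume "x \<in> {x. det (F' x) = 0}"
    then show "(F has_derivative (\<lambda>h. F' x *v h)) (at x within {x. det (F' x) = 0})"
      using F has_derivative_at_withinI by blast
    show "rank (matrix ((*v) (F' x))) < CARD('m)"
      using \<open>x \<in> _\<close> by (simp add: det_eq_0_rank)
  qed simp
  then have "AE b in lebesgue. b \<notin> F ` {x. det (F' x) = 0}"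
    using negligible_iff_null_sets AE_not_in by blast
  then have "AE b in lborel. b \<notin> F ` {x. det (F' x) = 0}"
    using AE_completion_iff by blast
  then show ?thesis
    by eventually_elim auto
qed

text \<open>Near a regular point the derivative is close in operator norm to an invertible one, so
  the map is injective on a ball; Lindelof's theorem reduces these balls to countably many.\<close>

lemma injective_open_cover:
  fixes F :: "real^'m \<Rightarrow> real^'m"
  assumes F: "\<And>x. (F has_derivative (\<lambda>h. F' x *v h)) (at x)"
    and cont: "continuous_on UNIV F'"
  obtains B :: "nat \<Rightarrow> (real^'m) set" where "\<And>n. open (B n)" "\<And>n. inj_on F (B n)"
    "{x. det (F' x) \<noteq> 0} \<subseteq> (\<Union>n. B n)"
proof -
  let ?U = "{x. det (F' x) \<noteq> 0}"
  have ex: "\<exists>r>0. inj_on F (ball a r)" if a: "a \<in> ?U" for a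
  proof -
    obtain M where M: "M ** F' a = mat 1"
      using a invertible_det_nz[of "F' a"] by (auto simp: invertible_def)
    obtain r where "r > 0" "ball a r \<subseteq> UNIV" "inj_on F (ball a r)"
    proof (rule has_derivative_locally_injective[of a UNIV "(*v) M" "\<lambda>x. (*v) (F' x)" F])
      show "(*v) M \<circ> (*v) (F' a) = id"
        by (auto simp: fun_eq_iff matrix_vector_mul_assoc M)
      fix e :: real assume e: "e > 0"
      have "isCont F' a"
        using cont continuous_on_eq_continuous_at by blast
      \<comment> \<open>Entrywise closeness \<open>e'\<close> bounds the operator norm by
        \<open>n * n * e'\<close>, with \<open>n\<close> the dimension, and this is
        \<open>e / 2\<close>.\<close>
      define e' where "e' = e / (2 * real CARD('m) * real CARD('m))"
      have e': "e' > 0" using e by (simp add: e'_def)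
      then obtain d where d: "d > 0" "\<And>x. dist x a < d \<Longrightarrow> dist (F' x) (F' a) < e'"
        using \<open>isCont F' a\<close> unfolding continuous_at_eps_delta by (metis dist_norm)
      show "\<exists>d>0. \<forall>x. dist a x < d \<longrightarrow> onorm (\<lambda>v. F' x *v v - F' a *v v) < e"
      proof (intro exI conjI allI impI)
        fix x assume "dist a x < d"
        then have *: "norm (F' x - F' a) < e'"
          using d(2)[of x] by (simp add: dist_norm norm_minus_commute)
        have "(\<lambda>v. F' x *v v - F' a *v v) = (*v) (F' x - F' a)"
          by (simp add: fun_eq_iff matrix_vector_mult_diff_rdistrib)
        moreover have "onorm ((*v) (F' x - F' a)) \<le> real CARD('m) * real CARD('m) * e'"
        proof (rule onorm_le_matrix_component)
          fix i j
          have "\<bar>(F' x - F' a) $ i $ j\<bar> \<le> norm ((F' x - F' a) $ i)"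
            by (rule component_le_norm_cart)
          also have "\<dots> \<le> norm (F' x - F' a)"
            by (rule Finite_Cartesian_Product.norm_nth_le)
          finally have "\<bar>(F' x - F' a) $ i $ j\<bar> \<le> norm (F' x - F' a)" .
          then show "\<bar>(F' x - F' a) $ i $ j\<bar> \<le> e'" using * by linarith
        qed
        moreover have "real CARD('m) * real CARD('m) * e' < e"
          using e by (simp add: e'_def)
        ultimately show "onorm (\<lambda>v. F' x *v v - F' a *v v) < e"
          by simp
      qed (rule d)
    qed (use F in auto)
    then show ?thesis by blast
  qed
  then obtain r where r: "\<And>a. a \<in> ?U \<Longrightarrow> r a > 0 \<and> inj_on F (ball a (r a))"
    by metis
  obtain \<F>' where sub: "\<F>' \<subseteq> (\<lambda>a. ball a (r a)) ` ?U" and cnt: "countable \<F>'"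
    and Un: "\<Union>\<F>' = \<Union>((\<lambda>a. ball a (r a)) ` ?U)"
    by (rule Lindelof[of "(\<lambda>a. ball a (r a)) ` ?U"]) auto
  \<comment> \<open>The empty set is added so that the family is nonempty and can be enumerated by
    all natural numbers.\<close>
  define B where "B n = from_nat_into (insert {} \<F>') n" for n
  have rng: "range B = insert {} \<F>'"
    unfolding B_def using cnt by (intro range_from_nat_into) auto
  show thesis
  proof
    fix n
    have "B n \<in> insert {} \<F>'" using rng by blast
    then show "open (B n)" "inj_on F (B n)"
      using sub r by auto
  next
    have "?U \<subseteq> \<Union>\<F>'"
      unfolding Un using r by auto
    then show "?U \<subseteq> (\<Union>n. B n)" unfolding rng by auto
  qed
qed

text \<open>The change-of-variables theorem invoked here concerns vector-valued functions; the
  scalar weight is embedded as a multiple of \<open>1 :: real^1\<close> and recovered as the only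
  component.\<close>

lemma nn_integral_change_of_variables_inj:
  fixes F :: "real^'m::{finite,wellorder} \<Rightarrow> real^'m::_"
  assumes F: "\<And>x. (F has_derivative (\<lambda>h. F' x *v h)) (at x)"
    and S: "S \<in> sets borel" "F ` S \<in> sets borel" and inj: "inj_on F S"
    and phi: "integrable lborel \<phi>" "\<And>x. 0 \<le> \<phi> x"
  shows "(\<integral>\<^sup>+ x. ennreal (\<bar>det (F' x)\<bar> * \<phi> (F x)) * indicator S x \<partial>lborel)
       = (\<integral>\<^sup>+ b. ennreal (\<phi> b) * indicator (F ` S) b \<partial>lborel)"
proof -
  let ?g = "\<lambda>x. (\<chi> i::1. \<phi> x) :: real^1"
  have "\<phi> absolutely_integrable_on (F ` S)"
  proof -
    have "integrable lebesgue \<phi>"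
      using phi by (simp add: integrable_completion borel_measurable_integrable)
    then have "set_integrable lebesgue UNIV \<phi>"
      by (simp add: set_integrable_def)
    then show ?thesis
      by (rule set_integrable_subset) (use S in auto)
  qed
  then have a: "(\<lambda>x. \<phi> x *\<^sub>R (1 :: real^1)) absolutely_integrable_on (F ` S)"
    by (intro absolutely_integrable_scaleR_right)
  obtain b where b: "integral (F ` S) (\<lambda>x. \<phi> x *\<^sub>R (1 :: real^1)) = b" by blast
  have "S \<in> sets lebesgue" using S by auto
  from has_absolute_integral_change_of_variables[OF this, of F "\<lambda>x. (*v) (F' x)" "\<lambda>x. \<phi> x *\<^sub>R
      (1 :: real^1)" b]
  have c: "(\<lambda>x. \<bar>det (F' x)\<bar> *\<^sub>R \<phi> (F x) *\<^sub>R (1 :: real^1)) absolutely_integrable_on S"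
    "integral S (\<lambda>x. \<bar>det (F' x)\<bar> *\<^sub>R \<phi> (F x) *\<^sub>R (1 :: real^1)) = b"
    using a b F inj by (auto simp: has_derivative_at_withinI)
  have 1: "((\<lambda>x. \<phi> x) has_integral (b $ 1)) (F ` S)"
  proof -
    have "((\<lambda>x. \<phi> x *\<^sub>R (1 :: real^1)) has_integral b) (F ` S)"
      using a b by (simp add: has_integral_integrable_integral absolutely_integrable_on_def)
    from has_integral_linear[OF this bounded_linear_vec_nth[of 1]] show ?thesis
      by (simp add: o_def)
  qed
  have 2: "((\<lambda>x. \<bar>det (F' x)\<bar> * \<phi> (F x)) has_integral (b $ 1)) S"
  proof -
    have "((\<lambda>x. \<bar>det (F' x)\<bar> *\<^sub>R \<phi> (F x) *\<^sub>R (1 :: real^1)) has_integral b) S"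
      using c by (simp add: has_integral_integrable_integral absolutely_integrable_on_def)
    from has_integral_linear[OF this bounded_linear_vec_nth[of 1]] show ?thesis
      by (simp add: o_def)
  qed
  show ?thesis
    using nn_integral_has_integral_lebesgue'[OF _ 1] nn_integral_has_integral_lebesgue'[OF _ 2] phi
    by simp
qed

text \<open>For \<open>b\<close> outside the null set of critical values all preimages are regular
  points. The regular points of \<open>A\<close> are split into disjoint pieces \<open>D n\<close>
  on which \<open>F\<close> is injective, so the count at \<open>b\<close> is a sum of indicators of
  the images of the pieces, and the injective case applies to each. Singular points drop out on the
  right because the determinant vanishes there.\<close>

lemma area_formula_wellorder:
  fixes F :: "real^'m::{finite,wellorder} \<Rightarrow> real^'m::_"
  assumes F: "\<And>x. (F has_derivative (\<lambda>h. F' x *v h)) (at x)"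
    and cont: "continuous_on UNIV F'" and A: "closed A"
    and phi: "integrable lborel \<phi>" "\<And>x. 0 \<le> \<phi> x"
  shows "(\<integral>\<^sup>+ b. emeasure (count_space UNIV) {x \<in> A. F x = b} * ennreal (\<phi> b) \<partial>lborel)
       = (\<integral>\<^sup>+ x. ennreal (\<bar>det (F' x)\<bar> * \<phi> (F x)) * indicator A x \<partial>lborel)"
proof -
  let ?U = "{x. det (F' x) \<noteq> 0}"
  obtain B where B: "\<And>n::nat. open (B n)" "\<And>n. inj_on F (B n)" "?U \<subseteq> (\<Union>n. B n)"
    using injective_open_cover[OF F cont] by metis
  have cF: "continuous_on UNIV F"
    by (meson F continuous_at_imp_continuous_on has_derivative_continuous)
  have cdet: "continuous_on UNIV (\<lambda>x. det (F' x))"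
    unfolding det_def by (intro continuous_intros continuous_on_compose2[OF _ cont]) auto
  have U: "open ?U"
    using open_Collect_neq[OF cdet continuous_on_const] by simp
  define D where "D n = A \<inter> ?U \<inter> disjointed B n" for n
  have "sigma_compact (disjointed B n)" for n
  proof -
    have "disjointed B n = B n \<inter> (- (\<Union>i\<in>{0..<n}. B i))"
      by (auto simp: disjointed_def)
    moreover have "closed (- (\<Union>i\<in>{0..<n}. B i))"
      using B by (intro closed_Compl open_UN) auto
    ultimately show ?thesis
      using B sigma_compact_Int sigma_compact_open sigma_compact_closed by metis
  qed
  then have scD: "sigma_compact (D n)" for n
    unfolding D_def using sigma_compact_closed[OF A] sigma_compact_open[OF U] sigma_compact_Int
      by blast
  have scFD: "sigma_compact (F ` D n)" for n
    by (intro sigma_compact_image scD continuous_on_subset[OF cF]) auto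
  have disj: "disjoint_family D"
    using disjoint_family_disjointed[of B] by (rule disjoint_family_subset) (auto simp: D_def)
  have UnD: "(\<Union>n. D n) = A \<inter> ?U"
  proof -
    have "(\<Union>n. D n) = A \<inter> ?U \<inter> (\<Union>n. disjointed B n)"
      by (auto simp: D_def)
    then show ?thesis
      using B(3) unfolding UN_disjointed_eq by auto
  qed
  have injD: "inj_on F (D n)" for n
    using B(2)[of n] by (rule inj_on_subset) (auto simp: D_def disjointed_def)
  have count: "emeasure (count_space UNIV) {x \<in> A. F x = b} = (\<Sum>n. indicator (F ` D n) b)"
    if "\<forall>x. F x = b \<longrightarrow> det (F' x) \<noteq> 0" for b
  proof -
    have "emeasure (count_space UNIV) {x \<in> A. F x = b}
        = (\<Sum>n. if {x \<in> A. F x = b} \<inter> D n = {} then 0 else 1)"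
    proof (rule emeasure_count_UN_disjoint[OF disj])
      fix n
      have *: "x = y" if "x \<in> {x \<in> A. F x = b} \<inter> D n" "y \<in> {x \<in> A. F x = b} \<inter> D n" for x y
        using injD[of n] that by (auto dest: inj_onD)
      have "{x \<in> A. F x = b} \<inter> D n = {} \<or> (\<exists>y. {x \<in> A. F x = b} \<inter> D n = {y})"
      proof (cases "{x \<in> A. F x = b} \<inter> D n = {}")
        case False
        then obtain y where "y \<in> {x \<in> A. F x = b} \<inter> D n" by blast
        with * have "{x \<in> A. F x = b} \<inter> D n = {y}" by blast
        then show ?thesis by blast
      qed simp
      then show "finite ({x \<in> A. F x = b} \<inter> D n) \<and> card ({x \<in> A. F x = b} \<inter> D n) \<le> 1"
        by (elim disjE exE) simp_all
    next
      show "{x \<in> A. F x = b} \<subseteq> \<Union> (range D)"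
        unfolding UnD using that by auto
    qed
    also have "\<dots> = (\<Sum>n. indicator (F ` D n) b)"
      by (intro suminf_cong) (auto simp: indicator_def D_def)
    finally show ?thesis .
  qed
  have [measurable]: "D n \<in> sets borel" "F ` D n \<in> sets borel" for n
    using scD scFD sigma_compact_borel by auto
  have [measurable]: "\<phi> \<in> borel_measurable borel"
    using phi by auto
  have [measurable]: "F \<in> borel_measurable borel" "(\<lambda>x. det (F' x)) \<in> borel_measurable borel"
    using cF cdet by (auto intro: borel_measurable_continuous_onI)
  have "(\<integral>\<^sup>+ b. emeasure (count_space UNIV) {x \<in> A. F x = b} * ennreal (\<phi> b) \<partial>lborel)
      = (\<integral>\<^sup>+ b. (\<Sum>n. ennreal (\<phi> b) * indicator (F ` D n) b) \<partial>lborel)"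
    using Sard_AE[OF F]
    by (intro nn_integral_cong_AE, eventually_elim) (simp add: count mult.commute[of _ "ennreal _"])
  also have "\<dots> = (\<Sum>n. \<integral>\<^sup>+ b. ennreal (\<phi> b) * indicator (F ` D n) b \<partial>lborel)"
    by (intro nn_integral_suminf) measurable
  also have "\<dots> = (\<Sum>n. \<integral>\<^sup>+ x. ennreal (\<bar>det (F' x)\<bar> * \<phi> (F x)) * indicator (D n) x \<partial>lborel)"
    by (intro suminf_cong nn_integral_change_of_variables_inj[symmetric] F injD phi) auto
  also have "\<dots> = (\<integral>\<^sup>+ x. (\<Sum>n. ennreal (\<bar>det (F' x)\<bar> * \<phi> (F x)) * indicator (D n) x) \<partial>lborel)"
    by (intro nn_integral_suminf[symmetric]) measurable
  also have "\<dots> = (\<integral>\<^sup>+ x. ennreal (\<bar>det (F' x)\<bar> * \<phi> (F x)) * indicator A x \<partial>lborel)"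
  proof (intro nn_integral_cong)
    fix x
    have "(\<Sum>n. ennreal (\<bar>det (F' x)\<bar> * \<phi> (F x)) * indicator (D n) x)
        = ennreal (\<bar>det (F' x)\<bar> * \<phi> (F x)) * indicator (\<Union>n. D n) x"
      by (simp add: suminf_indicator[OF disj])
    also have "\<dots> = ennreal (\<bar>det (F' x)\<bar> * \<phi> (F x)) * indicator A x"
      unfolding UnD by (auto simp: indicator_def)
    finally show "(\<Sum>n. ennreal (\<bar>det (F' x)\<bar> * \<phi> (F x)) * indicator (D n) x)
      = ennreal (\<bar>det (F' x)\<bar> * \<phi> (F x)) * indicator A x" .
  qed
  finally show ?thesis .
qed

section \<open>Measurability of the number of zeros\<close>

lemma sets_Ex_zero_compact:
  fixes \<Phi> :: "'a \<Rightarrow> 'b::euclidean_space \<Rightarrow> real"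
  assumes [measurable]: "\<And>x. (\<lambda>\<omega>. \<Phi> \<omega> x) \<in> borel_measurable M"
    and cont: "\<And>\<omega>. continuous_on UNIV (\<Phi> \<omega>)" and nonneg: "\<And>\<omega> x. \<Phi> \<omega> x \<ge> 0"
    and K: "compact K"
  shows "{\<omega> \<in> space M. \<exists>x\<in>K. \<Phi> \<omega> x = 0} \<in> sets M"
proof -
  obtain T where T: "countable T" "T \<subseteq> K" "K \<subseteq> closure T"
    using separable by metis
  \<comment> \<open>A nonnegative continuous function attains its infimum on a compact set, so it
    has a zero iff its values on a dense subset become arbitrarily small; for a countable dense
    subset the latter is a countable combination of measurable conditions.\<close>
  have "(\<exists>x\<in>K. \<Phi> \<omega> x = 0) \<longleftrightarrow> (\<forall>n::nat. \<exists>x\<in>T. \<Phi> \<omega> x < 1 / real (Suc n))" for \<omega>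
  proof (intro iffI allI)
    fix n assume "\<exists>x\<in>K. \<Phi> \<omega> x = 0"
    then obtain x where x: "x \<in> K" "\<Phi> \<omega> x = 0" by blast
    have "open (\<Phi> \<omega> -` {..<1 / real (Suc n)})"
      by (intro open_vimage cont open_lessThan)
    moreover have "x \<in> \<Phi> \<omega> -` {..<1 / real (Suc n)}"
      using x by simp
    ultimately have "T \<inter> \<Phi> \<omega> -` {..<1 / real (Suc n)} \<noteq> {}"
      using x T(3) open_Int_closure_eq_empty[of "\<Phi> \<omega> -` {..<1 / real (Suc n)}" T] by blast
    then show "\<exists>x\<in>T. \<Phi> \<omega> x < 1 / real (Suc n)" by auto
  next
    assume *: "\<forall>n::nat. \<exists>x\<in>T. \<Phi> \<omega> x < 1 / real (Suc n)"
    then have "K \<noteq> {}" using T by blast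
    then obtain x where x: "x \<in> K" "\<And>y. y \<in> K \<Longrightarrow> \<Phi> \<omega> x \<le> \<Phi> \<omega> y"
      using continuous_attains_inf[OF K _ continuous_on_subset[OF cont]] by blast
    have "\<Phi> \<omega> x < 1 / real (Suc n)" for n
      using * x(2) T(2) by (meson le_less_trans subsetD)
    then have "\<not> \<Phi> \<omega> x > 0"
      using reals_Archimedean[of "\<Phi> \<omega> x"] by (metis inverse_eq_divide order_less_asym)
    then show "\<exists>x\<in>K. \<Phi> \<omega> x = 0"
      using x(1) nonneg[of \<omega> x] by (intro bexI[of _ x]) auto
  qed
  moreover have "{\<omega> \<in> space M. \<forall>n::nat. \<exists>x\<in>T. \<Phi> \<omega> x < 1 / real (Suc n)} \<in> sets M"
    using T(1) by measurable
  ultimately show ?thesis by simp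
qed

lemma sets_Ex_zero_sigma_compact:
  fixes \<Phi> :: "'a \<Rightarrow> 'b::euclidean_space \<Rightarrow> real"
  assumes "\<And>x. (\<lambda>\<omega>. \<Phi> \<omega> x) \<in> borel_measurable M"
    and "\<And>\<omega>. continuous_on UNIV (\<Phi> \<omega>)" and "\<And>\<omega> x. \<Phi> \<omega> x \<ge> 0"
    and "sigma_compact S"
  shows "{\<omega> \<in> space M. \<exists>x\<in>S. \<Phi> \<omega> x = 0} \<in> sets M"
proof -
  obtain K where K: "\<And>n::nat. compact (K n)" "S = (\<Union>n. K n)"
    using assms(4) unfolding sigma_compact_def by metis
  have "{\<omega> \<in> space M. \<exists>x\<in>S. \<Phi> \<omega> x = 0} = (\<Union>n. {\<omega> \<in> space M. \<exists>x\<in>K n. \<Phi> \<omega> x = 0})"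
    by (auto simp: K)
  then show ?thesis
    using sets_Ex_zero_compact[OF assms(1-3) K(1)] by (auto intro!: sets.countable_UN)
qed

lemma card_hitting_family_le:
  assumes "finite C" "disjoint C" "\<And>V. V \<in> C \<Longrightarrow> V \<inter> X \<noteq> {}"
  shows "of_nat (card C) \<le> emeasure (count_space UNIV) X"
proof -
  obtain g where g: "\<And>V. V \<in> C \<Longrightarrow> g V \<in> V \<inter> X"
  proof -
    have "\<forall>V\<in>C. \<exists>x. x \<in> V \<inter> X" using assms(3) by blast
    then show thesis using that by (metis bchoice)
  qed
  have "inj_on g C"
  proof (rule inj_onI)
    fix U V assume UV: "U \<in> C" "V \<in> C" "g U = g V"
    then have "U \<inter> V \<noteq> {}"
      using g[of U] g[of V] by auto
    then show "U = V"
      using assms(2) UV(1,2) unfolding disjoint_def by blast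
  qed
  then have "card C = card (g ` C)" by (simp add: card_image)
  also have "of_nat \<dots> = emeasure (count_space UNIV) (g ` C)"
    using assms(1) by (simp add: emeasure_count_space_finite)
  also have "\<dots> \<le> emeasure (count_space UNIV) X"
    using g by (intro emeasure_mono) auto
  finally show ?thesis .
qed

lemma disjoint_basis_neighbourhoods:
  fixes Y :: "'b::metric_space set"
  assumes Y: "finite Y" and \<B>: "topological_basis \<B>"
  obtains C where "finite C" "C \<subseteq> \<B>" "disjoint C" "card C = card Y" "\<And>V. V \<in> C \<Longrightarrow> V \<inter> Y \<noteq> {}"
proof -
  obtain e where e: "e > 0" "\<And>x y. x \<in> Y \<Longrightarrow> y \<in> Y \<Longrightarrow> x \<noteq> y \<Longrightarrow> e \<le> dist x y"
  proof -
    \<comment> \<open>The added 1 keeps the set of distances nonempty when \<open>Y\<close> has at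
      most one point.\<close>
    let ?D = "insert 1 ((\<lambda>(x, y). dist x y) ` {(x, y). x \<in> Y \<and> y \<in> Y \<and> x \<noteq> y})"
    have "{(x, y). x \<in> Y \<and> y \<in> Y \<and> x \<noteq> y} \<subseteq> Y \<times> Y" by auto
    then have fin: "finite ?D"
      using Y finite_subset by fastforce
    show thesis
    proof
      show "Min ?D > 0" using fin by (subst Min_gr_iff) auto
      show "Min ?D \<le> dist x y" if "x \<in> Y" "y \<in> Y" "x \<noteq> y" for x y
        using that fin by (intro Min_le) force+
    qed
  qed
  have "\<exists>V\<in>\<B>. y \<in> V \<and> V \<subseteq> ball y (e / 2)" for y
    using topological_basisE[OF \<B> open_ball[of y "e/2"], of y] e(1)
      by (metis centre_in_ball half_gt_zero)
  then obtain V where V: "\<And>y. V y \<in> \<B> \<and> y \<in> V y \<and> V y \<subseteq> ball y (e / 2)" by metis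
  have disj: "V x \<inter> V y = {}" if "x \<in> Y" "y \<in> Y" "x \<noteq> y" for x y
  proof -
    have False if "z \<in> V x" "z \<in> V y" for z
    proof -
      have "dist x z < e / 2" "dist y z < e / 2"
        using V that by (meson mem_ball subsetD)+
      then have "dist x y < e" by (metis dist_commute dist_triangle_half_r)
      then show False using e(2)[OF \<open>x \<in> Y\<close> \<open>y \<in> Y\<close> \<open>x \<noteq> y\<close>] by simp
    qed
    then show ?thesis by blast
  qed
  have "inj_on V Y"
    using disj V by (metis inf.idem inj_onI empty_iff)
  show thesis
  proof
    show "disjoint (V ` Y)" using disj by (auto simp: disjoint_def)
    show "card (V ` Y) = card Y" using \<open>inj_on V Y\<close> by (rule card_image)
    show "W \<inter> Y \<noteq> {}" if "W \<in> V ` Y" for W using that V by blast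
  qed (use Y V in auto)
qed

text \<open>A set has at least \<open>k\<close> points iff some \<open>k\<close> pairwise disjoint
  basic open sets all meet it. Over a countable basis the supremum is countable, so measurability of
  a random count reduces to that of the events that a given basic set is hit.\<close>

lemma emeasure_count_eq_SUP:
  fixes X :: "'b::metric_space set"
  assumes \<B>: "topological_basis \<B>"
  shows "emeasure (count_space UNIV) X
    = (SUP C\<in>{C. finite C \<and> C \<subseteq> \<B> \<and> disjoint C}. if \<forall>V\<in>C. V \<inter> X \<noteq> {} then of_nat (card C) else 0)"
    (is "_ = ?S")
proof (rule antisym)
  have le: "of_nat (card Y) \<le> ?S" if Y: "finite Y" "Y \<subseteq> X" for Y
  proof -
    obtain C where C: "finite C" "C \<subseteq> \<B>" "disjoint C" "card C = card Y" "\<And>V. V \<in> C \<Longrightarrow> V \<inter> Y \<noteq> {}"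
      using disjoint_basis_neighbourhoods[OF Y(1) \<B>] by metis
    then have "\<forall>V\<in>C. V \<inter> X \<noteq> {}" using Y(2) by blast
    then show ?thesis
      using C by (intro SUP_upper2[of C]) auto
  qed
  show "emeasure (count_space UNIV) X \<le> ?S"
  proof (cases "finite X")
    case True
    then show ?thesis using le[of X] by (simp add: emeasure_count_space_finite)
  next
    case False
    have "of_nat n \<le> ?S" for n
    proof -
      obtain Y where "finite Y" "card Y = n" "Y \<subseteq> X"
        using infinite_arbitrarily_large[OF False, of n] by blast
      then show ?thesis using le[of Y] by simp
    qed
    then have "(SUP n. of_nat n :: ennreal) \<le> ?S"
      by (intro SUP_least)
    then have "?S = \<top>"
      by (simp only: ennreal_SUP_of_nat_eq_top top_unique)
    then show ?thesis by (simp only: top_greatest)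
  qed
  show "?S \<le> emeasure (count_space UNIV) X"
    by (intro SUP_least) (auto intro!: card_hitting_family_le)
qed

text \<open>A basic open set intersected with the closed \<open>A\<close> is sigma-compact, so
  hitting events are measurable by \<open>sets_Ex_zero_sigma_compact\<close>, and
  \<open>emeasure_count_eq_SUP\<close> assembles them.\<close>

lemma borel_measurable_count_zeros:
  fixes \<Phi> :: "'a \<Rightarrow> 'b::euclidean_space \<Rightarrow> real"
  assumes meas: "\<And>x. (\<lambda>\<omega>. \<Phi> \<omega> x) \<in> borel_measurable M"
    and cont: "\<And>\<omega>. continuous_on UNIV (\<Phi> \<omega>)" and nonneg: "\<And>\<omega> x. \<Phi> \<omega> x \<ge> 0"
    and A: "closed A" and Z: "\<And>\<omega> x. \<omega> \<in> space M \<Longrightarrow> P \<omega> x \<longleftrightarrow> \<Phi> \<omega> x = 0"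
  shows "(\<lambda>\<omega>. emeasure (count_space UNIV) {x \<in> A. P \<omega> x}) \<in> borel_measurable M"
proof -
  obtain \<B> :: "'b set set" where \<B>: "countable \<B>" "topological_basis \<B>"
    using ex_countable_basis by blast
  let ?D = "{C. finite C \<and> C \<subseteq> \<B> \<and> disjoint C}"
  have hit: "{\<omega> \<in> space M. V \<inter> {x \<in> A. P \<omega> x} \<noteq> {}} \<in> sets M" if "V \<in> \<B>" for V
  proof -
    have "sigma_compact (V \<inter> A)"
      using that \<B>(2) A sigma_compact_Int sigma_compact_open sigma_compact_closed
        topological_basis_open by metis
    moreover have "{\<omega> \<in> space M. V \<inter> {x \<in> A. P \<omega> x} \<noteq> {}} = {\<omega> \<in> space M. \<exists>x\<in>V \<inter> A. \<Phi> \<omega> x = 0}"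
      using Z by auto
    ultimately show ?thesis
      using sets_Ex_zero_sigma_compact[OF meas cont nonneg] by simp
  qed
  have "(\<lambda>\<omega>. SUP C\<in>?D. if \<forall>V\<in>C. V \<inter> {x \<in> A. P \<omega> x} \<noteq> {} then of_nat (card C) else (0::ennreal))
      \<in> borel_measurable M"
  proof (rule borel_measurable_SUP)
    show "countable ?D"
      using countable_Collect_finite_subset[OF \<B>(1)] by (rule countable_subset[rotated]) auto
    fix C assume C: "C \<in> ?D"
    have "{\<omega> \<in> space M. \<forall>V\<in>C. V \<inter> {x \<in> A. P \<omega> x} \<noteq> {}} \<in> sets M"
      using C hit by (intro sets.sets_Collect_finite_All) auto
    then show "(\<lambda>\<omega>. if \<forall>V\<in>C. V \<inter> {x \<in> A. P \<omega> x} \<noteq> {} then of_nat (card C) else (0::ennreal))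
        \<in> borel_measurable M"
      by (intro measurable_If) auto
  qed
  then show ?thesis
    by (simp only: emeasure_count_eq_SUP[OF \<B>(2)])
qed

text \<open>The change-of-variables theorems require a well-ordered index type; the area formula is proved
  over \<open>'n wo\<close> and transported back along \<open>Rep_wo\<close>.\<close>

typedef 'n wo = "UNIV :: 'n set"
  by auto

instantiation wo :: (finite) linorder
begin

definition less_eq_wo :: "'a wo \<Rightarrow> 'a wo \<Rightarrow> bool" where
  "less_eq_wo x y \<longleftrightarrow> to_nat (Rep_wo x) \<le> to_nat (Rep_wo y)"

definition less_wo :: "'a wo \<Rightarrow> 'a wo \<Rightarrow> bool" where
  "less_wo x y \<longleftrightarrow> to_nat (Rep_wo x) < to_nat (Rep_wo y)"

instance
  by standard (auto simp: less_eq_wo_def less_wo_def Rep_wo_inject)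

end

lemma bij_Rep_wo: "bij Rep_wo"
  by (metis Abs_wo_inverse Rep_wo_inverse UNIV_I bijI')

instance wo :: (finite) finite
  by standard (use bij_Rep_wo bij_betw_finite finite in blast)

instance wo :: (finite) wellorder
proof (rule wf_wellorderI)
  have "{(x, y :: 'a wo). x < y} \<subseteq> Wellfounded.measure (\<lambda>x. to_nat (Rep_wo x))"
    by (auto simp: less_wo_def)
  then show "wf {(x, y :: 'a wo). x < y}"
    using wf_subset wf_measure by blast
qed standard

section \<open>Relabelling coordinates\<close>

definition reindex :: "('m \<Rightarrow> 'n) \<Rightarrow> 'a^'n \<Rightarrow> 'a^'m" where
  "reindex \<pi> x = (\<chi> i. x $ \<pi> i)"

lemma reindex_nth [simp]: "reindex \<pi> x $ i = x $ \<pi> i"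
  by (simp add: reindex_def)

lemma prod_Basis_cart:
  fixes f :: "real^'n \<Rightarrow> 'a::comm_monoid_mult"
  shows "(\<Prod>b\<in>Basis. f b) = (\<Prod>i\<in>UNIV. f (axis i (1::real)))"
proof -
  have "(Basis :: (real^'n) set) = range (\<lambda>i. axis i 1)"
    by (auto simp: Basis_vec_def)
  moreover have inj: "inj (\<lambda>i. axis i (1::real) :: real^'n)"
    by (auto simp: inj_on_def axis_eq_axis)
  ultimately show ?thesis
    using prod.reindex[OF inj, of f] by (simp only: o_def)
qed

lemma borel_measurable_reindex [measurable]:
  "(reindex \<pi> :: real^'n \<Rightarrow> real^'m) \<in> borel_measurable borel"
  unfolding reindex_def by (intro borel_measurable_continuous_onI continuous_intros)

lemma distr_lborel_reindex:
  fixes \<pi> :: "'m::finite \<Rightarrow> 'n::finite"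
  assumes "bij \<pi>"
  shows "distr lborel borel (reindex \<pi> :: real^'n \<Rightarrow> real^'m) = lborel"
proof (rule lborel_eqI[symmetric])
  fix l u :: "real^'m"
  assume lu: "\<And>b. b \<in> Basis \<Longrightarrow> l \<bullet> b \<le> u \<bullet> b"
  let ?s = "reindex (inv \<pi>) :: real^'m \<Rightarrow> real^'n"
  have pi: "inv \<pi> (\<pi> i) = i" "\<pi> (inv \<pi> j) = j" for i j
    using assms by (simp_all add: bij_is_inj bij_is_surj surj_f_inv_f)
  have lu': "l $ i \<le> u $ i" for i
    using lu[of "axis i 1"] by (simp add: inner_axis)
  have eq: "reindex \<pi> -` box l u = box (?s l) (?s u)"
    unfolding set_eq_iff vimage_eq mem_box_cart reindex_nth using pi by metis
  have "emeasure (distr lborel borel (reindex \<pi>)) (box l u) = emeasure lborel (box (?s l) (?s u))"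
    by (simp add: emeasure_distr eq)
  also have "\<dots> = ennreal (\<Prod>i\<in>UNIV. ?s u $ i - ?s l $ i)"
  proof (subst emeasure_lborel_box)
    show "?s l \<bullet> b \<le> ?s u \<bullet> b" if "b \<in> Basis" for b
      using that lu' by (auto simp: Basis_vec_def inner_axis)
  qed (simp add: prod_Basis_cart inner_axis)
  also have "(\<Prod>i\<in>UNIV. ?s u $ i - ?s l $ i) = (\<Prod>i\<in>UNIV. u $ i - l $ i)"
    unfolding reindex_nth
    using prod.reindex_bij_betw[OF bij_imp_bij_inv[OF assms], of "\<lambda>i. u $ i - l $ i"] by simp
  also have "\<dots> = (\<Prod>b\<in>Basis. (u - l) \<bullet> b)"
    by (simp add: prod_Basis_cart inner_axis)
  finally show "emeasure (distr lborel borel (reindex \<pi>)) (box l u)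
      = ennreal (\<Prod>b\<in>Basis. (u - l) \<bullet> b)" .
qed simp

text \<open>Conjugation by \<open>\<pi>\<close> is a sign-preserving bijection between the
  permutations in the two Leibniz sums.\<close>

lemma det_reindex:
  fixes A :: "real^'n::finite^'n" and \<pi> :: "'m::finite \<Rightarrow> 'n"
  assumes "bij \<pi>"
  shows "det (\<chi> i j. A $ \<pi> i $ \<pi> j) = det A"
proof -
  have pi: "inv \<pi> (\<pi> i) = i" "\<pi> (inv \<pi> j) = j" for i j
    using assms by (simp_all add: bij_is_inj bij_is_surj surj_f_inv_f)
  have inj: "inj \<pi>" and surj: "range \<pi> = UNIV"
    using assms by (simp_all add: bij_is_inj bij_is_surj)
  have mp: "map_permutation UNIV \<pi> = (\<lambda>p x. if x \<in> UNIV then \<pi> (p (inv_into UNIV \<pi> x)) else x)"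
    by (simp add: fun_eq_iff map_permutation_def surj restrict_id_def)
  have bij: "bij_betw (map_permutation UNIV \<pi>) {p. p permutes (UNIV :: 'm set)}
      {p. p permutes (UNIV :: 'n set)}"
    unfolding mp by (rule bij_betw_permutations) (use assms in simp)
  have "det A = (\<Sum>p | p permutes (UNIV :: 'm set). of_int (sign (map_permutation UNIV \<pi> p)) *
      (\<Prod>i\<in>UNIV. A $ i $ map_permutation UNIV \<pi> p i))"
    unfolding det_def by (rule sum.reindex_bij_betw[OF bij, symmetric])
  also have "\<dots> = (\<Sum>p | p permutes (UNIV :: 'm set). of_int (sign p) *
      (\<Prod>i\<in>UNIV. A $ \<pi> i $ \<pi> (p i)))"
  proof (intro sum.cong refl)
    fix p :: "'m \<Rightarrow> 'm" assume "p \<in> {p. p permutes UNIV}"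
    then have "sign (map_permutation UNIV \<pi> p) = sign p"
      using inj by (intro sign_map_permutation) auto
    moreover have "(\<Prod>i\<in>UNIV. A $ i $ map_permutation UNIV \<pi> p i) = (\<Prod>i\<in>UNIV. A $ \<pi> i $ \<pi> (p i))"
      using prod.reindex_bij_betw[OF assms, of "\<lambda>i. A $ i $ map_permutation UNIV \<pi> p i"]
      by (simp add: mp pi)
    ultimately show "of_int (sign (map_permutation UNIV \<pi> p))
        * (\<Prod>i\<in>UNIV. A $ i $ map_permutation UNIV \<pi> p i)
      = of_int (sign p) * (\<Prod>i\<in>UNIV. A $ \<pi> i $ \<pi> (p i))" by simp
  qed
  finally show ?thesis
    by (simp add: det_def)
qed

text \<open>\<open>F\<close> is conjugated with the relabelling \<open>?R\<close> and its inverse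
  \<open>?S\<close>. Lebesgue measure, determinants and numbers of preimages are unchanged, so the
  statements over the well-ordered index type pull back.\<close>

lemma
  fixes F :: "real^'n \<Rightarrow> real^'n::finite"
  assumes F: "\<And>x. (F has_derivative (\<lambda>h. F' x *v h)) (at x)"
    and cont: "continuous_on UNIV F'"
  shows Sard: "AE b in lborel. \<forall>x. F x = b \<longrightarrow> det (F' x) \<noteq> 0"
    and area_formula: "\<And>A \<phi>. closed A \<Longrightarrow> integrable lborel \<phi> \<Longrightarrow> (\<And>x. 0 \<le> \<phi> x) \<Longrightarrow>
      (\<integral>\<^sup>+ b. emeasure (count_space UNIV) {x \<in> A. F x = b} * ennreal (\<phi> b) \<partial>lborel)
       = (\<integral>\<^sup>+ x. ennreal (\<bar>det (F' x)\<bar> * \<phi> (F x)) * indicator A x \<partial>lborel)"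
proof -
  let ?R = "reindex Rep_wo :: real^'n \<Rightarrow> real^'n wo"
      and ?S = "reindex Abs_wo :: real^'n wo \<Rightarrow> real^'n"
  have RS [simp]: "?R (?S y) = y" "?S (?R x) = x" for x y
    by (simp_all add: vec_eq_iff Abs_wo_inverse Rep_wo_inverse)
  have bijA: "bij (Abs_wo :: 'n \<Rightarrow> 'n wo)"
    by (metis Abs_wo_inverse Rep_wo_inverse UNIV_I bijI')
  have dR: "distr lborel borel ?R = lborel" and dS: "distr lborel borel ?S = lborel"
    by (intro distr_lborel_reindex bij_Rep_wo bijA)+
  have lin: "linear ?R" "linear ?S"
    by (auto simp: linear_iff vec_eq_iff)
  have bl: "bounded_linear ?R" "bounded_linear ?S"
    using lin by (auto simp: linear_conv_bounded_linear)
  have cR: "continuous_on UNIV ?R" and cS: "continuous_on UNIV ?S"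
    using bl by (auto intro: linear_continuous_on)
  define G where "G y = ?R (F (?S y))" for y
  define G' where "G' y = (\<chi> i j. F' (?S y) $ Rep_wo i $ Rep_wo j)" for y
  have det: "det (G' y) = det (F' (?S y))" for y
    unfolding G'_def by (rule det_reindex[OF bij_Rep_wo])
  have mv: "G' y *v h = ?R (F' (?S y) *v ?S h)" for y h
  proof (subst vec_eq_iff, intro allI)
    fix i
    have "(\<Sum>j\<in>UNIV. F' (?S y) $ Rep_wo i $ Rep_wo j * h $ j)
      = (\<Sum>j\<in>UNIV. F' (?S y) $ Rep_wo i $ j * h $ Abs_wo j)"
      using sum.reindex_bij_betw[OF bij_Rep_wo, of "\<lambda>j. F' (?S y) $ Rep_wo i $ j * h $ Abs_wo j"]
      by (simp add: Rep_wo_inverse)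
    then show "(G' y *v h) $ i = ?R (F' (?S y) *v ?S h) $ i"
      by (simp add: G'_def matrix_vector_mult_def)
  qed
  have G: "(G has_derivative (\<lambda>h. G' y *v h)) (at y)" for y
  proof -
    have "((\<lambda>y. F (?S y)) has_derivative (\<lambda>h. F' (?S y) *v ?S h)) (at y)"
      using has_derivative_compose[OF bounded_linear_imp_has_derivative[OF bl(2)] F] .
    from bounded_linear.has_derivative[OF bl(1) this] show ?thesis
      by (simp add: G_def[abs_def] mv[abs_def])
  qed
  have cont': "continuous_on UNIV G'"
    unfolding G'_def
    by (intro continuous_on_vec_lambda continuous_intros continuous_on_compose2[OF cont] cS) auto
  have "AE y in distr lborel borel ?R. \<forall>x. G x = y \<longrightarrow> det (G' x) \<noteq> 0"
    unfolding dR by (rule Sard_AE[OF G])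
  then have "AE b in lborel. \<forall>x. G x = ?R b \<longrightarrow> det (G' x) \<noteq> 0"
    by (rule AE_distrD[rotated]) simp
  then show "AE b in lborel. \<forall>x. F x = b \<longrightarrow> det (F' x) \<noteq> 0"
  proof (eventually_elim, intro allI impI)
    fix b x assume "\<forall>x. G x = ?R b \<longrightarrow> det (G' x) \<noteq> 0" "F x = b"
    then have "det (G' (?R x)) \<noteq> 0" by (simp add: G_def)
    then show "det (F' x) \<noteq> 0" by (simp add: det)
  qed
  fix A :: "(real^'n) set" and \<phi> :: "real^'n \<Rightarrow> real"
  assume A: "closed A" and phi: "integrable lborel \<phi>" "\<And>x. 0 \<le> \<phi> x"
  have [measurable]: "\<phi> \<in> borel_measurable borel"
    using borel_measurable_integrable[OF phi(1)] by simp
  have A': "closed (?S -` A)"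
    by (rule closed_vimage[OF A cS])
  have phi': "integrable lborel (\<lambda>y. \<phi> (?S y))"
  proof -
    have "integrable (distr lborel borel ?S) \<phi>" using phi dS by simp
    then show ?thesis by (subst (asm) integrable_distr_eq) auto
  qed
  have "continuous_on UNIV F"
    by (meson F continuous_at_imp_continuous_on has_derivative_continuous)
  then have [measurable]: "F \<in> borel_measurable borel"
    by (auto intro: borel_measurable_continuous_onI)
  have "continuous_on UNIV (\<lambda>x. det (F' x))"
    unfolding det_def by (intro continuous_intros continuous_on_compose2[OF _ cont]) auto
  then have [measurable]: "(\<lambda>x. det (F' x)) \<in> borel_measurable borel"
    by (auto intro: borel_measurable_continuous_onI)
  have [measurable]: "A \<in> sets borel" using A by simp
  have count: "emeasure (count_space UNIV) {x \<in> A. F x = b}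
    = emeasure (count_space UNIV) {y \<in> ?S -` A. G y = ?R b}" for b
  proof -
    have "bij_betw ?R {x \<in> A. F x = b} {y \<in> ?S -` A. G y = ?R b}"
      by (rule bij_betwI[of _ _ _ ?S]) (auto simp: G_def, metis RS(2))
    then show ?thesis
      by (auto simp: emeasure_count_space bij_betw_finite bij_betw_same_card)
  qed
  have "(\<integral>\<^sup>+ b. emeasure (count_space UNIV) {x \<in> A. F x = b} * ennreal (\<phi> b) \<partial>lborel)
      = (\<integral>\<^sup>+ b. emeasure (count_space UNIV) {y \<in> ?S -` A. G y = b} * ennreal (\<phi> (?S b)) \<partial>distr
        lborel borel ?R)"
  proof -
    \<comment> \<open>The integral over an image measure is rewritten only for measurable
      integrands, hence the count has to be measurable in \<open>b\<close>.\<close>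
    have "(\<lambda>b. emeasure (count_space UNIV) {y \<in> ?S -` A. G y = b}) \<in> borel_measurable borel"
    proof (rule borel_measurable_count_zeros[of "\<lambda>b y. norm (G y - b)"])
      show "continuous_on UNIV (\<lambda>y. norm (G y - b))" for b
        using G by (intro continuous_intros)
          (meson continuous_at_imp_continuous_on has_derivative_continuous)
    qed (auto simp: A')
    then have m: "(\<lambda>b. emeasure (count_space UNIV) {y \<in> ?S -` A. G y = b} * ennreal (\<phi> (?S b)))
        \<in> borel_measurable borel"
      by measurable
    show ?thesis
      by (subst nn_integral_distr) (use m in \<open>simp_all add: count\<close>)
  qed
  also have "\<dots> = (\<integral>\<^sup>+ x. ennreal (\<bar>det (G' x)\<bar> * \<phi> (?S (G x))) * indicator (?S -` A) x \<partial>lborel)"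
    unfolding dR by (rule area_formula_wellorder[OF G cont' A' phi']) (use phi in simp)
  also have "\<dots> = (\<integral>\<^sup>+ x. ennreal (\<bar>det (F' (?S x))\<bar> * \<phi> (F (?S x))) * indicator A (?S x) \<partial>lborel)"
    by (intro nn_integral_cong) (simp add: det G_def indicator_def)
  also have "\<dots> = (\<integral>\<^sup>+ x. ennreal (\<bar>det (F' x)\<bar> * \<phi> (F x)) * indicator A x \<partial>distr lborel borel ?S)"
    by (subst nn_integral_distr) auto
  finally show "(\<integral>\<^sup>+ b. emeasure (count_space UNIV) {x \<in> A. F x = b} * ennreal (\<phi> b) \<partial>lborel)
       = (\<integral>\<^sup>+ x. ennreal (\<bar>det (F' x)\<bar> * \<phi> (F x)) * indicator A x \<partial>lborel)"
    unfolding dS .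
qed

subsection \<open>Second-order conditions\<close>

text \<open>Semidefinite rather than definite, because this set is closed, as the area formula and
  the measurability of counts require; at nondegenerate critical points the two notions
  agree.\<close>

definition possemidef :: "(real^'n^'n::finite) set" where
  "possemidef = {S. \<forall>v. 0 \<le> v \<bullet> (S *v v)}"

lemma closed_possemidef: "closed (possemidef :: (real^'n::finite^'n) set)"
proof -
  have eq: "possemidef = (\<Inter>v. {S :: real^'n^'n. 0 \<le> v \<bullet> (S *v v)})"
    by (auto simp: possemidef_def)
  have "closed {S. 0 \<le> v \<bullet> (S *v v)}" for v :: "real^'n"
    unfolding inner_outer[symmetric] by (intro closed_Collect_le continuous_intros)
  then show ?thesis unfolding eq by (intro closed_INT ballI)
qed

text \<open>Moving from \<open>v\<close> in the direction \<open>w = S *v v\<close> changes the form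
  by \<open>2 t |w|^2 + O(t^2)\<close>, which is negative for small negative \<open>t\<close> unless
  \<open>w = 0\<close>.\<close>

lemma possemidef_null_vector:
  assumes S: "transpose S = S" "S \<in> possemidef" and v: "v \<bullet> (S *v v) = 0"
  shows "S *v v = 0"
proof -
  define w where "w = S *v v"
  have q: "0 \<le> 2 * t * (w \<bullet> w) + t\<^sup>2 * (w \<bullet> (S *v w))" for t
  proof -
    have "0 \<le> (v + t *\<^sub>R w) \<bullet> (S *v (v + t *\<^sub>R w))"
      using S(2) by (simp add: possemidef_def)
    also have "\<dots> = 2 * t * (w \<bullet> w) + t\<^sup>2 * (w \<bullet> (S *v w))"
      using v symmetric_inner[OF S(1), of v w]
      by (simp add: matrix_vector_right_distrib inner_add_left inner_add_right
        matrix_vector_mult_scaleR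
          w_def[symmetric] power2_eq_square inner_commute algebra_simps)
    finally show ?thesis .
  qed
  show ?thesis
  proof (rule ccontr)
    assume "S *v v \<noteq> 0"
    then have p: "w \<bullet> w > 0" by (simp add: w_def)
    have q0: "0 \<le> w \<bullet> (S *v w)" using S(2) by (simp add: possemidef_def)
    \<comment> \<open>Small enough that the quadratic term is at most half of the linear one in
      size; the 1 in the denominator avoids division by zero.\<close>
    define t where "t = - (w \<bullet> w) / (1 + w \<bullet> (S *v w))"
    have "t < 0" using p q0 by (simp add: t_def divide_neg_pos)
    have "2 * t * (w \<bullet> w) + t\<^sup>2 * (w \<bullet> (S *v w)) = t * (2 * (w \<bullet> w) + t * (w \<bullet> (S *v w)))"
      by (simp add: power2_eq_square algebra_simps)
    moreover have "- t * (w \<bullet> (S *v w)) \<le> w \<bullet> w"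
      using p q0 by (simp add: t_def field_simps)
    then have "2 * (w \<bullet> w) + t * (w \<bullet> (S *v w)) > 0" using p by linarith
    ultimately show False
      using q[of t] \<open>t < 0\<close> mult_neg_pos by fastforce
  qed
qed

text \<open>A vector on which a semidefinite form vanishes lies in the kernel, and a nonsingular
  matrix has none besides 0.\<close>

lemma positive_definite_iff_possemidef:
  assumes "transpose S = S" "det S \<noteq> 0"
  shows "positive_definite S \<longleftrightarrow> S \<in> possemidef"
proof
  assume "positive_definite S"
  then show "S \<in> possemidef"
    unfolding positive_definite_def possemidef_def mem_Collect_eq
    by (metis inner_zero_left less_eq_real_def)
next
  assume S: "S \<in> possemidef"
  have "v \<bullet> (S *v v) > 0" if "v \<noteq> 0" for v
  proof -
    have "v \<bullet> (S *v v) \<noteq> 0"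
    proof
      assume "v \<bullet> (S *v v) = 0"
      then have "S *v v = 0" using possemidef_null_vector assms S by blast
      moreover obtain R where "R ** S = mat 1"
        using assms(2) invertible_det_nz[of S] by (auto simp: invertible_def)
      ultimately show False
        using that by (metis matrix_vector_mul_assoc matrix_vector_mul_lid
          matrix_vector_mult_0_right)
    qed
    then show ?thesis using S by (simp add: possemidef_def order_less_le)
  qed
  then show "positive_definite S"
    using assms(1) by (simp add: positive_definite_def)
qed

lemma norm_outer_self: "norm (outer v v) = (norm v)\<^sup>2"
proof -
  have "outer v v \<bullet> outer v v = (v \<bullet> v)\<^sup>2"
    unfolding inner_outer by (simp add: outer_mult_vec power2_eq_square)
  then have "(norm (outer v v))\<^sup>2 = ((norm v)\<^sup>2)\<^sup>2"
    by (simp add: power2_norm_eq_inner)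
  then show ?thesis by (rule power2_eq_imp_eq) auto
qed

text \<open>The quadratic form of \<open>S\<close> has a positive minimum \<open>c\<close> on the
  compact unit sphere, and passing to \<open>T\<close> changes it there by at most
  \<open>norm (T - S)\<close>.\<close>

lemma positive_definite_neighbourhood:
  assumes S: "positive_definite S"
  obtains e where "e > 0" "\<And>T. norm (T - S) < e \<Longrightarrow> T \<in> possemidef"
proof -
  have "compact (sphere (0 :: real^'n) 1)" by simp
  moreover have "sphere (0 :: real^'n) 1 \<noteq> {}" by simp
  moreover have "continuous_on (sphere 0 1) (\<lambda>v. v \<bullet> (S *v v))"
    by (intro continuous_intros)
  ultimately obtain u where u: "u \<in> sphere 0 1" "\<And>v. v \<in> sphere 0 1 \<Longrightarrow> u \<bullet> (S *v u) \<le> v \<bullet> (S *v v)"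
    using continuous_attains_inf by (metis (no_types, lifting))
  define c where "c = u \<bullet> (S *v u)"
  have c: "c > 0"
  proof -
    have "u \<noteq> 0" using u(1) by auto
    then show ?thesis using S by (simp add: positive_definite_def c_def)
  qed
  have lower: "c * (norm v)\<^sup>2 \<le> v \<bullet> (S *v v)" for v
  proof (cases "v = 0")
    case False
    then have "c \<le> (v /\<^sub>R norm v) \<bullet> (S *v (v /\<^sub>R norm v))"
      unfolding c_def by (intro u(2)) simp
    also have "\<dots> = (v \<bullet> (S *v v)) / (norm v)\<^sup>2"
      by (simp add: matrix_vector_mult_scaleR power2_eq_square divide_inverse)
    finally show ?thesis using False by (simp add: field_simps)
  qed simp
  show thesis
  proof
    fix T assume T: "norm (T - S) < c"
    show "T \<in> possemidef"
      unfolding possemidef_def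
    proof (intro CollectI allI)
      fix v
      have "\<bar>v \<bullet> ((T - S) *v v)\<bar> \<le> norm (T - S) * (norm v)\<^sup>2"
        unfolding inner_outer[symmetric] norm_outer_self[symmetric] by (rule Cauchy_Schwarz_ineq2)
      also have "\<dots> \<le> c * (norm v)\<^sup>2" using T by (intro mult_right_mono) auto
      finally show "0 \<le> v \<bullet> (T *v v)"
        using lower[of v] by (simp add: matrix_vector_mult_diff_rdistrib inner_diff_right)
    qed
  qed (rule c)
qed

section \<open>Critical points and local minima of a twice differentiable function\<close>

context
  fixes F :: "real^'n \<Rightarrow> real" and g :: "real^'n \<Rightarrow> real^'n" and H :: "real^'n \<Rightarrow> real^'n^'n"
  assumes F: "\<And>x. (F has_derivative (\<lambda>h. g x \<bullet> h)) (at x)"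
    and g: "\<And>x. (g has_derivative (\<lambda>h. H x *v h)) (at x)"
begin

lemma line_derivatives:
  "((\<lambda>t. F (x + t *\<^sub>R v)) has_real_derivative (g (x + t *\<^sub>R v) \<bullet> v)) (at t)"
  "((\<lambda>t. g (x + t *\<^sub>R v) \<bullet> v) has_real_derivative (v \<bullet> (H (x + t *\<^sub>R v) *v v))) (at t)"
proof -
  have l: "((\<lambda>t. x + t *\<^sub>R v) has_derivative (\<lambda>s. s *\<^sub>R v)) (at t)"
    by (auto intro!: derivative_eq_intros)
  have "((\<lambda>t. F (x + t *\<^sub>R v)) has_derivative (\<lambda>s. g (x + t *\<^sub>R v) \<bullet> (s *\<^sub>R v))) (at t)"
    by (rule has_derivative_compose[OF l F])
  then show "((\<lambda>t. F (x + t *\<^sub>R v)) has_real_derivative (g (x + t *\<^sub>R v) \<bullet> v)) (at t)"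
    by (simp add: has_field_derivative_def mult_commute_abs)
  have "((\<lambda>t. g (x + t *\<^sub>R v)) has_derivative (\<lambda>s. H (x + t *\<^sub>R v) *v (s *\<^sub>R v))) (at t)"
    by (rule has_derivative_compose[OF l g])
  then have "((\<lambda>t. g (x + t *\<^sub>R v) \<bullet> v) has_derivative (\<lambda>s. (H (x + t *\<^sub>R v) *v (s *\<^sub>R v))
      \<bullet> v)) (at t)"
    by (rule has_derivative_inner_left)
  then show "((\<lambda>t. g (x + t *\<^sub>R v) \<bullet> v) has_real_derivative (v \<bullet> (H (x + t *\<^sub>R v) *v v))) (at t)"
    by (simp add: has_field_derivative_def mult_commute_abs matrix_vector_mult_scaleR inner_commute)
qed

lemma critical_point_iff_gradient: "critical_point F x \<longleftrightarrow> g x = 0"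
proof
  assume "critical_point F x"
  then have "(\<lambda>h. g x \<bullet> h) = (\<lambda>_. 0)"
    unfolding critical_point_def using F has_derivative_unique by blast
  then have "g x \<bullet> g x = 0" by (rule fun_cong)
  then show "g x = 0" by simp
next
  assume "g x = 0"
  then show "critical_point F x" using F[of x] by (simp add: critical_point_def)
qed

text \<open>If the curvature along \<open>v\<close> were negative, the slope along \<open>v\<close>,
  which is 0 at \<open>x\<close>, would be negative just after, and by the mean value theorem the
  function would fall below its value at \<open>x\<close>.\<close>

lemma local_minimum_necessary:
  assumes "local_minimum F x"
  shows "g x = 0" "H x \<in> possemidef"
proof -
  obtain S where S: "open S" "x \<in> S" "\<And>y. y \<in> S \<Longrightarrow> F x \<le> F y"
    using assms unfolding local_minimum_def eventually_nhds by blast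
  then have "(\<lambda>h. g x \<bullet> h) = (\<lambda>_. 0)"
    using differential_zero_maxmin[OF S(2,1) F] by blast
  then have "g x \<bullet> g x = 0" by (rule fun_cong)
  then show gx: "g x = 0" by simp
  show "H x \<in> possemidef"
    unfolding possemidef_def
  proof (intro CollectI allI, rule ccontr)
    fix v assume "\<not> 0 \<le> v \<bullet> (H x *v v)"
    then have neg: "v \<bullet> (H x *v v) < 0" by simp
    have "((\<lambda>t. g (x + t *\<^sub>R v) \<bullet> v) has_real_derivative (v \<bullet> (H x *v v))) (at 0)"
      using line_derivatives(2)[of x v 0] by simp
    from DERIV_neg_dec_right[OF this neg] obtain d where d: "d > 0"
      "\<And>h. h > 0 \<Longrightarrow> h < d \<Longrightarrow> g (x + h *\<^sub>R v) \<bullet> v < 0"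
      by (auto simp: gx)
    obtain e where e: "e > 0" "ball x e \<subseteq> S"
      using S(1,2) openE by blast
    \<comment> \<open>Keeps \<open>t\<close> below \<open>d\<close>, where the slope is negative,
      and \<open>x + t *\<^sub>R v\<close> within distance \<open>e / 2\<close> of \<open>x\<close>;
      adding 1 to \<open>norm v\<close> avoids division by zero.\<close>
    define t where "t = min (d / 2) (e / (2 * (norm v + 1)))"
    have t: "t > 0" "t < d"
      using d e by (auto simp: t_def min_less_iff_disj intro!: divide_pos_pos add_nonneg_pos)
    have "t * norm v \<le> (e / (2 * (norm v + 1))) * (norm v + 1)"
      using e by (intro mult_mono) (auto simp: t_def)
    also have "\<dots> = e / 2"
    proof -
      have "norm v + 1 \<noteq> 0" using norm_ge_zero[of v] by linarith
      then show ?thesis by (simp add: field_simps)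
    qed
    also have "\<dots> < e" using e by simp
    finally have "x + t *\<^sub>R v \<in> ball x e"
      using t by (simp add: dist_norm)
    then have le: "F x \<le> F (x + t *\<^sub>R v)" using S(3) e by blast
    obtain z where z: "0 < z" "z < t" "F (x + t *\<^sub>R v) - F (x + 0 *\<^sub>R v)
        = (t - 0) * (g (x + z *\<^sub>R v) \<bullet> v)"
      using MVT2[OF t(1) line_derivatives(1)[of x v]] by auto
    then have "F (x + t *\<^sub>R v) - F x < 0"
      using d(2)[of z] t by (simp add: mult_pos_neg)
    with le show False by simp
  qed
qed

text \<open>Definiteness at \<open>x\<close> gives semidefinite Hessians on a whole ball; two
  applications of the mean value theorem along segments from \<open>x\<close> then show that the
  slopes, and hence the increments, are nonnegative.\<close>

lemma local_minimum_sufficient: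
  assumes cont: "continuous_on UNIV H" and gx: "g x = 0" and pd: "positive_definite (H x)"
  shows "local_minimum F x"
proof -
  obtain e where e: "e > 0" "\<And>T. norm (T - H x) < e \<Longrightarrow> T \<in> possemidef"
    using positive_definite_neighbourhood[OF pd] by metis
  obtain d where d: "d > 0" "\<And>y. dist y x < d \<Longrightarrow> dist (H y) (H x) < e"
    using cont e(1) unfolding continuous_on_iff by (metis UNIV_I)
  have "F x \<le> F y" if y: "y \<in> ball x d" for y
  proof -
    define v where "v = y - x"
    have ps: "0 \<le> v \<bullet> (H (x + t *\<^sub>R v) *v v)" if "0 \<le> t" "t \<le> 1" for t
    proof -
      have "dist (x + t *\<^sub>R v) x \<le> norm v"
        using that by (simp add: dist_norm mult_left_le_one_le)
      also have "\<dots> < d" using y by (simp add: v_def dist_norm norm_minus_commute)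
      finally have "H (x + t *\<^sub>R v) \<in> possemidef"
        using d e by (simp add: dist_norm)
      then show ?thesis by (simp add: possemidef_def)
    qed
    have gt: "0 \<le> g (x + t *\<^sub>R v) \<bullet> v" if t: "0 < t" "t < 1" for t
    proof -
      obtain z where "0 < z" "z < t"
        "g (x + t *\<^sub>R v) \<bullet> v - g (x + 0 *\<^sub>R v) \<bullet> v = (t - 0) * (v \<bullet> (H (x + z *\<^sub>R v) *v v))"
        using MVT2[OF t(1) line_derivatives(2)[of x v]] by auto
      then show ?thesis using ps[of z] t by (simp add: gx)
    qed
    obtain z where "0 < z" "z < 1" "F (x + 1 *\<^sub>R v) - F (x + 0 *\<^sub>R v)
        = (1 - 0) * (g (x + z *\<^sub>R v) \<bullet> v)"
      using MVT2[OF zero_less_one line_derivatives(1)[of x v]] by auto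
    then show ?thesis using gt[of z] by (simp add: v_def)
  qed
  then show ?thesis
    unfolding local_minimum_def eventually_nhds using d(1) by (intro exI[of _ "ball x d"]) auto
qed

end

subsection \<open>The Kac-Rice formula\<close>

definition unit_index :: "'n \<Rightarrow> 'n::finite \<Rightarrow> nat" where
  "unit_index i = (\<lambda>j. if j = i then 1 else 0)"

definition poly_grad :: "nat \<Rightarrow> (('n::finite \<Rightarrow> nat) \<Rightarrow> real) \<Rightarrow> real^'n \<Rightarrow> real^'n" where
  "poly_grad d f x = (\<Sum>\<alpha>\<in>multi_indices d. f \<alpha> *\<^sub>R monom_grad \<alpha> x)"

definition poly_hess :: "nat \<Rightarrow> (('n::finite \<Rightarrow> nat) \<Rightarrow> real) \<Rightarrow> real^'n \<Rightarrow> real^'n^'n" where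
  "poly_hess d f x = (\<Sum>\<alpha>\<in>multi_indices d. f \<alpha> *\<^sub>R monom_hess \<alpha> x)"

definition nonlinear_grad :: "nat \<Rightarrow> (('n::finite \<Rightarrow> nat) \<Rightarrow> real) \<Rightarrow> real^'n \<Rightarrow> real^'n" where
  "nonlinear_grad d f x = (\<Sum>\<alpha>\<in>multi_indices d - range unit_index. f \<alpha> *\<^sub>R monom_grad \<alpha> x)"

text \<open>A coefficient of degree one has variance \<open>d\<close>, so it may be resampled from a standard Gaussian vector
  without changing the law of the family.\<close>

definition replace_linear :: "nat \<Rightarrow> (('n::finite \<Rightarrow> nat) \<Rightarrow> real) \<Rightarrow> real^'n \<Rightarrow> ('n \<Rightarrow> nat) \<Rightarrow> real" where
  "replace_linear d f b \<alpha> = (if \<alpha> \<in> range unit_index then sqrt (real d)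
    * b $ (inv unit_index \<alpha>) else f \<alpha>)"

lemma unit_index_same [simp]: "unit_index i i = 1"
  by (simp add: unit_index_def)

lemma inj_unit_index: "inj unit_index"
  by (auto simp: inj_def unit_index_def fun_eq_iff split: if_splits)

lemma replace_linear_unit [simp]: "replace_linear d f b (unit_index i) = sqrt (real d) * b $ i"
  by (simp add: replace_linear_def inv_f_f[OF inj_unit_index])

lemma sum_unit_index [simp]: "(\<Sum>j\<in>UNIV. unit_index i j) = 1"
  by (simp add: unit_index_def)

lemma unit_index_in: "d \<ge> 1 \<Longrightarrow> range unit_index \<subseteq> multi_indices d"
  by (auto simp: multi_indices_def)

lemma multinomial_unit_index: "d \<ge> 1 \<Longrightarrow> multinomial d (unit_index i) = real d"
  by (cases d) (simp_all add: multinomial_def, simp add: unit_index_def if_distrib[of fact] cong: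
    if_cong)

lemma multinomial_pos: "multinomial d \<alpha> > 0"
  by (auto simp: multinomial_def intro!: divide_pos_pos mult_pos_pos prod_pos)

lemma monom_grad_unit_index: "monom_grad (unit_index i) x = axis i 1"
proof -
  have "(unit_index i)(i := unit_index i i - 1) = (\<lambda>_. 0)"
    by (auto simp: unit_index_def)
  then have "monom_fun ((unit_index i)(i := unit_index i i - 1)) x = 1"
    by (simp add: monom_fun_def)
  then show ?thesis
    by (auto simp: vec_eq_iff monom_grad_def axis_def unit_index_def)
qed

lemma monom_grad_0: "monom_grad (\<lambda>_. 0) x = 0"
  by (simp add: monom_grad_def vec_eq_iff)

lemma monom_hess_unit_index: "monom_hess (unit_index i) x = 0"
proof -
  have z: "(unit_index i)(i := 0) = (\<lambda>_. 0)"
    by (auto simp: unit_index_def)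
  have "monom_hess (unit_index i) x $ j = 0" for j
  proof (cases "j = i")
    case True
    then show ?thesis by (simp add: monom_hess_def z monom_grad_0)
  qed (simp add: monom_hess_def unit_index_def)
  then show ?thesis by (simp add: vec_eq_iff)
qed

lemma poly_fun_derivative: "(poly_fun d f has_derivative (\<lambda>h. poly_grad d f x \<bullet> h)) (at x)"
proof -
  have "((\<lambda>x. \<Sum>\<alpha>\<in>multi_indices d. f \<alpha> * monom_fun \<alpha> x) has_derivative
    (\<lambda>h. \<Sum>\<alpha>\<in>multi_indices d. f \<alpha> * (monom_grad \<alpha> x \<bullet> h))) (at x)"
    by (intro has_derivative_sum has_derivative_mult_right monom_fun_derivative)
  then show ?thesis
    by (simp add: poly_fun_def[abs_def] monom_fun_def poly_grad_def inner_sum_left)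
qed

lemma poly_grad_derivative: "(poly_grad d f has_derivative (\<lambda>h. poly_hess d f x *v h)) (at x)"
proof -
  have "((\<lambda>x. \<Sum>\<alpha>\<in>multi_indices d. f \<alpha> *\<^sub>R monom_grad \<alpha> x) has_derivative
    (\<lambda>h. \<Sum>\<alpha>\<in>multi_indices d. f \<alpha> *\<^sub>R (monom_hess \<alpha> x *v h))) (at x)"
    by (intro has_derivative_sum has_derivative_scaleR_right monom_grad_derivative)
  then show ?thesis
    by (simp add: poly_grad_def[abs_def] poly_hess_def sum_matrix_vector_mult
      scaleR_matrix_vector_assoc)
qed

lemma continuous_on_poly_grad: "continuous_on S (poly_grad d f)"
  unfolding poly_grad_def by (intro continuous_intros)

lemma continuous_on_poly_hess: "continuous_on S (poly_hess d f)"
  unfolding poly_hess_def by (intro continuous_intros)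

lemma transpose_poly_hess: "transpose (poly_hess d f x) = poly_hess d f x"
proof -
  have s: "monom_hess \<alpha> x $ i $ j = monom_hess \<alpha> x $ j $ i" for \<alpha> i j
    using transpose_monom_hess[of \<alpha> x] by (simp add: vec_eq_iff transpose_def)
  show ?thesis
    unfolding vec_eq_iff
  proof (intro allI)
    fix i j show "transpose (poly_hess d f x) $ i $ j = poly_hess d f x $ i $ j"
      by (simp add: transpose_def poly_hess_def s[of _ j i])
  qed
qed

lemma
  assumes "d \<ge> 1"
  shows poly_grad_split: "poly_grad d f x = nonlinear_grad d f x + (\<chi> i. f (unit_index i))"
    and poly_hess_split: "poly_hess d f x
      = (\<Sum>\<alpha>\<in>multi_indices d - range unit_index. f \<alpha> *\<^sub>R monom_hess \<alpha> x)"
proof -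
  have "(\<Sum>\<alpha>\<in>range unit_index. f \<alpha> *\<^sub>R monom_grad \<alpha> x) = (\<Sum>i\<in>UNIV. f (unit_index i) *\<^sub>R axis i 1)"
    by (simp add: sum.reindex[OF inj_unit_index] monom_grad_unit_index)
  also have "\<dots> = (\<chi> i. f (unit_index i))"
    by (simp add: vec_eq_iff axis_def if_distrib cong: if_cong)
  finally show "poly_grad d f x = nonlinear_grad d f x + (\<chi> i. f (unit_index i))"
    unfolding poly_grad_def nonlinear_grad_def
    by (subst sum.subset_diff[OF unit_index_in[OF assms]]) auto
  have "(\<Sum>\<alpha>\<in>range unit_index. f \<alpha> *\<^sub>R monom_hess \<alpha> x) = 0"
    by (auto intro!: sum.neutral simp: monom_hess_unit_index)
  then show "poly_hess d f x = (\<Sum>\<alpha>\<in>multi_indices d - range unit_index. f \<alpha> *\<^sub>R monom_hess \<alpha> x)"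
    unfolding poly_hess_def by (subst sum.subset_diff[OF unit_index_in[OF assms]]) auto
qed

lemma nonlinear_grad_replace: "nonlinear_grad d (replace_linear d f b) x = nonlinear_grad d f x"
  unfolding nonlinear_grad_def by (intro sum.cong) (auto simp: replace_linear_def)

lemma poly_hess_replace: "d \<ge> 1 \<Longrightarrow> poly_hess d (replace_linear d f b) x = poly_hess d f x"
  unfolding poly_hess_split by (intro sum.cong) (auto simp: replace_linear_def)

lemma poly_grad_replace:
  assumes "d \<ge> 1"
  shows "poly_grad d (replace_linear d f b) x = nonlinear_grad d f x + sqrt (real d) *\<^sub>R b"
  unfolding poly_grad_split[OF assms] nonlinear_grad_replace by (simp add: vec_eq_iff)

section \<open>Resampling the linear coefficients\<close>

lemma measurable_random_coeffs_component:
  "\<alpha> \<in> multi_indices d \<Longrightarrow> (\<lambda>f. f \<alpha>) \<in> borel_measurable (random_coeffs d)"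
  unfolding random_coeffs_def
  using measurable_component_singleton[of \<alpha> "multi_indices d" "\<lambda>\<alpha>. density lborel
    (normal_density 0 (sqrt (multinomial d \<alpha>)))"]
  by (simp add: measurable_cong_sets[OF refl sets_density])

lemma prob_space_random_coeffs: "prob_space (random_coeffs d)"
  unfolding random_coeffs_def
  by (rule prob_space_PiM) (simp add: prob_space_normal_density multinomial_pos)

lemma emeasure_std_gaussian_product:
  assumes [measurable]: "\<And>i. B i \<in> sets borel"
  shows "emeasure std_gaussian {b :: real^'n. \<forall>i. b $ i \<in> B i}
    = (\<Prod>i\<in>UNIV. emeasure std_normal_distribution (B i))"
proof -
  interpret product_prob_space "\<lambda>_::real^'n. std_normal_distribution"
    by (simp add: product_prob_spaceI prob_space_std_normal)
  \<comment> \<open>The product measure is indexed by basis vectors; the coordinate sets are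
    transferred by recovering \<open>i\<close> from \<open>axis i 1\<close>.\<close>
  have ex: "\<exists>C. \<forall>i. C (axis i 1 :: real^'n) = B i"
    by (rule exI[of _ "\<lambda>b. B (SOME i. b = axis i 1)"]) (simp add: axis_eq_axis)
  then obtain C where C: "\<And>i. C (axis i 1 :: real^'n) = B i" by blast
  have CB: "C b \<in> sets borel" if "b \<in> Basis" for b
    using that by (auto simp: Basis_vec_def C)
  have nth: "(\<Sum>b\<in>Basis. f b *\<^sub>R b) $ i = f (axis i 1)" for f :: "real^'n \<Rightarrow> real" and i
  proof -
    have "(\<Sum>b\<in>Basis. f b *\<^sub>R b) $ i = (\<Sum>b\<in>Basis. f b *\<^sub>R b) \<bullet> axis i 1"
      by (simp add: inner_axis)
    also have "\<dots> = f (axis i 1)"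
      by (simp add: inner_sum_left inner_Basis if_distrib sum.delta cong: if_cong)
    finally show ?thesis .
  qed
  have [measurable]: "{b :: real^'n. \<forall>i. b $ i \<in> B i} \<in> sets borel" by measurable
  have "emeasure std_gaussian {b :: real^'n. \<forall>i. b $ i \<in> B i}
     = emeasure (PiM Basis (\<lambda>_. std_normal_distribution)) (Pi\<^sub>E Basis C)"
  proof -
    have "(\<lambda>f. \<Sum>b\<in>Basis. f b *\<^sub>R b) -` {b :: real^'n. \<forall>i. b $ i \<in> B i}
        \<inter> space (PiM Basis (\<lambda>_. std_normal_distribution))
      = Pi\<^sub>E Basis C"
    proof -
      have "(\<forall>b\<in>Basis. f b \<in> C b) \<longleftrightarrow> (\<forall>i. f (axis i 1) \<in> B i)" for f
        by (auto simp: Basis_vec_def C)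
      then show ?thesis
        by (auto simp: nth space_PiM PiE_iff simp del: sum_component)
    qed
    moreover have "(\<lambda>f. \<Sum>b\<in>Basis. f b *\<^sub>R b)
        \<in> borel_measurable (PiM (Basis :: (real^'n) set) (\<lambda>_. std_normal_distribution))"
      by measurable
    ultimately show ?thesis
      unfolding std_gaussian_eq_distr by (subst emeasure_distr) auto
  qed
  also have "\<dots> = (\<Prod>b\<in>Basis. emeasure std_normal_distribution (C b))"
    using CB by (intro emeasure_PiM) auto
  also have "\<dots> = (\<Prod>i\<in>UNIV. emeasure std_normal_distribution (B i))"
    by (simp add: prod_Basis_cart C)
  finally show ?thesis .
qed

lemma measurable_replace_linear:
  assumes d: "d \<ge> 1"
  shows "(\<lambda>(f, b :: real^'n::finite). replace_linear d f b)
    \<in> random_coeffs d \<Otimes>\<^sub>M std_gaussian \<rightarrow>\<^sub>M random_coeffs d"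
proof -
  let ?I = "multi_indices d :: ('n \<Rightarrow> nat) set" and ?J = "range (unit_index :: 'n \<Rightarrow> 'n \<Rightarrow> nat)"
  let ?N = "\<lambda>\<alpha> :: 'n \<Rightarrow> nat. density lborel (normal_density 0 (sqrt (multinomial d \<alpha>)))"
  have J: "?J \<subseteq> ?I" by (rule unit_index_in[OF d])
  have ext: "f \<alpha> = undefined" if "f \<in> space (random_coeffs d)" "\<alpha> \<notin> ?I" for f :: "('n \<Rightarrow> nat) \<Rightarrow> real"
      and \<alpha>
    using that by (auto simp: random_coeffs_def space_PiM PiE_def extensional_def)
  show ?thesis
    unfolding random_coeffs_def
  proof (rule measurable_PiM_single')
    fix \<alpha> :: "'n \<Rightarrow> nat" assume \<alpha>: "\<alpha> \<in> ?I"
    have "(\<lambda>p. replace_linear d (fst p) (snd p) \<alpha>)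
        \<in> borel_measurable (random_coeffs d \<Otimes>\<^sub>M std_gaussian)"
    proof (cases "\<alpha> \<in> ?J")
      case True
      have "(\<lambda>b :: real^'n. sqrt (real d) * b $ inv unit_index \<alpha>) \<in> borel_measurable std_gaussian"
        by measurable
      from measurable_compose[OF measurable_snd this]
      have "(\<lambda>p. sqrt (real d) * snd p $ inv unit_index \<alpha>)
          \<in> borel_measurable (random_coeffs d \<Otimes>\<^sub>M (std_gaussian :: (real^'n) measure))" .
      with True show ?thesis unfolding replace_linear_def by simp
    next
      case False
      then show ?thesis
        unfolding replace_linear_def
        using measurable_compose[OF measurable_fst measurable_random_coeffs_component[OF \<alpha>]] by simp
    qed
    then show "(\<lambda>p. (case p of (f, b) \<Rightarrow> replace_linear d f b) \<alpha>)
        \<in> Pi\<^sub>M ?I ?N \<Otimes>\<^sub>M std_gaussian \<rightarrow>\<^sub>M ?N \<alpha>"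
      by (simp add: split_beta' random_coeffs_def measurable_cong_sets[OF refl sets_density])
  next
    show "(\<lambda>(f, b). replace_linear d f b)
        \<in> space (Pi\<^sub>M ?I ?N \<Otimes>\<^sub>M std_gaussian) \<rightarrow> (\<Pi>\<^sub>E \<alpha>\<in>?I. space (?N \<alpha>))"
      using ext J[THEN subsetD, OF rangeI]
      by (auto simp: space_pair_measure PiE_iff extensional_def replace_linear_def
        random_coeffs_def)
  qed
qed

text \<open>Verified on rectangles. The preimage of a rectangle is the product of a rectangle whose
  linear coordinates are free, each then of mass one, and a product set of vectors \<open>b\<close>;
  scaling by \<open>sqrt (real d)\<close> gives the required variance \<open>d\<close>.\<close>

lemma distr_replace_linear:
  assumes d: "d \<ge> 1"
  shows "distr (random_coeffs d \<Otimes>\<^sub>M std_gaussian) (random_coeffs d)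
    (\<lambda>(f, b :: real^'n::finite). replace_linear d f b)
    = random_coeffs d"
proof -
  let ?I = "multi_indices d :: ('n \<Rightarrow> nat) set" and ?J = "range (unit_index :: 'n \<Rightarrow> 'n \<Rightarrow> nat)"
  let ?N = "\<lambda>\<alpha> :: 'n \<Rightarrow> nat. density lborel (normal_density 0 (sqrt (multinomial d \<alpha>)))"
  have pN: "prob_space (?N \<alpha>)" for \<alpha>
    by (rule prob_space_normal_density) (simp add: multinomial_pos)
  interpret product_prob_space ?N
    by (simp add: product_prob_spaceI pN)
  interpret R: prob_space "random_coeffs d :: (('n \<Rightarrow> nat) \<Rightarrow> real) measure"
    by (rule prob_space_random_coeffs)
  interpret G: prob_space "std_gaussian :: (real^'n) measure" by (rule prob_space_std_gaussian)
  have J: "?J \<subseteq> ?I" by (rule unit_index_in[OF d])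
  have ext: "f \<alpha> = undefined" if "f \<in> space (random_coeffs d)" "\<alpha> \<notin> ?I" for f :: "('n \<Rightarrow> nat) \<Rightarrow> real"
      and \<alpha>
    using that by (auto simp: random_coeffs_def space_PiM PiE_def extensional_def)
  have meas: "(\<lambda>(f, b :: real^'n). replace_linear d f b)
      \<in> random_coeffs d \<Otimes>\<^sub>M std_gaussian \<rightarrow>\<^sub>M random_coeffs d"
    by (rule measurable_replace_linear[OF d])
  have "distr (random_coeffs d \<Otimes>\<^sub>M std_gaussian) (random_coeffs d)
      (\<lambda>(f, b :: real^'n). replace_linear d f b) = Pi\<^sub>M ?I ?N"
  proof (rule PiM_eqI)
    show "sets (distr (random_coeffs d \<Otimes>\<^sub>M std_gaussian) (random_coeffs d)
        (\<lambda>(f, b :: real^'n). replace_linear d f b)) = sets (Pi\<^sub>M ?I ?N)"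
      by (simp add: random_coeffs_def)
    fix A assume A: "\<And>\<alpha>. \<alpha> \<in> ?I \<Longrightarrow> A \<alpha> \<in> sets (?N \<alpha>)"
    have [measurable]: "Pi\<^sub>E ?I A \<in> sets (random_coeffs d)"
      using A unfolding random_coeffs_def by (intro sets_PiM_I_finite) auto
    define A' where "A' \<alpha> = (if \<alpha> \<in> ?J then UNIV else A \<alpha>)" for \<alpha>
    define B where "B i = (\<lambda>x. sqrt (real d) * x) -` A (unit_index i)" for i
    have Au: "A (unit_index i) \<in> sets borel" for i
      using A[of "unit_index i"] J by auto
    have [measurable]: "B i \<in> sets borel" for i
    proof -
      have "(\<lambda>x. sqrt (real d) * x) -` A (unit_index i) \<inter> space borel \<in> sets borel"
        by (rule measurable_sets[OF _ Au]) measurable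
      then show ?thesis by (simp add: B_def)
    qed
    have [measurable]: "Pi\<^sub>E ?I A' \<in> sets (random_coeffs d)"
      using A unfolding random_coeffs_def by (intro sets_PiM_I_finite) (auto simp: A'_def)
    have Bm [measurable]: "{b :: real^'n. \<forall>i. b $ i \<in> B i} \<in> sets std_gaussian" by measurable
    have "(\<lambda>(f, b). replace_linear d f b) -` Pi\<^sub>E ?I A \<inter> space (random_coeffs d \<Otimes>\<^sub>M std_gaussian)
      = Pi\<^sub>E ?I A' \<times> {b. \<forall>i. b $ i \<in> B i}" (is "?L = ?R")
    proof (intro set_eqI iffI)
      fix p assume p: "p \<in> ?L"
      obtain f b where [simp]: "p = (f, b)" by (cases p)
      have 1: "replace_linear d f b \<alpha> \<in> A \<alpha>" if "\<alpha> \<in> ?I" for \<alpha>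
        using p that by (auto simp: PiE_iff)
      have "b $ i \<in> B i" for i
        using 1[of "unit_index i"] J by (auto simp: B_def)
      moreover have "f \<in> Pi\<^sub>E ?I A'"
        unfolding PiE_iff extensional_def
      proof (intro conjI ballI CollectI allI impI)
        fix \<alpha> assume "\<alpha> \<in> ?I"
        then show "f \<alpha> \<in> A' \<alpha>" using 1[of \<alpha>] by (auto simp: A'_def replace_linear_def)
      next
        fix \<alpha> assume "\<alpha> \<notin> ?I"
        then show "f \<alpha> = undefined" using p ext by (auto simp: space_pair_measure)
      qed
      ultimately show "p \<in> ?R" by simp
    next
      fix p assume p: "p \<in> ?R"
      obtain f b where [simp]: "p = (f, b)" by (cases p)
      have f: "f \<in> Pi\<^sub>E ?I A'" and b: "\<And>i. b $ i \<in> B i" using p by auto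
      have sp: "f \<in> space (random_coeffs d)"
        using f by (auto simp: random_coeffs_def space_PiM PiE_iff)
      have "replace_linear d f b \<in> Pi\<^sub>E ?I A"
        unfolding PiE_iff extensional_def
      proof (intro conjI ballI CollectI allI impI)
        fix \<alpha> assume "\<alpha> \<in> ?I"
        show "replace_linear d f b \<alpha> \<in> A \<alpha>"
        proof (cases "\<alpha> \<in> ?J")
          case True
          then obtain i where "\<alpha> = unit_index i" by blast
          then show ?thesis using b[of i] by (simp add: B_def)
        next
          case False
          then show ?thesis using f \<open>\<alpha> \<in> ?I\<close> by (auto simp: PiE_iff A'_def replace_linear_def)
        qed
      next
        fix \<alpha> assume "\<alpha> \<notin> ?I"
        then show "replace_linear d f b \<alpha> = undefined"
          using J ext[OF sp] by (auto simp: replace_linear_def)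
      qed
      then show "p \<in> ?L" using sp by (simp add: space_pair_measure)
    qed
    then have "emeasure (distr (random_coeffs d \<Otimes>\<^sub>M std_gaussian) (random_coeffs d)
        (\<lambda>(f, b :: real^'n). replace_linear d f b)) (Pi\<^sub>E ?I A)
      = emeasure (random_coeffs d \<Otimes>\<^sub>M std_gaussian) (Pi\<^sub>E ?I A' \<times> {b. \<forall>i. b $ i \<in> B i})"
      by (subst emeasure_distr[OF meas]) auto
    also have "\<dots> = emeasure (random_coeffs d) (Pi\<^sub>E ?I A')
        * emeasure std_gaussian {b :: real^'n. \<forall>i. b $ i \<in> B i}"
      by (intro G.emeasure_pair_measure_Times) measurable
    also have "emeasure (random_coeffs d) (Pi\<^sub>E ?I A') = (\<Prod>\<alpha>\<in>?I. emeasure (?N \<alpha>) (A' \<alpha>))"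
      unfolding random_coeffs_def using A by (intro emeasure_PiM) (auto simp: A'_def)
    also have "\<dots> = (\<Prod>\<alpha>\<in>?I - ?J. emeasure (?N \<alpha>) (A \<alpha>))"
    proof -
      have "emeasure (?N \<alpha>) UNIV = 1" for \<alpha>
        using prob_space.emeasure_space_1[OF pN[of \<alpha>]] by simp
      then show ?thesis
        by (subst prod.subset_diff[OF J]) (auto simp: A'_def intro!: prod.cong)
    qed
    also have "emeasure std_gaussian {b :: real^'n. \<forall>i. b $ i \<in> B i}
        = (\<Prod>\<alpha>\<in>?J. emeasure (?N \<alpha>) (A \<alpha>))"
    proof -
      have "emeasure (?N (unit_index i)) (A (unit_index i))
          = emeasure std_normal_distribution (B i)" for i :: 'n
        using d Au[of i]
        by (simp add: multinomial_unit_index normal_density_scale[of "sqrt (real d)"] emeasure_distr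
          B_def)
      then show ?thesis
        by (simp add: emeasure_std_gaussian_product prod.reindex[OF inj_unit_index])
    qed
    also have "(\<Prod>\<alpha>\<in>?I - ?J. emeasure (?N \<alpha>) (A \<alpha>)) * (\<Prod>\<alpha>\<in>?J. emeasure (?N \<alpha>) (A \<alpha>))
        = (\<Prod>\<alpha>\<in>?I. emeasure (?N \<alpha>) (A \<alpha>))"
      by (rule prod.subset_diff[OF J, symmetric]) simp
    finally show "emeasure (distr (random_coeffs d \<Otimes>\<^sub>M std_gaussian) (random_coeffs d)
        (\<lambda>(f, b :: real^'n). replace_linear d f b)) (Pi\<^sub>E ?I A)
      = (\<Prod>\<alpha>\<in>?I. emeasure (?N \<alpha>) (A \<alpha>))" .
  qed simp
  then show ?thesis
    by (simp only: random_coeffs_def[symmetric])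
qed

text \<open>Makes the linear coefficients the inner integration variable, with an explicit density
  against Lebesgue measure, which is the shape of the area formula.\<close>

lemma nn_integral_replace_linear:
  fixes h :: "(('n::finite \<Rightarrow> nat) \<Rightarrow> real) \<Rightarrow> ennreal"
  assumes d: "d \<ge> 1" and [measurable]: "h \<in> borel_measurable (random_coeffs d)"
  shows "(\<integral>\<^sup>+ f. h f \<partial>random_coeffs d)
    = (\<integral>\<^sup>+ f. (\<integral>\<^sup>+ b. h (replace_linear d f (b :: real^'n)) * ennreal (std_gaussian_density b)
      \<partial>lborel) \<partial>random_coeffs d)"
proof -
  interpret G: prob_space "std_gaussian :: (real^'n) measure" by (rule prob_space_std_gaussian)
  have m: "(\<lambda>(f, b :: real^'n). replace_linear d f b)
      \<in> random_coeffs d \<Otimes>\<^sub>M std_gaussian \<rightarrow>\<^sub>M random_coeffs d"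
    by (rule measurable_replace_linear[OF d])
  have hm: "(\<lambda>p. h (replace_linear d (fst p) (snd p :: real^'n)))
      \<in> borel_measurable (random_coeffs d \<Otimes>\<^sub>M std_gaussian)"
    using measurable_compose[OF m assms(2)] by (simp add: split_beta')
  have "(\<integral>\<^sup>+ f. h f \<partial>random_coeffs d)
    = (\<integral>\<^sup>+ f. h f \<partial>distr (random_coeffs d \<Otimes>\<^sub>M std_gaussian) (random_coeffs d)
      (\<lambda>(f, b :: real^'n). replace_linear d f b))"
    by (simp add: distr_replace_linear[OF d])
  also have "\<dots> = (\<integral>\<^sup>+ p. h (replace_linear d (fst p) (snd p :: real^'n))
      \<partial>(random_coeffs d \<Otimes>\<^sub>M std_gaussian))"
    by (subst nn_integral_distr[OF m]) (simp_all add: split_beta')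
  also have "\<dots> = (\<integral>\<^sup>+ f. (\<integral>\<^sup>+ b. h (replace_linear d f (b :: real^'n)) \<partial>std_gaussian)
      \<partial>random_coeffs d)"
    by (subst G.nn_integral_fst[symmetric, OF hm]) simp
  also have "\<dots> = (\<integral>\<^sup>+ f. (\<integral>\<^sup>+ b. h (replace_linear d f (b :: real^'n))
      * ennreal (std_gaussian_density b) \<partial>lborel) \<partial>random_coeffs d)"
  proof (intro nn_integral_cong)
    fix f :: "('n \<Rightarrow> nat) \<Rightarrow> real" assume f: "f \<in> space (random_coeffs d)"
    have "(\<lambda>b :: real^'n. h (replace_linear d f b)) \<in> borel_measurable std_gaussian"
      using measurable_Pair2[OF hm f] by simp
    then have [measurable]: "(\<lambda>b :: real^'n. h (replace_linear d f b)) \<in> borel_measurable borel"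
      by (simp add: measurable_cong_sets[OF sets_std_gaussian refl])
    show "(\<integral>\<^sup>+ b. h (replace_linear d f (b :: real^'n)) \<partial>std_gaussian)
      = (\<integral>\<^sup>+ b. h (replace_linear d f b) * ennreal (std_gaussian_density b) \<partial>lborel)"
      unfolding std_gaussian_def by (subst nn_integral_density) (auto simp: mult.commute)
  qed
  finally show ?thesis .
qed

section \<open>Measurability, the counting formula and nondegeneracy\<close>

lemma measurable_poly_grad: "(\<lambda>f. poly_grad d f x) \<in> borel_measurable (random_coeffs d)"
  unfolding poly_grad_def
  by (intro borel_measurable_sum borel_measurable_scaleR measurable_random_coeffs_component) auto

lemma measurable_poly_hess: "(\<lambda>f. poly_hess d f x) \<in> borel_measurable (random_coeffs d)"
  unfolding poly_hess_def
  by (intro borel_measurable_sum borel_measurable_scaleR measurable_random_coeffs_component) auto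

lemma measurable_nonlinear_grad_pair:
  "(\<lambda>p. nonlinear_grad d (fst p) (snd p :: real^'n::finite))
    \<in> borel_measurable (random_coeffs d \<Otimes>\<^sub>M borel)"
  unfolding nonlinear_grad_def
proof (intro borel_measurable_sum borel_measurable_scaleR)
  fix \<alpha> :: "'n \<Rightarrow> nat" assume "\<alpha> \<in> multi_indices d - range unit_index"
  then show "(\<lambda>p. fst p \<alpha>) \<in> borel_measurable (random_coeffs d \<Otimes>\<^sub>M (borel :: (real^'n) measure))"
    by (intro measurable_compose[OF measurable_fst] measurable_random_coeffs_component) auto
  show "(\<lambda>p. monom_grad \<alpha> (snd p)) \<in> borel_measurable (random_coeffs d \<Otimes>\<^sub>M borel)"
    by (intro measurable_compose[OF measurable_snd] borel_measurable_continuous_onI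
      continuous_intros)
qed

lemma measurable_poly_hess_pair:
  "(\<lambda>p. poly_hess d (fst p) (snd p :: real^'n::finite))
    \<in> borel_measurable (random_coeffs d \<Otimes>\<^sub>M borel)"
  unfolding poly_hess_def
proof (intro borel_measurable_sum borel_measurable_scaleR)
  fix \<alpha> :: "'n \<Rightarrow> nat" assume "\<alpha> \<in> multi_indices d"
  then show "(\<lambda>p. fst p \<alpha>) \<in> borel_measurable (random_coeffs d \<Otimes>\<^sub>M (borel :: (real^'n) measure))"
    by (intro measurable_compose[OF measurable_fst] measurable_random_coeffs_component) auto
  show "(\<lambda>p. monom_hess \<alpha> (snd p)) \<in> borel_measurable (random_coeffs d \<Otimes>\<^sub>M borel)"
    by (intro measurable_compose[OF measurable_snd] borel_measurable_continuous_onI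
      continuous_intros)
qed

lemma continuous_on_det: "continuous_on S (det :: real^'n^'n \<Rightarrow> real)"
  unfolding det_def[abs_def] by (intro continuous_intros)

lemma borel_measurable_det [measurable]: "(det :: real^'n^'n \<Rightarrow> real) \<in> borel_measurable borel"
  by (intro borel_measurable_continuous_onI continuous_on_det)

lemma det_scaleR: "det (c *\<^sub>R A) = c ^ CARD('n) * det (A :: real^'n^'n)"
proof -
  have "c *\<^sub>R A = (\<chi> i. c *s A $ i)"
    by (simp add: vec_eq_iff)
  then show ?thesis
    using det_rows_mul[of "\<lambda>_. c" "\<lambda>i. A $ i"] by simp
qed

text \<open>The points counted are the zeros of one nonnegative continuous function, the norm of the
  gradient plus the distance of the Hessian to \<open>S\<close>. The empty \<open>S\<close> is
  treated apart, since \<open>infdist\<close> to it is 0 by convention.\<close>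

lemma measurable_count_critical:
  assumes S: "closed S"
  shows "(\<lambda>f. emeasure (count_space UNIV) {x. poly_grad d f x = 0 \<and> poly_hess d f x \<in> S})
    \<in> borel_measurable (random_coeffs d)"
proof (cases "S = {}")
  case False
  have "(\<lambda>f. emeasure (count_space UNIV) {x \<in> UNIV. poly_grad d f x = 0 \<and> poly_hess d f x \<in> S})
    \<in> borel_measurable (random_coeffs d)"
  proof (rule borel_measurable_count_zeros)
    fix x
    have "(\<lambda>H. infdist H S) \<in> borel_measurable borel"
      by (intro borel_measurable_continuous_onI continuous_intros)
    then show "(\<lambda>f. norm (poly_grad d f x) + infdist (poly_hess d f x) S)
        \<in> borel_measurable (random_coeffs d)"
      by (intro borel_measurable_add
        measurable_compose[OF measurable_poly_grad borel_measurable_norm]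
        measurable_compose[OF measurable_poly_hess]) auto
  next
    fix f
    show "continuous_on UNIV (\<lambda>x. norm (poly_grad d f x) + infdist (poly_hess d f x) S)"
      by (intro continuous_intros continuous_on_poly_grad continuous_on_poly_hess)
  next
    fix f x
    show "0 \<le> norm (poly_grad d f x) + infdist (poly_hess d f x) S"
      by (simp add: infdist_nonneg)
    show "(poly_grad d f x = 0 \<and> poly_hess d f x \<in> S)
        = (norm (poly_grad d f x) + infdist (poly_hess d f x) S = 0)"
      using in_closed_iff_infdist_zero[OF S False, of "poly_hess d f x"]
      by (auto simp: add_nonneg_eq_0_iff infdist_nonneg)
  qed simp
  then show ?thesis by simp
qed simp

lemma nonlinear_grad_derivative:
  assumes "d \<ge> 1"
  shows "(nonlinear_grad d f has_derivative (\<lambda>h. poly_hess d f x *v h)) (at x)"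
proof -
  have "nonlinear_grad d f = (\<lambda>x. poly_grad d f x - (\<chi> i. f (unit_index i)))"
    by (simp add: fun_eq_iff poly_grad_split[OF assms])
  moreover have "((\<lambda>x. poly_grad d f x
      - (\<chi> i. f (unit_index i))) has_derivative (\<lambda>h. poly_hess d f x *v h - 0)) (at x)"
    by (intro has_derivative_diff poly_grad_derivative has_derivative_const)
  ultimately show ?thesis by simp
qed

lemma scaled_nonlinear_grad_derivative:
  assumes "d \<ge> 1"
  shows "((\<lambda>x. c *\<^sub>R nonlinear_grad d f x) has_derivative (\<lambda>h. (c *\<^sub>R poly_hess d f x) *v h))
    (at x)"
  using has_derivative_scaleR_right[OF nonlinear_grad_derivative[OF assms, of f x], of c]
  by (simp add: scaleR_matrix_vector_assoc)

lemma poly_grad_replace_eq_0_iff: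
  assumes "d \<ge> 1"
  shows "poly_grad d (replace_linear d f b) x = 0 \<longleftrightarrow> (- 1 / sqrt (real d)) *\<^sub>R nonlinear_grad d f x
    = b"
proof -
  let ?g = "nonlinear_grad d f x"
  have d: "sqrt (real d) \<noteq> 0" using assms by simp
  have "?g + sqrt (real d) *\<^sub>R b = 0 \<longleftrightarrow> ?g = - (sqrt (real d) *\<^sub>R b)"
    by (simp add: eq_neg_iff_add_eq_0)
  also have "\<dots> \<longleftrightarrow> (- 1 / sqrt (real d)) *\<^sub>R ?g = (- 1 / sqrt (real d)) *\<^sub>R (- (sqrt (real d) *\<^sub>R b))"
    by (simp only: scaleR_cancel_left) (use d in simp)
  also have "(- 1 / sqrt (real d)) *\<^sub>R (- (sqrt (real d) *\<^sub>R b)) = b"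
    using d by simp
  finally show ?thesis
    by (simp only: poly_grad_replace[OF assms])
qed

text \<open>The factor \<open>d\<^bsup>-n/2\<^esup>\<close> turns the standard Gaussian density at \<open>Dg(x) / \<surd>d\<close> into the density of the
  linear coefficients at \<open>Dg(x)\<close>. The Hessian of \<open>f\<close> is that of \<open>g\<close>.\<close>

definition kac_rice_density :: "nat \<Rightarrow> (real^'n^'n) set \<Rightarrow> real^'n::finite \<Rightarrow> ennreal" where
  "kac_rice_density d S x = (\<integral>\<^sup>+ f. ennreal (real d powr (- real CARD('n) / 2)
    * \<bar>det (poly_hess d f x)\<bar> *
     std_gaussian_density (nonlinear_grad d f x /\<^sub>R sqrt (real d))) * indicator S (poly_hess d f x)
       \<partial>random_coeffs d)"

text \<open>With the nonlinear part fixed, the Hessian condition cuts out a closed set of points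
  that does not depend on the linear coefficients, so the area formula can be used over this set;
  Fubini then exchanges the integrals.\<close>

lemma kac_rice:
  fixes S :: "(real^'n::finite^'n) set"
  assumes d: "d \<ge> 1" and S: "closed S"
  shows "(\<integral>\<^sup>+ f. emeasure (count_space UNIV) {x. poly_grad d f x
    = 0 \<and> poly_hess d f x \<in> S} \<partial>random_coeffs d)
    = (\<integral>\<^sup>+ x. kac_rice_density d S x \<partial>lborel)"
proof -
  interpret R: prob_space "random_coeffs d :: (('n \<Rightarrow> nat) \<Rightarrow> real) measure"
    by (rule prob_space_random_coeffs)
  interpret pair_sigma_finite "random_coeffs d :: (('n \<Rightarrow> nat) \<Rightarrow> real) measure" "lborel :: (real^'n)
    measure"
    by (simp add: pair_sigma_finite.intro R.sigma_finite_measure_axioms sigma_finite_lborel)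
  let ?c = "- 1 / sqrt (real d)"
  let ?J = "\<lambda>f x. ennreal (real d powr (- real CARD('n) / 2) * \<bar>det (poly_hess d f x)\<bar> *
     std_gaussian_density (nonlinear_grad d f x /\<^sub>R sqrt (real d))) * indicator S (poly_hess d f x)"
  have [measurable]: "S \<in> sets borel" using S by simp
  have "(\<integral>\<^sup>+ f. emeasure (count_space UNIV) {x. poly_grad d f x
      = 0 \<and> poly_hess d f x \<in> S} \<partial>random_coeffs d)
    = (\<integral>\<^sup>+ f. (\<integral>\<^sup>+ b. emeasure (count_space UNIV)
      {x. poly_grad d (replace_linear d f b) x = 0 \<and> poly_hess d (replace_linear d f b) x \<in> S}
        * ennreal (std_gaussian_density (b :: real^'n)) \<partial>lborel) \<partial>random_coeffs d)"
    by (rule nn_integral_replace_linear[OF d measurable_count_critical[OF S]])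
  also have "\<dots> = (\<integral>\<^sup>+ f. (\<integral>\<^sup>+ x. ?J f x \<partial>lborel) \<partial>random_coeffs d)"
  proof (rule nn_integral_cong)
    fix f :: "('n \<Rightarrow> nat) \<Rightarrow> real"
    let ?A = "{x. poly_hess d f x \<in> S}"
    have "closed (poly_hess d f -` S)"
      by (rule closed_vimage[OF S continuous_on_poly_hess])
    then have A: "closed ?A" by (simp add: vimage_def)
    have "(\<integral>\<^sup>+ b. emeasure (count_space UNIV) {x. poly_grad d (replace_linear d f b) x
        = 0 \<and> poly_hess d (replace_linear d f b) x \<in> S}
        * ennreal (std_gaussian_density (b :: real^'n)) \<partial>lborel)
      = (\<integral>\<^sup>+ b. emeasure (count_space UNIV) {x \<in> ?A. ?c *\<^sub>R nonlinear_grad d f x = b} * ennreal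
        (std_gaussian_density b) \<partial>lborel)"
      unfolding poly_grad_replace_eq_0_iff[OF d] poly_hess_replace[OF d] by (simp add: conj_commute)
    also have "\<dots> = (\<integral>\<^sup>+ x. ennreal (\<bar>det (?c *\<^sub>R poly_hess d f x)\<bar>
        * std_gaussian_density (?c *\<^sub>R nonlinear_grad d f x)) * indicator ?A x \<partial>lborel)"
      by (intro area_formula scaled_nonlinear_grad_derivative[OF d] A
        integrable_std_gaussian_density
          std_gaussian_density_nonneg continuous_intros continuous_on_poly_hess)
    also have "\<dots> = (\<integral>\<^sup>+ x. ?J f x \<partial>lborel)"
    proof (intro nn_integral_cong)
      fix x
      have "\<bar>det (?c *\<^sub>R poly_hess d f x)\<bar>
          = real d powr (- real CARD('n) / 2) * \<bar>det (poly_hess d f x)\<bar>"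
      proof -
        have "\<bar>?c\<bar> ^ CARD('n) = real d powr (- real CARD('n) / 2)"
        proof -
          have "\<bar>?c\<bar> = real d powr (- 1 / 2)"
            using d by (simp add: powr_half_sqrt[symmetric] powr_minus_divide)
          then show ?thesis using d by (simp add: powr_realpow[symmetric] powr_powr)
        qed
        then show ?thesis by (simp only: det_scaleR abs_mult power_abs)
      qed
      moreover have "std_gaussian_density (?c *\<^sub>R nonlinear_grad d f x)
          = std_gaussian_density (nonlinear_grad d f x /\<^sub>R sqrt (real d))"
      proof -
        have "norm (?c *\<^sub>R nonlinear_grad d f x) = norm (nonlinear_grad d f x /\<^sub>R sqrt (real d))"
          by (simp add: inverse_eq_divide)
        then show ?thesis by (simp only: std_gaussian_density_def)
      qed
      ultimately show "ennreal (\<bar>det (?c *\<^sub>R poly_hess d f x)\<bar>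
          * std_gaussian_density (?c *\<^sub>R nonlinear_grad d f x)) * indicator ?A x = ?J f x"
        by (simp add: indicator_def)
    qed
    finally show "(\<integral>\<^sup>+ b. emeasure (count_space UNIV) {x. poly_grad d (replace_linear d f b) x
        = 0 \<and> poly_hess d (replace_linear d f b) x \<in> S}
        * ennreal (std_gaussian_density (b :: real^'n)) \<partial>lborel) = (\<integral>\<^sup>+ x. ?J f x \<partial>lborel)" .
  qed
  also have "\<dots> = (\<integral>\<^sup>+ x. (\<integral>\<^sup>+ f. ?J f x \<partial>random_coeffs d) \<partial>lborel)"
  proof (rule Fubini'[symmetric])
    note [measurable] = measurable_poly_hess_pair measurable_nonlinear_grad_pair
    have "(\<lambda>p. ?J (fst p) (snd p)) \<in> borel_measurable (random_coeffs d \<Otimes>\<^sub>M borel)"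
      by measurable
    then show "(\<lambda>(f, x). ?J f x) \<in> borel_measurable (random_coeffs d \<Otimes>\<^sub>M lborel)"
      by (simp add: split_beta' cong: measurable_cong_sets)
  qed
  finally show ?thesis
    by (simp add: kac_rice_density_def)
qed

text \<open>A degenerate critical point forces the linear coefficients to be a critical value of a
  map determined by the other coefficients; by Sard's theorem this has probability zero for each
  choice of the latter.\<close>

lemma AE_nondegenerate:
  assumes d: "d \<ge> 1"
  shows "AE f in random_coeffs d. \<forall>x :: real^'n::finite. poly_grad d f x = 0
    \<longrightarrow> det (poly_hess d f x) \<noteq> 0"
proof -
  let ?B = "\<lambda>f. \<exists>x\<in>(UNIV :: (real^'n) set). norm (poly_grad d f x) + \<bar>det (poly_hess d f x)\<bar> = 0"
  have [measurable]: "(\<lambda>f. poly_grad d f x) \<in> borel_measurable (random_coeffs d)"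
    "(\<lambda>f. poly_hess d f x) \<in> borel_measurable (random_coeffs d)" for x :: "real^'n"
    by (rule measurable_poly_grad measurable_poly_hess)+
  have B: "{f \<in> space (random_coeffs d). ?B f} \<in> sets (random_coeffs d)"
  proof (rule sets_Ex_zero_sigma_compact)
    show "continuous_on UNIV (\<lambda>x. norm (poly_grad d f x) + \<bar>det (poly_hess d f x)\<bar>)"
        for f :: "('n \<Rightarrow> nat) \<Rightarrow> real"
      by (intro continuous_intros continuous_on_poly_grad
        continuous_on_compose2[OF continuous_on_det continuous_on_poly_hess]) auto
  qed (auto intro: sigma_compact_open)
  have "emeasure (random_coeffs d) {f \<in> space (random_coeffs d). ?B f}
    = (\<integral>\<^sup>+ f. indicator {f \<in> space (random_coeffs d). ?B f} f \<partial>random_coeffs d)"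
    using B by simp
  also have "\<dots> = (\<integral>\<^sup>+ f. (\<integral>\<^sup>+ b. indicator {f
      \<in> space (random_coeffs d). ?B f} (replace_linear d f (b :: real^'n))
       * ennreal (std_gaussian_density b) \<partial>lborel) \<partial>random_coeffs d)"
    by (intro nn_integral_replace_linear[OF d] borel_measurable_indicator B)
  also have "\<dots> = (\<integral>\<^sup>+ f. (\<integral>\<^sup>+ b. 0 \<partial>(lborel :: (real^'n) measure))
      \<partial>(random_coeffs d :: (('n \<Rightarrow> nat) \<Rightarrow> real) measure))"
  proof (rule nn_integral_cong, rule nn_integral_cong_AE)
    fix f :: "('n \<Rightarrow> nat) \<Rightarrow> real"
    have "AE b in lborel. \<forall>x. (- 1 / sqrt (real d)) *\<^sub>R nonlinear_grad d f x = b
        \<longrightarrow> det ((- 1 / sqrt (real d)) *\<^sub>R poly_hess d f x) \<noteq> 0"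
      by (intro Sard scaled_nonlinear_grad_derivative[OF d] continuous_intros
        continuous_on_poly_hess)
    then show "AE b in lborel. indicator {f
        \<in> space (random_coeffs d). ?B f} (replace_linear d f (b :: real^'n))
       * ennreal (std_gaussian_density b) = 0"
    proof eventually_elim
      case (elim b)
      have "\<not> ?B (replace_linear d f b)"
      proof
        assume "?B (replace_linear d f b)"
        then obtain x where "poly_grad d (replace_linear d f b) x
            = 0" "det (poly_hess d (replace_linear d f b) x) = 0"
          by (auto simp: add_nonneg_eq_0_iff)
        then have "(- 1 / sqrt (real d)) *\<^sub>R nonlinear_grad d f x = b" "det (poly_hess d f x) = 0"
          by (simp_all only: poly_grad_replace_eq_0_iff[OF d] poly_hess_replace[OF d])
        then show False
          using elim by (metis det_scaleR mult_zero_right)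
      qed
      then show ?case by simp
    qed
  qed
  finally have "AE f in random_coeffs d. f \<notin> {f \<in> space (random_coeffs d). ?B f}"
    using B by (intro AE_not_in) (auto simp: null_sets_def)
  then show ?thesis
    by (rule AE_mp) (auto intro!: AE_I2 simp: add_nonneg_eq_0_iff)
qed

lemma expected_critical_points_kac_rice:
  assumes "d \<ge> 1"
  shows "expected_critical_points TYPE('n::finite) d
    = (\<integral>\<^sup>+ x. kac_rice_density d (UNIV :: (real^'n^'n) set) x \<partial>lborel)"
  unfolding kac_rice[OF assms closed_UNIV, symmetric] expected_critical_points_def
    critical_point_iff_gradient[OF poly_fun_derivative poly_grad_derivative] by simp

lemma local_minimum_iff:
  assumes "\<forall>x. poly_grad d f x = 0 \<longrightarrow> det (poly_hess d f x) \<noteq> 0"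
  shows "local_minimum (poly_fun d f) x \<longleftrightarrow> poly_grad d f x = 0 \<and> poly_hess d f x \<in> possemidef"
proof
  assume "local_minimum (poly_fun d f) x"
  then show "poly_grad d f x = 0 \<and> poly_hess d f x \<in> possemidef"
    using local_minimum_necessary[OF poly_fun_derivative poly_grad_derivative] by blast
next
  assume x: "poly_grad d f x = 0 \<and> poly_hess d f x \<in> possemidef"
  then have "positive_definite (poly_hess d f x)"
    using assms positive_definite_iff_possemidef[OF transpose_poly_hess] by blast
  then show "local_minimum (poly_fun d f) x"
    using local_minimum_sufficient[OF poly_fun_derivative poly_grad_derivative
      continuous_on_poly_hess] x by blast
qed

lemma expected_local_minima_kac_rice:
  assumes "d \<ge> 1"
  shows "expected_local_minima TYPE('n::finite) d
    = (\<integral>\<^sup>+ x. kac_rice_density d (possemidef :: (real^'n^'n) set) x \<partial>lborel)"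
  unfolding kac_rice[OF assms closed_possemidef, symmetric] expected_local_minima_def
proof (rule nn_integral_cong_AE)
  show "AE f in random_coeffs d. emeasure (count_space UNIV)
      {x :: real^'n. local_minimum (poly_fun d f) x}
    = emeasure (count_space UNIV) {x. poly_grad d f x = 0 \<and> poly_hess d f x \<in> possemidef}"
    using AE_nondegenerate[OF assms] by eventually_elim (simp add: local_minimum_iff)
qed

subsection \<open>Matrices and rank-one perturbations\<close>

definition sympart :: "real^'n^'n \<Rightarrow> real^'n^'n" where
  "sympart A = (1 / 2) *\<^sub>R (A + transpose A)"

lemma transpose_sympart: "transpose (sympart A) = sympart A"
  by (simp add: sympart_def transpose_def vec_eq_iff)

lemma sympart_id: "transpose A = A \<Longrightarrow> sympart A = A"
  by (simp add: sympart_def scaleR_2[symmetric])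

lemma transpose_outer: "transpose (outer u v) = outer v u"
  by (simp add: transpose_def outer_def vec_eq_iff)

lemma transpose_add: "transpose (A + B) = transpose A + transpose (B :: real^'n^'m)"
  by (simp add: transpose_def vec_eq_iff)

lemma inner_transpose: "transpose A \<bullet> transpose B = A \<bullet> (B :: real^'n^'m)"
  unfolding inner_vec_def transpose_def by (simp add: inner_vec_def) (rule sum.swap)

text \<open>Symmetrisation is an orthogonal projection; hence a symmetric \<open>T\<close> takes the
  same value on \<open>Z\<close> and on \<open>sympart Z\<close>.\<close>

lemma inner_sympart: "A \<bullet> sympart B = sympart A \<bullet> B"
  using inner_transpose[of A "transpose B"]
  by (simp add: sympart_def inner_add_left inner_add_right)

lemma inner_matrix_mult_left: "A \<bullet> (B ** C) = (transpose B ** A) \<bullet> (C :: real^'k^'m)"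
proof -
  have "A \<bullet> (B ** C) = (\<Sum>i\<in>UNIV. \<Sum>j\<in>UNIV. \<Sum>k\<in>UNIV. A $ i $ j * (B $ i $ k * C $ k $ j))"
    by (simp add: inner_vec_def matrix_matrix_mult_def sum_distrib_left)
  also have "\<dots> = (\<Sum>i\<in>UNIV. \<Sum>k\<in>UNIV. \<Sum>j\<in>UNIV. A $ i $ j * (B $ i $ k * C $ k $ j))"
    by (intro sum.cong refl sum.swap)
  also have "\<dots> = (\<Sum>k\<in>UNIV. \<Sum>i\<in>UNIV. \<Sum>j\<in>UNIV. A $ i $ j * (B $ i $ k * C $ k $ j))"
    by (rule sum.swap)
  also have "\<dots> = (\<Sum>k\<in>UNIV. \<Sum>j\<in>UNIV. \<Sum>i\<in>UNIV. A $ i $ j * (B $ i $ k * C $ k $ j))"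
    by (intro sum.cong refl sum.swap)
  also have "\<dots> = (transpose B ** A) \<bullet> C"
    by (simp add: inner_vec_def matrix_matrix_mult_def transpose_def sum_distrib_left mult_ac)
  finally show ?thesis .
qed

lemma inner_matrix_mult_right: "A \<bullet> (B ** C) = (A ** transpose C) \<bullet> (B :: real^'k^'m)"
proof -
  have "A \<bullet> (B ** C) = transpose A \<bullet> (transpose C ** transpose B)"
    by (simp add: inner_transpose flip: matrix_transpose_mul)
  also have "\<dots> = (C ** transpose A) \<bullet> transpose B"
    by (subst inner_matrix_mult_left) simp
  also have "\<dots> = transpose (A ** transpose C) \<bullet> transpose B"
    by (simp add: matrix_transpose_mul)
  finally show ?thesis by (simp add: inner_transpose)
qed

lemma inner_congruence:
  assumes "transpose D = (D :: real^'n^'n)"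
  shows "T \<bullet> (D ** M ** D) = (D ** T ** D) \<bullet> M"
  using assms by (simp add: inner_matrix_mult_right[of T] inner_matrix_mult_left[of _ D]
    matrix_mul_assoc)

lemma inner_outer_outer: "outer u v \<bullet> outer a b = (u \<bullet> a) * (v \<bullet> b)"
  unfolding inner_outer by (simp add: outer_mult_vec inner_commute)

text \<open>In an orthonormal basis containing the direction of \<open>x\<close> the perturbation
  changes a single entry of row \<open>k\<close>, and the determinant is linear in that row.
  \<open>Q\<close> and \<open>k\<close> depend on \<open>x\<close> only, so one statement serves all
  \<open>A\<close> and \<open>t\<close>.\<close>

lemma det_rank_one_perturbation:
  fixes x :: "real^'n::finite"
  shows "\<exists>(Q :: real^'n^'n) k. orthogonal_matrix Q \<and>
    (\<forall>A t. det (A + t *\<^sub>R outer x x) = det (transpose Q ** A ** Q)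
      + t * (x \<bullet> x) * det (\<chi> i. if i = k then axis k 1 else (transpose Q ** A ** Q) $ i))"
proof -
  fix k :: 'n
  obtain Q :: "real^'n^'n" and c where Q: "orthogonal_matrix Q" and x: "x = c *\<^sub>R (Q *v axis k 1)"
  proof (cases "x = 0")
    case True
    then show thesis using that[of "mat 1" 0] by (simp add: orthogonal_matrix_id)
  next
    case False
    obtain Q :: "real^'n^'n" where "orthogonal_matrix Q" "Q *v axis k 1 = x /\<^sub>R norm x"
      using orthogonal_matrix_exists_basis[of "x /\<^sub>R norm x" k] False by auto
    then show thesis using that[of Q "norm x"] False by simp
  qed
  have QQ: "transpose Q ** Q = mat 1" "Q ** transpose Q = mat 1"
    using Q by (simp_all add: orthogonal_matrix_def)
  have Qx: "transpose Q *v x = c *\<^sub>R axis k 1"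
    by (simp add: x matrix_vector_mult_scaleR matrix_vector_mul_assoc QQ)
  have xx: "x \<bullet> x = c * c"
  proof -
    have "(Q *v axis k 1) \<bullet> (Q *v axis k 1) = axis k 1 \<bullet> (axis k 1 :: real^'n)"
      by (metis QQ(1) dot_lmul_matrix matrix_vector_mul_assoc matrix_vector_mul_lid
        transpose_matrix_vector)
    then show ?thesis by (simp add: x inner_axis_axis)
  qed
  show ?thesis
  proof (intro exI conjI allI, rule Q)
    fix A :: "real^'n^'n" and t :: real
    let ?C = "transpose Q ** A ** Q"
    have "det (A + t *\<^sub>R outer x x) = det (transpose Q) * det (A + t *\<^sub>R outer x x) * det Q"
    proof -
      have "det (transpose Q) * det Q = 1"
        using QQ(1) by (metis det_I det_mul)
      then show ?thesis by (metis mult.commute mult.assoc mult_1)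
    qed
    also have "\<dots> = det (transpose Q ** (A + t *\<^sub>R outer x x) ** Q)"
      by (simp add: det_mul)
    also have "transpose Q ** (A + t *\<^sub>R outer x x) ** Q
        = ?C + (t * (x \<bullet> x)) *\<^sub>R outer (axis k 1) (axis k 1)"
      unfolding matrix_eq
    proof
      fix h
      have "x \<bullet> (Q *v h) = c * (axis k 1 \<bullet> h)"
        using dot_lmul_matrix[of x Q h] Qx by (simp add: transpose_matrix_vector)
      then show "(transpose Q ** (A + t *\<^sub>R outer x x) ** Q) *v h
          = (?C + (t * (x \<bullet> x)) *\<^sub>R outer (axis k 1) (axis k 1)) *v h"
        by (simp add: matrix_vector_mul_assoc[symmetric] matrix_vector_mult_add_rdistrib xx
          Qx[unfolded transpose_matrix_vector]
            scaleR_matrix_vector_assoc[symmetric] outer_mult_vec matrix_vector_right_distrib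
              matrix_vector_mult_scaleR)
    qed
    also have "\<dots> = (\<chi> i. if i = k then ?C $ k + (t * (x \<bullet> x)) *s axis k 1 else ?C $ i)"
      by (simp add: vec_eq_iff outer_def axis_def)
    also have "det \<dots> = det (\<chi> i. if i = k then ?C $ k else ?C $ i)
        + det (\<chi> i. if i = k then (t * (x \<bullet> x)) *s axis k 1 else ?C $ i)"
      by (rule det_row_add)
    also have "det (\<chi> i. if i = k then (t * (x \<bullet> x)) *s axis k 1 else ?C $ i)
       = (t * (x \<bullet> x)) * det (\<chi> i. if i = k then axis k 1 else ?C $ i)"
      by (rule det_row_mul)
    also have "(\<chi> i. if i = k then ?C $ k else ?C $ i) = ?C"
      by (simp add: vec_eq_iff)
    finally show "det (A + t *\<^sub>R outer x x)
        = det ?C + t * (x \<bullet> x) * det (\<chi> i. if i = k then axis k 1 else ?C $ i)" .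
  qed
qed

lemma det_rank_one_affine:
  fixes x :: "real^'n::finite"
  obtains a b where "\<And>t. det (A + t *\<^sub>R outer x x) = a + b * t"
proof -
  obtain Q k where "orthogonal_matrix (Q :: real^'n^'n)" "\<And>A t. det (A + t *\<^sub>R outer x x)
      = det (transpose Q ** A ** Q)
      + t * (x \<bullet> x) * det (\<chi> i. if i = k then axis k 1 else (transpose Q ** A ** Q) $ i)"
    using det_rank_one_perturbation[of x] by blast
  then show thesis
    by (intro that[of "det (transpose Q ** A ** Q)" "(x \<bullet> x) * det (\<chi> i. if i
      = k then axis k 1 else (transpose Q ** A ** Q) $ i)"])
      (simp add: mult_ac)
qed

lemma det_id_rank_one: "det (mat 1 + t *\<^sub>R outer x x) = 1 + t * (x \<bullet> (x :: real^'n::finite))"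
proof -
  obtain Q k where Q: "orthogonal_matrix (Q :: real^'n^'n)" and
    eq: "\<And>A t. det (A + t *\<^sub>R outer x x) = det (transpose Q ** A ** Q)
      + t * (x \<bullet> x) * det (\<chi> i. if i = k then axis k 1 else (transpose Q ** A ** Q) $ i)"
    using det_rank_one_perturbation[of x] by blast
  have 1: "transpose Q ** mat 1 ** Q = mat 1"
    using Q by (simp add: orthogonal_matrix_def)
  have 2: "(\<chi> i. if i = k then axis k 1 else mat 1 $ i) = (mat 1 :: real^'n^'n)"
    by (auto simp: vec_eq_iff mat_def axis_def)
  show ?thesis
    unfolding eq 1 2 by simp
qed

lemma id_rank_one_mult_vec: "(mat 1 + c *\<^sub>R outer x x) *v h = h + (c * (x \<bullet> h)) *\<^sub>R x"
  by (simp add: matrix_vector_mult_add_rdistrib scaleR_matrix_vector_assoc[symmetric]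
    outer_mult_vec)

lemma transpose_id_rank_one: "transpose (mat 1 + c *\<^sub>R outer x x) = mat 1 + c *\<^sub>R outer x x"
  by (simp add: vec_eq_iff transpose_def outer_def mat_def mult_ac)

text \<open>Since \<open>D ** D = mat 1 + e *\<^sub>R outer x x\<close>, the first formula expands
  the trace of \<open>T D\<^sup>2 T D\<^sup>2\<close>; \<open>x\<close> is an eigenvector of
  \<open>D\<close> with eigenvalue \<open>1 + c * (x \<bullet> x)\<close>, which gives the
  second.\<close>

lemma congruence_rank_one:
  fixes x :: "real^'n::finite" and c :: real
  assumes T: "transpose T = T"
  defines "D \<equiv> mat 1 + c *\<^sub>R outer x x" and "e \<equiv> 2 * c + c\<^sup>2 * (x \<bullet> x)"
  shows "(D ** T ** D) \<bullet> (D ** T ** D)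
    = T \<bullet> T + 2 * e * ((T *v x) \<bullet> (T *v x)) + e\<^sup>2 * (x \<bullet> (T *v x))\<^sup>2"
    and "(D ** T ** D) \<bullet> outer x x = (1 + c * (x \<bullet> x))\<^sup>2 * (x \<bullet> (T *v x))"
proof -
  have eq: "D ** T ** D = T + c *\<^sub>R outer x (T *v x) + c *\<^sub>R outer (T *v x) x
      + (c\<^sup>2 * (x \<bullet> (T *v x))) *\<^sub>R outer x x"
    unfolding matrix_eq
  proof
    fix h
    have "x \<bullet> (T *v h) = (T *v x) \<bullet> h" by (rule symmetric_inner[OF T, symmetric])
    then show "(D ** T ** D) *v h
        = (T + c *\<^sub>R outer x (T *v x) + c *\<^sub>R outer (T *v x) x + (c\<^sup>2 * (x \<bullet> (T *v x))) *\<^sub>R outer x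
          x) *v h"
      by (simp add: matrix_vector_mul_assoc[symmetric] D_def id_rank_one_mult_vec
        matrix_vector_mult_add_rdistrib
          scaleR_matrix_vector_assoc[symmetric] outer_mult_vec matrix_vector_right_distrib
            matrix_vector_mult_scaleR
          inner_add_right algebra_simps power2_eq_square)
  qed
  have 1: "outer u v \<bullet> T = u \<bullet> (T *v v)" for u v
    by (simp add: inner_outer inner_commute[of _ T])
  have 2: "(T *v x) \<bullet> (T *v x) = x \<bullet> (T *v (T *v x))" "x \<bullet> (T *v x) = (T *v x) \<bullet> x"
    by (rule symmetric_inner[OF T]) (rule inner_commute)
  show "(D ** T ** D) \<bullet> (D ** T ** D)
      = T \<bullet> T + 2 * e * ((T *v x) \<bullet> (T *v x)) + e\<^sup>2 * (x \<bullet> (T *v x))\<^sup>2"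
    unfolding eq
    by (simp add: inner_add_left inner_add_right inner_outer_outer 1 inner_outer 2 e_def
        outer_mult_vec scaleR_matrix_vector_assoc[symmetric] power2_eq_square algebra_simps)
  show "(D ** T ** D) \<bullet> outer x x = (1 + c * (x \<bullet> x))\<^sup>2 * (x \<bullet> (T *v x))"
    unfolding eq
    by (simp add: inner_add_left inner_outer_outer inner_outer 2
        outer_mult_vec scaleR_matrix_vector_assoc[symmetric] power2_eq_square algebra_simps)
qed

text \<open>Completes the square in \<open>z\<close> inside the variance of
  \<open>functional_variance\<close>: the shift by \<open>a T x + b x\<close> absorbs all terms that
  mix \<open>z\<close> and \<open>T\<close>. What remains, free of \<open>z\<close>, is up to a
  factor the covariance form of the Hessian conditioned on the gradient. The variables stand for
  \<open>zz = z \<bullet> z\<close>, \<open>zx = z \<bullet> x\<close>,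
  \<open>zTx = z \<bullet> T x\<close>, \<open>\<tau> = x \<bullet> T x\<close>,
  \<open>w = T x \<bullet> T x\<close>, \<open>tt = T \<bullet> T\<close> and
  \<open>p = x \<bullet> x\<close>.\<close>

lemma completed_square_algebra:
  fixes p zz zx zTx \<tau> w tt d q :: real
  assumes p: "p \<ge> 0" and d: "d \<ge> 1"
  defines "r \<equiv> 1 + p" and "m \<equiv> 1 + d * p"
  defines "a \<equiv> 2 * (d - 1) / r" and "b \<equiv> - d * (d - 1) * \<tau> / (r * m)"
  shows "r ^ 3 * zz + (d - 1) * r\<^sup>2 * zx\<^sup>2 + 4 * (d - 1) * r\<^sup>2 * zTx + 2 * (d - 1) * (d - 2) * r * \<tau>
    * zx
      + 2 * (d - 1) * r\<^sup>2 * tt + 4 * (d - 1) * (d - 2) * r * w + (d - 1) * (d - 2) * (d - 3) * \<tau>\<^sup>2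
    = r\<^sup>2 * (r * (zz + 2 * (a * zTx + b * zx) + (a\<^sup>2 * w + 2 * a * b * \<tau> + b\<^sup>2 * p))
        + (d - 1) * (zx + a * \<tau> + b * p)\<^sup>2)
      + 2 * (d - 1) * r\<^sup>2 * (tt - 2 * w / r + (1 + d * (d - 1) / (2 * m)) * \<tau>\<^sup>2 / r\<^sup>2)"
proof -
  have r: "r > 0" and m: "m > 0" using p d by (auto simp: r_def m_def intro: add_pos_nonneg)
  have a: "a * r = 2 * (d - 1)" using r by (simp add: a_def)
  have b: "b * r * m = - d * (d - 1) * \<tau>" using r m by (simp add: b_def)
  define u where "u = 1 / m"
  have u: "u * m = 1" using m by (simp add: u_def)
  have rm: "r + (d - 1) * p = m" by (simp add: r_def m_def algebra_simps)
  have b': "b * r = - d * (d - 1) * \<tau> * u" using r by (simp add: b_def u_def)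
  have "2 * (d - 1) * r\<^sup>2 * (tt - 2 * w / r + (1 + d * (d - 1) / (2 * m)) * \<tau>\<^sup>2 / r\<^sup>2)
    = 2 * (d - 1) * (r\<^sup>2 * tt - 2 * w * r + (1 + d * (d - 1) * u / 2) * \<tau>\<^sup>2)"
    using r by (simp add: u_def power2_eq_square field_simps)
  then show ?thesis
    using a b' u rm r_def by algebra
qed

subsection \<open>The law of the Hessian at a critical point\<close>

lemma continuous_on_matrix_affine: "continuous_on S (\<lambda>z. (B :: real^'n^'m) *v (z + a))"
  unfolding matrix_vector_right_distrib by (intro continuous_intros)

text \<open>An affine bijection has exactly one preimage everywhere, so the area formula reduces to
  the substitution rule.\<close>

lemma nn_integral_std_gaussian_affine:
  fixes B :: "real^'n::finite^'n"
  assumes B: "det B \<noteq> 0"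
  shows "(\<integral>\<^sup>+ z. ennreal (std_gaussian_density (B *v (z + a))) \<partial>lborel) = ennreal (1 / \<bar>det B\<bar>)"
proof -
  interpret G: prob_space "std_gaussian :: (real^'n) measure" by (rule prob_space_std_gaussian)
  obtain B' where B': "B ** B' = mat 1" "B' ** B = mat 1"
    using B invertible_det_nz[of B] by (auto simp: invertible_def)
  have one: "emeasure (count_space UNIV) {z \<in> UNIV. B *v (z + a) = b} = 1" for b
  proof -
    have "B *v (z + a) = b \<longleftrightarrow> z = B' *v b - a" for z
    proof
      assume "B *v (z + a) = b"
      then have "B' *v b = z + a" using B'(2)
          by (metis matrix_vector_mul_assoc matrix_vector_mul_lid)
      then show "z = B' *v b - a" by simp
    next
      assume "z = B' *v b - a"
      then show "B *v (z + a) = b" using B'(1) by (simp add: matrix_vector_mul_assoc)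
    qed
    then have "{z \<in> UNIV. B *v (z + a) = b} = {B' *v b - a}" by auto
    then show ?thesis by simp
  qed
  have der: "((\<lambda>z. B *v (z + a)) has_derivative (\<lambda>h. B *v h)) (at z)" for z
  proof -
    have "((\<lambda>z. B *v z + B *v a) has_derivative (\<lambda>h. B *v h + 0)) (at z)"
      by (intro has_derivative_add has_derivative_const bounded_linear_imp_has_derivative
        matrix_vector_mul_bounded_linear)
    then show ?thesis by (simp add: matrix_vector_right_distrib)
  qed
  have "1 = (\<integral>\<^sup>+ b. ennreal (std_gaussian_density (b :: real^'n)) \<partial>lborel)"
    using G.emeasure_space_1 by (simp add: std_gaussian_def emeasure_density)
  also have "\<dots> = (\<integral>\<^sup>+ b. emeasure (count_space UNIV) {z \<in> UNIV. B *v (z + a)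
      = b} * ennreal (std_gaussian_density b) \<partial>lborel)"
    unfolding one by simp
  also have "\<dots> = (\<integral>\<^sup>+ z. ennreal (\<bar>det B\<bar> * std_gaussian_density (B *v (z + a))) * indicator UNIV z
      \<partial>lborel)"
    by (intro area_formula der integrable_std_gaussian_density std_gaussian_density_nonneg
      continuous_on_const closed_UNIV)
  also have "\<dots> = ennreal \<bar>det B\<bar> * (\<integral>\<^sup>+ z. ennreal (std_gaussian_density (B *v (z + a))) \<partial>lborel)"
  proof -
    have [measurable]: "(\<lambda>z. B *v (z + a)) \<in> borel_measurable borel"
      by (intro borel_measurable_continuous_onI continuous_on_matrix_affine)
    show ?thesis
      by (simp add: ennreal_mult std_gaussian_density_nonneg nn_integral_cmult)
  qed
  finally have eq: "1 = ennreal \<bar>det B\<bar>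
      * (\<integral>\<^sup>+ z. ennreal (std_gaussian_density (B *v (z + a))) \<partial>lborel)" .
  have "(\<integral>\<^sup>+ z. ennreal (std_gaussian_density (B *v (z + a))) \<partial>lborel)
    = ennreal (1 / \<bar>det B\<bar>) * (ennreal \<bar>det B\<bar> *
      (\<integral>\<^sup>+ z. ennreal (std_gaussian_density (B *v (z + a))) \<partial>lborel))"
    using B by (simp add: mult.assoc[symmetric] flip: ennreal_mult')
  then show ?thesis
    unfolding eq[symmetric] by simp
qed

lemma cis_random_coeffs:
  "(\<integral>f. cis (\<Sum>\<alpha>\<in>multi_indices d - J. c \<alpha> * f \<alpha>) \<partial>random_coeffs d)
    = of_real (exp (- (\<Sum>\<alpha>\<in>multi_indices d - J. multinomial d \<alpha> * (c \<alpha>)\<^sup>2) / 2))"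
proof -
  let ?c = "\<lambda>\<alpha>. if \<alpha> \<in> J then 0 else c \<alpha>"
  have eq: "(\<Sum>\<alpha>\<in>multi_indices d - J. g \<alpha>) = (\<Sum>\<alpha>\<in>multi_indices d. if \<alpha> \<in> J then 0 else g \<alpha>)"
      for g :: "_ \<Rightarrow> real"
    by (intro sum.mono_neutral_cong_left) auto
  have "(\<integral>f. cis (\<Sum>\<alpha>\<in>multi_indices d. ?c \<alpha> * f \<alpha>) \<partial>random_coeffs d)
    = of_real (exp (- (\<Sum>\<alpha>\<in>multi_indices d. (sqrt (multinomial d \<alpha>))\<^sup>2 * (?c \<alpha>)\<^sup>2) / 2))"
    unfolding random_coeffs_def by (rule cis_PiM_normal) (auto simp: multinomial_pos)
  then show ?thesis
    unfolding eq by (simp add: multinomial_pos less_imp_le if_distrib[of "\<lambda>c. c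
      * _"] if_distrib[of "\<lambda>c. c\<^sup>2"]
        if_distrib[of "\<lambda>c. _ * c"] cong: if_cong)
qed

text \<open>Up to normalisation, the law of the Hessian conditioned on \<open>x\<close> being
  critical; the Gaussian weight replaces conditioning on a null event.\<close>

definition hessian_measure :: "nat \<Rightarrow> real^'n::finite \<Rightarrow> (real^'n^'n) measure" where
  "hessian_measure d x = distr (density (random_coeffs d)
     (\<lambda>f. ennreal (real d powr (- real CARD('n) / 2) * std_gaussian_density
       (nonlinear_grad d f x /\<^sub>R sqrt (real d)))))
     borel (\<lambda>f. poly_hess d f x)"

lemma measurable_nonlinear_grad: "(\<lambda>f. nonlinear_grad d f x) \<in> borel_measurable (random_coeffs d)"
  unfolding nonlinear_grad_def
  by (intro borel_measurable_sum borel_measurable_scaleR measurable_random_coeffs_component) auto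

lemma kac_rice_density_eq:
  assumes [measurable]: "S \<in> sets borel"
  shows "kac_rice_density d S (x :: real^'n::finite)
    = (\<integral>\<^sup>+ H. ennreal \<bar>det H\<bar> * indicator S H \<partial>hessian_measure d x)"
proof -
  note [measurable] = measurable_nonlinear_grad measurable_poly_hess
  let ?k = "real d powr (- real CARD('n) / 2)"
  have eq: "ennreal (?k * \<bar>det (poly_hess d f x)\<bar> * g)
      = ennreal (?k * g) * ennreal \<bar>det (poly_hess d f x)\<bar>" if "g \<ge> 0" for f g
    using that by (subst ennreal_mult[symmetric]) (auto simp: mult_ac)
  have "(\<integral>\<^sup>+ H. ennreal \<bar>det H\<bar> * indicator S H \<partial>hessian_measure d x)
    = (\<integral>\<^sup>+ f. ennreal \<bar>det (poly_hess d f x)\<bar> * indicator S (poly_hess d f x) \<partial>density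
      (random_coeffs d)
     (\<lambda>f. ennreal (?k * std_gaussian_density (nonlinear_grad d f x /\<^sub>R sqrt (real d)))))"
    unfolding hessian_measure_def by (rule nn_integral_distr) auto
  also have "\<dots> = (\<integral>\<^sup>+ f. ennreal (?k
      * std_gaussian_density (nonlinear_grad d f x /\<^sub>R sqrt (real d)))
      * (ennreal \<bar>det (poly_hess d f x)\<bar> * indicator S (poly_hess d f x)) \<partial>random_coeffs d)"
    by (rule nn_integral_density) auto
  finally show ?thesis
    unfolding kac_rice_density_def eq[OF std_gaussian_density_nonneg] by (simp only: mult.assoc)
qed

lemma std_gaussian_density_bound: "std_gaussian_density (y :: 'a::euclidean_space) \<le> 1"
proof -
  have "(2 * pi) powr (- real DIM('a) / 2) \<le> 1"
    using powr_mono[of "- real DIM('a) / 2" 0 "2 * pi"] pi_gt3 by simp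
  then show ?thesis
    unfolding std_gaussian_density_def by (intro mult_le_one) auto
qed

lemma finite_hessian_measure: "finite_measure (hessian_measure d (x :: real^'n::finite))"
proof -
  note [measurable] = measurable_nonlinear_grad measurable_poly_hess
  interpret R: prob_space "random_coeffs d :: (('n \<Rightarrow> nat) \<Rightarrow> real) measure"
    by (rule prob_space_random_coeffs)
  have "(\<integral>\<^sup>+ f. ennreal (real d powr (- real CARD('n) / 2)
      * std_gaussian_density (nonlinear_grad d f x /\<^sub>R sqrt (real d))) \<partial>random_coeffs d)
     \<le> (\<integral>\<^sup>+ f. ennreal (real d powr (- real CARD('n) / 2))
       \<partial>(random_coeffs d :: (('n \<Rightarrow> nat) \<Rightarrow> real) measure))"
    by (intro nn_integral_mono ennreal_leI mult_left_le std_gaussian_density_bound) auto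
  also have "\<dots> < \<infinity>"
    using R.emeasure_space_1 by simp
  finally have "finite_measure (density (random_coeffs d)
     (\<lambda>f. ennreal (real d powr (- real CARD('n) / 2) * std_gaussian_density
       (nonlinear_grad d f x /\<^sub>R sqrt (real d)))))"
    by (intro finite_measureI) (simp add: emeasure_density cong: nn_integral_cong)
  then show ?thesis
    unfolding hessian_measure_def by (rule finite_measure.finite_measure_distr) measurable
qed

text \<open>The Gaussian weight is, up to a constant, the characteristic function of a further
  standard Gaussian \<open>z\<close> at \<open>Dg(x) / sqrt d\<close>. After Fubini the integral
  over the coefficients is a Gaussian characteristic function with exponent from
  \<open>functional_variance\<close>. Completing the square leaves a Gaussian integral over
  \<open>z\<close>, worth \<open>1 / |det B|\<close>, times the factor containing
  \<open>T\<close>.\<close>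

lemma cis_hessian_measure:
  fixes x :: "real^'n::finite" and T :: "real^'n^'n"
  assumes d: "d \<ge> 2" and T: "transpose T = T"
  defines "r \<equiv> 1 + x \<bullet> x" and "m \<equiv> 1 + real d * (x \<bullet> x)" and "\<tau> \<equiv> x \<bullet> (T *v x)"
  shows "(\<integral>H. cis (T \<bullet> H) \<partial>hessian_measure d x)
    = of_real ((2 * pi * real d) powr (- real CARD('n) / 2) *
      ((r ^ (d - 1)) powr (- real CARD('n) / 2) * sqrt (r / m)) *
       exp (- (2 * real d * real (d - 1) * r ^ (d - 2) *
         (T \<bullet> T - 2 * ((T *v x) \<bullet> (T *v x)) / r + (1 + real d * real (d - 1) / (2 * m)) * \<tau>\<^sup>2 /
           r\<^sup>2)) / 2))"
proof -
  note [measurable] = measurable_nonlinear_grad measurable_poly_hess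
  interpret R: prob_space "random_coeffs d :: (('n \<Rightarrow> nat) \<Rightarrow> real) measure"
    by (rule prob_space_random_coeffs)
  interpret G: prob_space "std_gaussian :: (real^'n) measure" by (rule prob_space_std_gaussian)
  interpret RG: pair_sigma_finite "random_coeffs d :: (('n \<Rightarrow> nat) \<Rightarrow> real) measure" "std_gaussian ::
    (real^'n) measure"
    by (simp add: pair_sigma_finite.intro R.sigma_finite_measure_axioms
      G.sigma_finite_measure_axioms)
  interpret RG: finite_measure "(random_coeffs d :: (('n \<Rightarrow> nat) \<Rightarrow> real) measure) \<Otimes>\<^sub>M
    (std_gaussian :: (real^'n) measure)"
    by (intro finite_measure_pair_measure R.finite_measure_axioms G.finite_measure_axioms)
  have d1: "d \<ge> 1" "real d > 0" using d by simp_all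
  let ?q = "r ^ (d - 2)" and ?p = "x \<bullet> x"
  have r: "r \<ge> 1" "r > 0" and m: "m > 0"
    using d1 by (auto simp: r_def m_def intro!: add_pos_nonneg)
  let ?K = "T \<bullet> T - 2 * ((T *v x) \<bullet> (T *v x)) / r + (1 + real d * (real d - 1) / (2 * m)) * \<tau>\<^sup>2
      / r\<^sup>2"
  have p0: "0 \<le> ?p" and d1': "1 \<le> real d" using d1 by simp_all
  let ?res = "2 * real d * real (d - 1) * ?q *
         (T \<bullet> T - 2 * ((T *v x) \<bullet> (T *v x)) / r + (1 + real d * real (d - 1) / (2 * m)) * \<tau>\<^sup>2 /
           r\<^sup>2)"
  let ?k = "real d powr (- real CARD('n) / 2)" and ?k2 = "(2 * pi) powr (- real CARD('n) / 2)"
  let ?g = "\<lambda>f. nonlinear_grad d f x /\<^sub>R sqrt (real d)"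

  \<comment> \<open>Chosen so that the square of \<open>mat 1 + \<gamma> *\<^sub>R outer x x\<close>
    is \<open>mat 1 + ((d - 1) / r) *\<^sub>R outer x x\<close>; then \<open>B\<close> is a square
    root of the covariance of \<open>Df(x) / sqrt d\<close>. The denominator with
    \<open>sqrt m + sqrt r\<close> keeps the formula valid at \<open>x = 0\<close>, where solving
    directly would divide by \<open>x \<bullet> x\<close>.\<close>
  define \<gamma> where "\<gamma> = (real d - 1) / (sqrt r * (sqrt m + sqrt r))"
  define B where "B = (sqrt (?q * r)) *\<^sub>R (mat 1 + \<gamma> *\<^sub>R outer x x)"
  have mr: "m - r = (real d - 1) * ?p" by (simp add: m_def r_def algebra_simps)
  have sr: "sqrt r * sqrt r = r" "sqrt m * sqrt m = m" "sqrt r > 0" "sqrt m > 0" using r m by auto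
  have g1: "1 + \<gamma> * ?p = sqrt m / sqrt r"
  proof -
    have "\<gamma> * ?p = (m - r) / (sqrt r * (sqrt m + sqrt r))" unfolding mr by (simp add: \<gamma>_def)
    also have "m - r = (sqrt m - sqrt r) * (sqrt m + sqrt r)" using sr by (simp add: algebra_simps)
    also have "\<dots> / (sqrt r * (sqrt m + sqrt r)) = (sqrt m - sqrt r) / sqrt r"
      using sr by (simp add: add_pos_pos less_imp_neq[symmetric])
    also have "\<dots> = sqrt m / sqrt r - 1" using sr by (simp add: diff_divide_distrib)
    finally show ?thesis by simp
  qed
  have g2: "r * (2 * \<gamma> + \<gamma>\<^sup>2 * ?p) = real d - 1"
  proof -
    have "2 * \<gamma> + \<gamma>\<^sup>2 * ?p = \<gamma> * (1 + (1 + \<gamma> * ?p))" by (simp add: power2_eq_square algebra_simps)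
    also have "\<dots> = \<gamma> * ((sqrt r + sqrt m) / sqrt r)" unfolding g1 using sr
        by (simp add: add_divide_distrib)
    also have "\<dots> = (real d - 1) / (sqrt r * sqrt r)"
      using sr by (simp add: \<gamma>_def add.commute add_pos_pos less_imp_neq[symmetric])
    finally show ?thesis using r sr by simp
  qed
  have detB: "\<bar>det B\<bar> = (r ^ (d - 1)) powr (real CARD('n) / 2) * sqrt (m / r)"
  proof -
    have "?q * r = r ^ (d - 1)" using d by (auto dest!: le_Suc_ex simp: mult.commute)
    then have "(sqrt (?q * r)) ^ CARD('n) = (r ^ (d - 1)) powr (real CARD('n) / 2)"
      using r by (simp add: powr_half_sqrt[symmetric] powr_realpow[symmetric] powr_powr)
    then show ?thesis
      using sr r by (simp add: B_def det_scaleR det_id_rank_one g1 abs_mult real_sqrt_divide)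
  qed
  then have detB0: "det B \<noteq> 0" using r m by auto
  have normB: "(norm (B *v y))\<^sup>2 = ?q * (r * (y \<bullet> y) + (real d - 1) * (y \<bullet> x)\<^sup>2)" for y
  proof -
    have "(norm (B *v y))\<^sup>2 = (?q * r) * ((y + (\<gamma> * (x \<bullet> y)) *\<^sub>R x) \<bullet> (y + (\<gamma> * (x \<bullet> y)) *\<^sub>R x))"
      using r by (simp add: B_def scaleR_matrix_vector_assoc[symmetric] id_rank_one_mult_vec
        power_mult_distrib dot_square_norm
          del: inner_add_left inner_add_right)
    also have "\<dots> = ?q * (r * (y \<bullet> y) + (r * (2 * \<gamma> + \<gamma>\<^sup>2 * ?p)) * (y \<bullet> x)\<^sup>2)"
      by (simp add: inner_add_left inner_add_right inner_commute[of x y] power2_eq_square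
        algebra_simps)
    finally show ?thesis unfolding g2 .
  qed
  define a b where "a = 2 * (real d - 1) / r" and "b = - real d * (real d - 1) * \<tau> / (r * m)"
  define z1 where "z1 = sqrt (real d) *\<^sub>R (a *\<^sub>R (T *v x) + b *\<^sub>R x)"
  let ?V = "\<lambda>w. \<Sum>\<alpha>\<in>multi_indices d. multinomial d \<alpha> * (w \<bullet> monom_grad \<alpha> x + T \<bullet> monom_hess \<alpha> x)\<^sup>2"
  have V: "?V (z /\<^sub>R sqrt (real d)) = (norm (B *v (z + z1)))\<^sup>2 + ?res" for z
  proof -
    define w where "w = z /\<^sub>R sqrt (real d)"
    have zw: "z = sqrt (real d) *\<^sub>R w" using d1 by (simp add: w_def)
    define u where "u = w + a *\<^sub>R (T *v x) + b *\<^sub>R x"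
    have zu: "z + z1 = sqrt (real d) *\<^sub>R u" by (simp add: zw z1_def u_def scaleR_add_right)
    have uu: "u \<bullet> u = w \<bullet> w + 2 * (a * (w \<bullet> (T *v x)) + b * (w \<bullet> x))
        + (a\<^sup>2 * ((T *v x) \<bullet> (T *v x)) + 2 * a * b * \<tau> + b\<^sup>2 * ?p)"
      by (simp add: u_def inner_add_left inner_add_right \<tau>_def inner_commute[of "T *v x" w]
        inner_commute[of x w] inner_commute[of "T *v x" x] power2_eq_square algebra_simps)
    have ux: "u \<bullet> x = w \<bullet> x + a * \<tau> + b * ?p"
      by (simp add: u_def inner_add_left \<tau>_def inner_commute[of "T *v x" x])
    have "r\<^sup>2 * ?V w = real d * ?q * (r ^ 3 * (w \<bullet> w) + (real d - 1) * r\<^sup>2 * (w \<bullet> x)\<^sup>2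
      + 4 * (real d - 1) * r\<^sup>2 * (w \<bullet> (T *v x)) + 2 * (real d - 1) * (real d - 2) * r * \<tau> * (w \<bullet> x)
      + 2 * (real d - 1) * r\<^sup>2 * (T \<bullet> T) + 4 * (real d - 1) * (real d - 2) * r *
        ((T *v x) \<bullet> (T *v x))
      + (real d - 1) * (real d - 2) * (real d - 3) * \<tau>\<^sup>2)"
      using functional_variance[OF T d, of x w] d1 by (simp add: r_def \<tau>_def of_nat_diff)
    also have "\<dots> = r\<^sup>2 * ((norm (B *v (z + z1)))\<^sup>2 + ?res)"
    proof -
      have N: "(norm (B *v (z + z1)))\<^sup>2 = real d * (?q * (r * (u \<bullet> u) + (real d - 1) * (u \<bullet> x)\<^sup>2))"
        unfolding zu matrix_vector_mult_scaleR by (simp add: power_mult_distrib normB)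
      have E: "r ^ 3 * (w \<bullet> w) + (real d - 1) * r\<^sup>2 * (w \<bullet> x)\<^sup>2
        + 4 * (real d - 1) * r\<^sup>2 * (w \<bullet> (T *v x)) + 2 * (real d - 1) * (real d - 2) * r * \<tau> *
          (w \<bullet> x)
        + 2 * (real d - 1) * r\<^sup>2 * (T \<bullet> T) + 4 * (real d - 1) * (real d - 2) * r *
          ((T *v x) \<bullet> (T *v x))
        + (real d - 1) * (real d - 2) * (real d - 3) * \<tau>\<^sup>2
        = r\<^sup>2 * (r * (u \<bullet> u) + (real d - 1) * (u \<bullet> x)\<^sup>2) + 2 * (real d - 1) * r\<^sup>2 * ?K"
        using completed_square_algebra[OF p0 d1', of "w \<bullet> w" "w \<bullet> x" "w \<bullet> (T *v x)" \<tau> "T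
          \<bullet> T" "(T *v x) \<bullet> (T *v x)"]
        unfolding uu ux r_def[symmetric] m_def[symmetric] a_def[symmetric] b_def[symmetric] .
      have R: "real (d - 1) = real d - 1" using d1 by (simp add: of_nat_diff)
      have ring: "D * q * (r\<^sup>2 * X + 2 * (D - 1) * r\<^sup>2 * K)
          = r\<^sup>2 * (D * (q * X) + 2 * D * (D - 1) * q * K)"
        for D q X K :: real by (simp add: algebra_simps)
      show ?thesis unfolding R E N by (rule ring)
    qed
    finally show ?thesis using r by (simp add: w_def)
  qed

  have inner_cf: "(\<integral>f. cis (T \<bullet> poly_hess d f x + z \<bullet> ?g f) \<partial>random_coeffs d)
     = of_real (exp (- (?V (z /\<^sub>R sqrt (real d)) - z \<bullet> z) / 2))" for z
  proof -
    let ?w = "z /\<^sub>R sqrt (real d)"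
    let ?c = "\<lambda>\<alpha>. ?w \<bullet> monom_grad \<alpha> x + T \<bullet> monom_hess \<alpha> x"
    have lin: "T \<bullet> poly_hess d f x + z \<bullet> ?g f = (\<Sum>\<alpha>\<in>multi_indices d - range unit_index. ?c \<alpha> * f \<alpha>)"
        for f
    proof -
      have 1: "T \<bullet> poly_hess d f x
          = (\<Sum>\<alpha>\<in>multi_indices d - range unit_index. f \<alpha> * (T \<bullet> monom_hess \<alpha> x))"
        unfolding poly_hess_split[OF d1(1)] by (simp add: inner_sum_right)
      have 2: "z \<bullet> ?g f = (\<Sum>\<alpha>\<in>multi_indices d - range unit_index. f \<alpha> * (?w \<bullet> monom_grad \<alpha> x))"
        unfolding nonlinear_grad_def
          by (simp add: inner_sum_right sum_distrib_left mult.left_commute)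
      show ?thesis
        unfolding 1 2 sum.distrib[symmetric] by (intro sum.cong refl) (simp only: algebra_simps)
    qed
    \<comment> \<open>The linear coefficients, absent from \<open>g\<close>, would contribute
      \<open>z \<bullet> z\<close> to the variance. This surplus later cancels the density of
      \<open>z\<close>, so that only the norm of \<open>B *v (z + z1)\<close> enters the Gaussian
      integral.\<close>
    have "(\<Sum>\<alpha>\<in>range unit_index. multinomial d \<alpha> * (?c \<alpha>)\<^sup>2) = (\<Sum>i\<in>UNIV. real d * (?w $ i)\<^sup>2)"
      using d1 by (simp add: sum.reindex[OF inj_unit_index] monom_grad_unit_index
        monom_hess_unit_index multinomial_unit_index inner_axis)
    also have "\<dots> = z \<bullet> z"
      using d1 by (simp add: inner_vec_def power2_eq_square field_simps)
    finally have "?V ?w - z \<bullet> z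
        = (\<Sum>\<alpha>\<in>multi_indices d - range unit_index. multinomial d \<alpha> * (?c \<alpha>)\<^sup>2)"
      by (subst sum.subset_diff[OF unit_index_in[OF d1(1)]]) auto
    then show ?thesis
      unfolding lin by (simp only: cis_random_coeffs)
  qed

  have "(\<integral>H. cis (T \<bullet> H) \<partial>hessian_measure d x)
    = (\<integral>f. (?k * std_gaussian_density (?g f)) *\<^sub>R cis (T \<bullet> poly_hess d f x) \<partial>random_coeffs d)"
    unfolding hessian_measure_def
    by (subst integral_distr, simp, simp, subst integral_density)
      (auto simp: std_gaussian_density_nonneg)
  also have "\<dots> = (\<integral>f. (\<integral>z. of_real (?k * ?k2) * cis (T \<bullet> poly_hess d f x + z \<bullet> ?g f) \<partial>std_gaussian)
      \<partial>random_coeffs d)"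
  proof (intro Bochner_Integration.integral_cong refl)
    fix f
    have "(\<integral>z. of_real (?k * ?k2) * cis (T \<bullet> poly_hess d f x + z \<bullet> ?g f) \<partial>std_gaussian)
      = (\<integral>z. (of_real (?k * ?k2) * cis (T \<bullet> poly_hess d f x)) * cis (?g f \<bullet> z) \<partial>std_gaussian)"
      by (simp add: cis_mult[symmetric] inner_commute mult_ac)
    also have "\<dots> = of_real (?k * ?k2) * cis (T \<bullet> poly_hess d f x)
        * of_real (exp (- (norm (?g f))\<^sup>2 / 2))"
      by (simp only: integral_mult_right_zero cis_std_gaussian)
    also have "\<dots> = (?k * std_gaussian_density (?g f)) *\<^sub>R cis (T \<bullet> poly_hess d f x)"
      by (simp add: std_gaussian_density_def scaleR_conv_of_real)
    finally show "(?k * std_gaussian_density (?g f)) *\<^sub>R cis (T \<bullet> poly_hess d f x)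
      = (\<integral>z. of_real (?k * ?k2) * cis (T \<bullet> poly_hess d f x + z \<bullet> ?g f) \<partial>std_gaussian)" ..
  qed
  also have "\<dots> = (\<integral>z. (\<integral>f. of_real (?k * ?k2) * cis (T \<bullet> poly_hess d f x + z \<bullet> ?g f)
      \<partial>random_coeffs d) \<partial>std_gaussian)"
  proof (rule RG.Fubini_integral[symmetric])
    have "(\<lambda>p. of_real (?k * ?k2) * cis (T \<bullet> poly_hess d (fst p) x + snd p \<bullet> ?g (fst p)))
        \<in> borel_measurable (random_coeffs d \<Otimes>\<^sub>M std_gaussian)"
      by measurable
    then show "integrable (random_coeffs d \<Otimes>\<^sub>M std_gaussian) (\<lambda>(f, z). of_real (?k * ?k2)
        * cis (T \<bullet> poly_hess d f x + z \<bullet> ?g f))"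
      by (intro RG.integrable_const_bound[of _ "?k * ?k2"]) (auto simp: norm_mult split_beta')
  qed
  also have "\<dots> = (\<integral>z. of_real (?k * ?k2 * exp (- ?res / 2)
      * exp ((z \<bullet> z - (norm (B *v (z + z1)))\<^sup>2) / 2)) \<partial>std_gaussian)"
  proof (intro Bochner_Integration.integral_cong refl)
    fix z
    have "exp (- (?V (z /\<^sub>R sqrt (real d)) - z \<bullet> z) / 2)
        = exp (- ?res / 2) * exp ((z \<bullet> z - (norm (B *v (z + z1)))\<^sup>2) / 2)"
      unfolding V mult_exp_exp by (simp add: field_simps)
    then show "(\<integral>f. of_real (?k * ?k2) * cis (T \<bullet> poly_hess d f x + z \<bullet> ?g f) \<partial>random_coeffs d)
       = of_real (?k * ?k2 * exp (- ?res / 2) * exp ((z \<bullet> z - (norm (B *v (z + z1)))\<^sup>2) / 2))"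
      by (simp only: integral_mult_right_zero inner_cf of_real_mult mult.assoc)
  qed
  also have "\<dots> = of_real (?k * ?k2 * exp (- ?res / 2)
      * (\<integral>z. exp ((z \<bullet> z - (norm (B *v (z + z1)))\<^sup>2) / 2) \<partial>std_gaussian))"
    by (simp only: integral_complex_of_real integral_mult_right_zero)
  also have "(\<integral>z. exp ((z \<bullet> z - (norm (B *v (z + z1)))\<^sup>2) / 2) \<partial>std_gaussian) = 1 / \<bar>det B\<bar>"
  proof -
    have [measurable]: "(\<lambda>z. B *v (z + z1)) \<in> borel_measurable borel"
      by (intro borel_measurable_continuous_onI continuous_on_matrix_affine)
    have "(\<integral>z. exp ((z \<bullet> z - (norm (B *v (z + z1)))\<^sup>2) / 2) \<partial>std_gaussian)
      = (\<integral>z. std_gaussian_density z * exp ((z \<bullet> z - (norm (B *v (z + z1)))\<^sup>2) / 2) \<partial>lborel)"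
      unfolding std_gaussian_def
        by (subst integral_density) (auto simp: std_gaussian_density_nonneg)
    also have "\<dots> = (\<integral>z. std_gaussian_density (B *v (z + z1)) \<partial>lborel)"
      by (intro Bochner_Integration.integral_cong refl)
        (simp add: std_gaussian_density_def mult_exp_exp dot_square_norm diff_divide_distrib)
    also have "\<dots> = 1 / \<bar>det B\<bar>"
      using nn_integral_std_gaussian_affine[OF detB0, of z1]
      by (subst integral_eq_nn_integral) (auto simp: std_gaussian_density_nonneg)
    finally show ?thesis .
  qed
  also have "?k * ?k2 * exp (- ?res / 2) * (1 / \<bar>det B\<bar>)
    = (2 * pi * real d) powr (- real CARD('n) / 2) *
      ((r ^ (d - 1)) powr (- real CARD('n) / 2) * sqrt (r / m)) * exp (- ?res / 2)"
  proof -
    have "?k * ?k2 = (2 * pi * real d) powr (- real CARD('n) / 2)"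
      by (simp add: powr_mult)
    moreover have "1 / \<bar>det B\<bar> = (r ^ (d - 1)) powr (- real CARD('n) / 2) * sqrt (r / m)"
      unfolding detB by (simp add: powr_minus_divide real_sqrt_divide)
    ultimately show ?thesis by (simp add: mult_ac)
  qed
  finally show ?thesis .
qed

section \<open>Comparison with a perturbed GOE matrix\<close>

lemma continuous_on_sympart [continuous_intros]:
  "continuous_on S f \<Longrightarrow> continuous_on S (\<lambda>x. sympart (f x :: real^'n^'n))"
  unfolding sympart_def transpose_def by (intro continuous_intros)

lemma borel_measurable_sympart [measurable]: "(sympart :: real^'n^'n \<Rightarrow> _) \<in> borel_measurable borel"
  by (intro borel_measurable_continuous_onI continuous_intros)

lemma transpose_congruence:
  "transpose D = (D :: real^'n^'n) \<Longrightarrow> transpose M = M \<Longrightarrow> transpose (D ** M ** D) = D ** M ** D"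
  by (simp add: matrix_transpose_mul matrix_mul_assoc)

lemma transpose_scaleR: "transpose (c *\<^sub>R A) = c *\<^sub>R transpose (A :: real^'n^'m)"
  by (simp add: transpose_def vec_eq_iff)

text \<open>The symmetric part of a standard Gaussian matrix is a GOE matrix.\<close>

definition perturbed :: "real \<Rightarrow> real^'n \<Rightarrow> real \<Rightarrow> real^'n^'n \<Rightarrow> real^'n^'n" where
  "perturbed s x \<xi> Z = sympart Z + (s * \<xi>) *\<^sub>R outer x x"

lemma transpose_perturbed: "transpose (perturbed s x \<xi> Z) = perturbed s x \<xi> Z"
  by (simp add: perturbed_def transpose_add transpose_sympart transpose_scaleR transpose_outer)

lemma measurable_perturbed [measurable]:
  "(\<lambda>p. perturbed s x (fst p) (snd p)) \<in> borel_measurable (borel \<Otimes>\<^sub>M borel)"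
  unfolding perturbed_def by measurable

lemma measurable_congruence [measurable]:
  "(\<lambda>M. c *\<^sub>R (D ** M ** D) :: real^'n^'n) \<in> borel_measurable borel"
proof -
  have "linear (\<lambda>M. c *\<^sub>R (D ** M ** D) :: real^'n^'n)"
    by (auto simp: linear_iff vec_eq_iff matrix_matrix_mult_def sum_distrib_left sum_distrib_right
      sum.distrib algebra_simps)
  then show ?thesis
    by (intro borel_measurable_continuous_onI linear_continuous_on)
      (simp add: linear_conv_bounded_linear)
qed

text \<open>With \<open>k\<close>, \<open>c\<close> and \<open>D\<close> free, one family contains
  both the Hessian law and, for the values 1, 1 and \<open>mat 1\<close>, the law of the plain
  perturbed matrix, which is needed in one variable.\<close>

definition perturbed_measure :: "real \<Rightarrow> real \<Rightarrow> real^'n^'n \<Rightarrow> real \<Rightarrow> real^'n \<Rightarrow> (real^'n^'n) measure"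
  where
  "perturbed_measure k c D s x = density (distr (std_normal_distribution \<Otimes>\<^sub>M std_gaussian) borel
     (\<lambda>(\<xi>, Z). c *\<^sub>R (D ** perturbed s x \<xi> Z ** D))) (\<lambda>_. ennreal k)"

lemma measurable_perturbed_congruence:
  "(\<lambda>(\<xi>, Z). c *\<^sub>R (D ** perturbed s x \<xi> Z ** D))
    \<in> borel_measurable (std_normal_distribution \<Otimes>\<^sub>M std_gaussian)"
proof -
  have "(\<lambda>p. c *\<^sub>R (D ** perturbed s x (fst p) (snd p) ** D)) \<in> borel_measurable (borel \<Otimes>\<^sub>M borel)"
    by (rule measurable_compose[OF measurable_perturbed measurable_congruence])
  then show ?thesis
    by (simp add: split_beta' cong: measurable_cong_sets)
qed

text \<open>Congruence by a symmetric \<open>D\<close> is self-adjoint and can be moved onto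
  \<open>T\<close>; the exponent then splits into independent Gaussian parts from
  \<open>\<xi>\<close> and \<open>Z\<close>.\<close>

lemma cis_perturbed_measure:
  fixes T :: "real^'n::finite^'n"
  assumes D: "transpose D = D" and T: "transpose T = T" and k: "k \<ge> 0"
  shows "(\<integral>H. cis (T \<bullet> H) \<partial>perturbed_measure k c D s x)
    = of_real (k * exp (- (c\<^sup>2 *
      ((D ** T ** D) \<bullet> (D ** T ** D) + s\<^sup>2 * ((D ** T ** D) \<bullet> outer x x)\<^sup>2)) / 2))"
proof -
  interpret N: prob_space std_normal_distribution by (rule prob_space_std_normal)
  interpret G: prob_space "std_gaussian :: (real^'n^'n) measure" by (rule prob_space_std_gaussian)
  interpret NG: pair_sigma_finite std_normal_distribution "std_gaussian :: (real^'n^'n) measure"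
    by (simp add: pair_sigma_finite.intro N.sigma_finite_measure_axioms
      G.sigma_finite_measure_axioms)
  interpret NG: finite_measure "std_normal_distribution \<Otimes>\<^sub>M (std_gaussian :: (real^'n^'n) measure)"
    by (intro finite_measure_pair_measure N.finite_measure_axioms G.finite_measure_axioms)
  note m = measurable_perturbed_congruence[of c D s x]
  let ?A = "D ** T ** D"
  have A: "transpose ?A = ?A" using D T by (rule transpose_congruence)
  let ?b = "c * s * (?A \<bullet> outer x x)"
  have split: "cis (T \<bullet> (c *\<^sub>R (D ** perturbed s x \<xi> Z ** D)))
      = cis (?b * \<xi>) * cis ((c *\<^sub>R ?A) \<bullet> Z)" for \<xi> Z
    by (simp add: inner_congruence[OF D] perturbed_def inner_add_right inner_sympart
      sympart_id[OF A] cis_mult algebra_simps)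
  have "(\<integral>H. cis (T \<bullet> H) \<partial>perturbed_measure k c D s x)
    = k *\<^sub>R (\<integral>p. cis (T \<bullet> (case p of (\<xi>, Z) \<Rightarrow> c *\<^sub>R (D ** perturbed s x \<xi> Z ** D)))
      \<partial>(std_normal_distribution \<Otimes>\<^sub>M std_gaussian))"
    unfolding perturbed_measure_def using k m
    by (subst integral_density, simp, simp, simp, subst integral_distr) auto
  also have "(\<integral>p. cis (T \<bullet> (case p of (\<xi>, Z) \<Rightarrow> c *\<^sub>R (D ** perturbed s x \<xi> Z ** D)))
      \<partial>(std_normal_distribution \<Otimes>\<^sub>M std_gaussian))
    = (\<integral>p. (case p of (\<xi>, Z) \<Rightarrow> cis (?b * \<xi>) * cis ((c *\<^sub>R ?A) \<bullet> Z))
      \<partial>(std_normal_distribution \<Otimes>\<^sub>M std_gaussian))"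
    by (intro Bochner_Integration.integral_cong refl) (simp only: split_beta split)
  also have "\<dots> = (\<integral>\<xi>. (\<integral>Z. cis (?b * \<xi>) * cis ((c *\<^sub>R ?A) \<bullet> Z) \<partial>std_gaussian)
      \<partial>std_normal_distribution)"
  proof (rule NG.integral_fst[symmetric])
    have "(\<lambda>p. cis (?b * fst p) * cis ((c *\<^sub>R ?A) \<bullet> snd p))
        \<in> borel_measurable (std_normal_distribution \<Otimes>\<^sub>M std_gaussian)"
      by measurable
    then show "integrable (std_normal_distribution \<Otimes>\<^sub>M std_gaussian) (\<lambda>(\<xi>, Z). cis (?b * \<xi>)
        * cis ((c *\<^sub>R ?A) \<bullet> Z))"
      by (intro NG.integrable_const_bound[of _ 1]) (auto simp: norm_mult split_beta')
  qed
  also have "\<dots> = of_real (exp (- (1\<^sup>2 * ?b\<^sup>2) / 2)) * of_real (exp (- (norm (c *\<^sub>R ?A))\<^sup>2 / 2))"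
    by (simp only: integral_mult_right_zero integral_mult_left_zero cis_std_gaussian
      cis_normal[of 1, OF zero_less_one])
  also have "\<dots> = of_real (exp (- (c\<^sup>2 * (?A \<bullet> ?A + s\<^sup>2 * (?A \<bullet> outer x x)\<^sup>2)) / 2))"
  proof -
    have "(norm (c *\<^sub>R ?A))\<^sup>2 = c\<^sup>2 * (?A \<bullet> ?A)"
      by (simp add: power_mult_distrib dot_square_norm)
    then have "- (1\<^sup>2 * ?b\<^sup>2) / 2 + - (norm (c *\<^sub>R ?A))\<^sup>2 / 2
        = - (c\<^sup>2 * (?A \<bullet> ?A + s\<^sup>2 * (?A \<bullet> outer x x)\<^sup>2)) / 2"
      by (simp add: power_mult_distrib algebra_simps)
    then show ?thesis
      by (simp only: of_real_mult[symmetric] mult_exp_exp)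
  qed
  finally show ?thesis by (simp add: scaleR_conv_of_real)
qed

lemma finite_perturbed_measure: "finite_measure (perturbed_measure k c D s (x :: real^'n::finite))"
proof -
  interpret N: prob_space std_normal_distribution by (rule prob_space_std_normal)
  interpret G: prob_space "std_gaussian :: (real^'n^'n) measure" by (rule prob_space_std_gaussian)
  interpret NG: finite_measure "std_normal_distribution \<Otimes>\<^sub>M (std_gaussian :: (real^'n^'n) measure)"
    by (intro finite_measure_pair_measure N.finite_measure_axioms G.finite_measure_axioms)
  interpret Q: finite_measure "distr (std_normal_distribution \<Otimes>\<^sub>M std_gaussian) borel
     (\<lambda>(\<xi>, Z). c *\<^sub>R (D ** perturbed s x \<xi> Z ** D))"
    by (rule NG.finite_measure_distr[OF measurable_perturbed_congruence])
  show ?thesis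
    unfolding perturbed_measure_def
    by (rule finite_measureI) (simp add: emeasure_density ennreal_mult_eq_top_iff Q.emeasure_finite)
qed

text \<open>Symmetric and antisymmetric matrices are orthogonal, so a measure carried by symmetric
  matrices need only be tested against symmetric \<open>T\<close>.\<close>

lemma integral_cong_symmetric:
  fixes M :: "(real^'n^'n) measure"
  assumes sets [measurable_cong]: "sets M = sets borel" and AE: "AE H in M. transpose H = H"
  shows "(\<integral>H. cis (T \<bullet> H) \<partial>M) = (\<integral>H. cis (sympart T \<bullet> H) \<partial>M)"
proof -
  have "T \<bullet> H = sympart T \<bullet> H" if "transpose H = H" for H
    using that inner_sympart[of T H] sympart_id[of H] by simp
  then have eq: "cis (T \<bullet> H) = cis (sympart T \<bullet> H)" if "transpose H = H" for H
    using that by simp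
  show ?thesis
    using AE by (intro integral_cong_AE) (auto simp: eq)
qed

text \<open>For \<open>t = sqrt r\<close>, where \<open>t * t - 1 = x \<bullet> x\<close>, the left
  side is the eigenvalue on \<open>x\<close> of the matrix \<open>D\<close> used in
  \<open>hessian_measure_eq\<close>.\<close>

lemma rank_one_root_identity:
  assumes "t > (0::real)"
  shows "1 + (- 1 / (t * (t + 1))) * (t * t - 1) = 1 / t"
proof -
  have t: "t \<noteq> 0" "t + 1 \<noteq> 0" using assms by auto
  have "(- 1 / (t * (t + 1))) * ((t - 1) * (t + 1)) = - ((t - 1) / t)"
    using t by simp
  moreover have "(t - 1) * (t + 1) = t * t - 1" by (simp add: algebra_simps)
  moreover have "(t - 1) / t = 1 - 1 / t" using t by (simp add: diff_divide_distrib)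
  ultimately show ?thesis by simp
qed

lemma closed_symmetric: "closed {H :: real^'n^'n. transpose H = H}"
  unfolding transpose_def by (intro closed_Collect_eq continuous_intros)

lemma AE_perturbed_measure_symmetric:
  assumes D: "transpose D = (D :: real^'n::finite^'n)"
  shows "AE H in perturbed_measure k c D s x. transpose H = H"
proof -
  have [measurable]: "{H :: real^'n^'n. transpose H = H} \<in> sets borel"
    by (rule borel_closed[OF closed_symmetric])
  have "AE H in distr (std_normal_distribution \<Otimes>\<^sub>M std_gaussian) borel
     (\<lambda>(\<xi>, Z). c *\<^sub>R (D ** perturbed s x \<xi> Z ** D)). transpose H = H"
    using measurable_perturbed_congruence
    by (subst AE_distr_iff) (auto simp: transpose_scaleR
      transpose_congruence[OF D transpose_perturbed])
  then show ?thesis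
    unfolding perturbed_measure_def by (subst AE_density) auto
qed

text \<open>The matrix \<open>D\<close> is the inverse square root of
  \<open>mat 1 + outer x x\<close>. Its congruence accounts for the terms
  \<open>T \<bullet> T - 2 |T x|^2 / r + \<tau>^2 / r^2\<close>, with
  \<open>\<tau> = x \<bullet> T x\<close>, in the exponent of \<open>cis_hessian_measure\<close>,
  and turns the product with \<open>outer x x\<close> into \<open>\<tau> / r\<close>. The
  coefficient of the remaining \<open>\<tau>^2 / r^2\<close> is therefore the variance of the
  rank-one part, whence \<open>s\<close>.\<close>

lemma hessian_measure_eq:
  fixes x :: "real^'n::finite"
  assumes d: "d \<ge> 2"
  defines "r \<equiv> 1 + x \<bullet> x" and "m \<equiv> 1 + real d * (x \<bullet> x)"
  shows "hessian_measure d x = perturbed_measure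
     ((2 * pi * real d) powr (- real CARD('n) / 2) *
       ((r ^ (d - 1)) powr (- real CARD('n) / 2) * sqrt (r / m)))
     (sqrt (2 * real d * real (d - 1) * r ^ (d - 2)))
     (mat 1 + (- 1 / (sqrt r * (sqrt r + 1))) *\<^sub>R outer x x)
       (sqrt (real d * real (d - 1) / (2 * m))) x"
    (is "_ = perturbed_measure ?k ?c ?D ?s x")
proof -
  have r: "r \<ge> 1" and m: "m > 0" by (auto simp: r_def m_def intro!: add_pos_nonneg)
  define \<rho> where "\<rho> = sqrt r"
  have rho: "\<rho> > 0" "\<rho> * \<rho> = r" using r by (auto simp: \<rho>_def)
  have p: "x \<bullet> x = \<rho> * \<rho> - 1" using rho by (simp add: r_def)
  let ?\<beta> = "- 1 / (\<rho> * (\<rho> + 1))"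
  have rp: "\<rho> + 1 \<noteq> 0" using rho by simp
  have D1: "1 + ?\<beta> * (x \<bullet> x) = 1 / \<rho>"
    unfolding p by (rule rank_one_root_identity[OF rho(1)])
  have D2: "2 * ?\<beta> + ?\<beta>\<^sup>2 * (x \<bullet> x) = - 1 / r"
  proof -
    have "2 * ?\<beta> + ?\<beta>\<^sup>2 * (x \<bullet> x) = ?\<beta> * (1 + (1 + ?\<beta> * (x \<bullet> x)))"
      by (simp add: power2_eq_square algebra_simps)
    also have "\<dots> = - 1 / (\<rho> * \<rho>)"
    proof -
      have "1 + 1 / \<rho> = (\<rho> + 1) / \<rho>" using rho(1) by (simp add: field_simps)
      then show ?thesis unfolding D1 using rho(1) rp by simp
    qed
    finally show ?thesis by (simp only: rho)
  qed
  have tD: "transpose ?D = ?D" by (rule transpose_id_rank_one)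
  have k: "?k \<ge> 0" using r m by simp
  have cis_sym: "(\<integral>H. cis (T \<bullet> H) \<partial>hessian_measure d x)
      = (\<integral>H. cis (T \<bullet> H) \<partial>perturbed_measure ?k ?c ?D ?s x)"
    if T: "transpose T = T" for T
  proof -
    have "?c\<^sup>2 * ((?D ** T ** ?D) \<bullet> (?D ** T ** ?D) + ?s\<^sup>2 * ((?D ** T ** ?D) \<bullet> outer x x)\<^sup>2)
      = 2 * real d * real (d - 1) * r ^ (d - 2) *
         (T \<bullet> T - 2 * ((T *v x) \<bullet> (T *v x)) / r + (1 + real d * real (d - 1) / (2 * m)) *
           (x \<bullet> (T *v x))\<^sup>2 / r\<^sup>2)"
    proof -
      have "?c\<^sup>2 = 2 * real d * real (d - 1) * r ^ (d - 2)" "?s\<^sup>2 = real d * real (d - 1) / (2 * m)"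
        using r m by simp_all
      moreover have "(1 / \<rho>)\<^sup>2 = 1 / r" using rho by (simp add: power2_eq_square)
      ultimately show ?thesis
        unfolding \<rho>_def[symmetric] congruence_rank_one[OF T] D1 D2
        using r m by (simp add: power_divide power_mult_distrib field_simps)
    qed
    then show ?thesis
      unfolding cis_perturbed_measure[OF tD T k]
        cis_hessian_measure[OF d T, of x, folded r_def m_def] by simp
  qed
  show ?thesis
  proof (rule measure_eqI_cis)
    show s1: "sets (hessian_measure d x) = sets borel" by (simp add: hessian_measure_def)
    show s2: "sets (perturbed_measure ?k ?c ?D ?s x) = sets borel"
        by (simp add: perturbed_measure_def)
    fix T :: "real^'n^'n"
    have [measurable]: "{H :: real^'n^'n. transpose H = H} \<in> sets borel"
      by (rule borel_closed[OF closed_symmetric])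
    have 1: "AE H in hessian_measure d x. transpose H = H"
      unfolding hessian_measure_def using measurable_poly_hess
      by (subst AE_distr_iff) (auto simp: transpose_poly_hess)
    have 2: "AE H in perturbed_measure ?k ?c ?D ?s x. transpose H = H"
      by (rule AE_perturbed_measure_symmetric[OF tD])
    show "(\<integral>H. cis (T \<bullet> H) \<partial>hessian_measure d x)
        = (\<integral>H. cis (T \<bullet> H) \<partial>perturbed_measure ?k ?c ?D ?s x)"
      using integral_cong_symmetric[OF s1 1, of T] integral_cong_symmetric[OF s2 2, of T]
        cis_sym[OF transpose_sympart, of T] by (simp only:)
  qed (rule finite_hessian_measure finite_perturbed_measure)+
qed

definition perturbed_expectation :: "(real^'n^'n) set \<Rightarrow> real \<Rightarrow> real^'n \<Rightarrow> ennreal" where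
  "perturbed_expectation S s x
    = (\<integral>\<^sup>+ Z. (\<integral>\<^sup>+ \<xi>. ennreal \<bar>det (perturbed s x \<xi> Z)\<bar> * indicator S (perturbed s x \<xi> Z)
     \<partial>std_normal_distribution) \<partial>std_gaussian)"

text \<open>The property by which \<open>c\<close> and \<open>D\<close> drop out of the indicator of
  \<open>S\<close> and survive only as a determinant factor.\<close>

definition congruence_invariant :: "(real^'n^'n) set \<Rightarrow> bool" where
  "congruence_invariant S \<longleftrightarrow> (\<forall>c D M. c > 0 \<longrightarrow> transpose D = D \<longrightarrow> det D \<noteq> 0
    \<longrightarrow> (c *\<^sub>R (D ** M ** D) \<in> S \<longleftrightarrow> M \<in> S))"

lemma congruence_invariant_UNIV: "congruence_invariant UNIV"
  by (simp add: congruence_invariant_def)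

lemma congruence_invariant_possemidef: "congruence_invariant
    (possemidef :: (real^'n::finite^'n) set)"
  unfolding congruence_invariant_def
proof (intro allI impI)
  fix c :: real and D M :: "real^'n^'n"
  assume c: "c > 0" and D: "transpose D = D" and det: "det D \<noteq> 0"
  obtain D' where D': "D ** D' = mat 1"
    using det invertible_det_nz[of D] by (auto simp: invertible_def)
  have eq: "v \<bullet> ((c *\<^sub>R (D ** M ** D)) *v v) = c * ((D *v v) \<bullet> (M *v (D *v v)))" for v
    using symmetric_inner[OF D, of v "M *v (D *v v)"]
    by (simp add: scaleR_matrix_vector_assoc[symmetric] matrix_vector_mul_assoc[symmetric])
  show "c *\<^sub>R (D ** M ** D) \<in> possemidef \<longleftrightarrow> M \<in> possemidef"
    unfolding possemidef_def mem_Collect_eq eq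
  proof (intro iffI allI)
    fix w assume *: "\<forall>v. 0 \<le> c * ((D *v v) \<bullet> (M *v (D *v v)))"
    have "D *v (D' *v w) = w" by (simp add: matrix_vector_mul_assoc D')
    then show "0 \<le> w \<bullet> (M *v w)" using *[rule_format, of "D' *v w"] c
        by (simp add: zero_le_mult_iff)
  next
    fix v assume "\<forall>v. 0 \<le> v \<bullet> (M *v v)"
    then show "0 \<le> c * ((D *v v) \<bullet> (M *v (D *v v)))" using c by simp
  qed
qed

text \<open>Since \<open>det D = 1 / sqrt r\<close>, the scaled congruence multiplies absolute
  determinants by \<open>c ^ n / r\<close>. Together with the total mass of the Hessian law, the
  factor \<open>2 d\<close> and all powers of \<open>r\<close> whose exponent depends on
  \<open>d\<close> cancel.\<close>

lemma kac_rice_density_formula: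
  fixes x :: "real^'n::finite"
  assumes d: "d \<ge> 2" and S [measurable]: "S \<in> sets borel" and inv: "congruence_invariant S"
  defines "r \<equiv> 1 + x \<bullet> x" and "m \<equiv> 1 + real d * (x \<bullet> x)"
  shows "kac_rice_density d S x
    = ennreal (((real d - 1) / (pi * r)) powr (real CARD('n) / 2) / (sqrt r * sqrt m)) *
    perturbed_expectation S (sqrt (real d * (real d - 1) / (2 * m))) x"
proof -
  interpret N: prob_space std_normal_distribution by (rule prob_space_std_normal)
  interpret G: prob_space "std_gaussian :: (real^'n^'n) measure" by (rule prob_space_std_gaussian)
  interpret NG: pair_sigma_finite std_normal_distribution "std_gaussian :: (real^'n^'n) measure"
    by (simp add: pair_sigma_finite.intro N.sigma_finite_measure_axioms
      G.sigma_finite_measure_axioms)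
  have r: "r \<ge> 1" and m: "m > 0" by (auto simp: r_def m_def intro!: add_pos_nonneg)
  let ?k = "(2 * pi * real d) powr (- real CARD('n) / 2)
      * ((r ^ (d - 1)) powr (- real CARD('n) / 2) * sqrt (r / m))"
  let ?c = "sqrt (2 * real d * real (d - 1) * r ^ (d - 2))"
  let ?D = "mat 1 + (- 1 / (sqrt r * (sqrt r + 1))) *\<^sub>R outer x x"
  let ?s = "sqrt (real d * real (d - 1) / (2 * m))"
  have d1: "real (d - 1) = real d - 1" "real d - 1 > 0" using d by (simp_all add: of_nat_diff)
  have c: "?c > 0" using r d by simp
  have sr: "sqrt r > 0" "sqrt r * sqrt r = r" using r by auto
  have detD: "det ?D = 1 / sqrt r"
  proof -
    have "x \<bullet> x = sqrt r * sqrt r - 1" using sr by (simp add: r_def)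
    then show ?thesis
      unfolding det_id_rank_one using rank_one_root_identity[OF sr(1)] by (simp only:)
  qed
  have tD: "transpose ?D = ?D" by (rule transpose_id_rank_one)
  let ?f = "\<lambda>\<xi> Z. ennreal \<bar>det (perturbed ?s x \<xi> Z)\<bar> * indicator S (perturbed ?s x \<xi> Z)"
  have fm: "(\<lambda>(\<xi>, Z). ?f \<xi> Z) \<in> borel_measurable (std_normal_distribution \<Otimes>\<^sub>M std_gaussian)"
  proof -
    have "(\<lambda>p. ?f (fst p) (snd p)) \<in> borel_measurable (borel \<Otimes>\<^sub>M borel)" by measurable
    then show ?thesis by (simp add: split_beta' cong: measurable_cong_sets)
  qed
  have "kac_rice_density d S x
      = (\<integral>\<^sup>+ H. ennreal \<bar>det H\<bar> * indicator S H \<partial>perturbed_measure ?k ?c ?D ?s x)"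
    using hessian_measure_eq[OF d, of x] by (simp add: kac_rice_density_eq[OF S] r_def m_def)
  also have "\<dots> = (\<integral>\<^sup>+ H. ennreal ?k * (ennreal \<bar>det H\<bar> * indicator S H)
      \<partial>distr (std_normal_distribution \<Otimes>\<^sub>M std_gaussian) borel
     (\<lambda>(\<xi>, Z). ?c *\<^sub>R (?D ** perturbed ?s x \<xi> Z ** ?D)))"
    unfolding perturbed_measure_def by (rule nn_integral_density) auto
  also have "\<dots> = (\<integral>\<^sup>+ p. ennreal ?k
      * (ennreal \<bar>det (case p of (\<xi>, Z) \<Rightarrow> ?c *\<^sub>R (?D ** perturbed ?s x \<xi> Z ** ?D))\<bar> *
      indicator S (case p of (\<xi>, Z) \<Rightarrow> ?c *\<^sub>R (?D ** perturbed ?s x \<xi> Z ** ?D)))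
        \<partial>(std_normal_distribution \<Otimes>\<^sub>M std_gaussian))"
    by (rule nn_integral_distr[OF measurable_perturbed_congruence]) auto
  also have "\<dots> = (\<integral>\<^sup>+ p. ennreal (?k * (?c ^ CARD('n) / r)) * (case p of (\<xi>, Z) \<Rightarrow> ?f \<xi> Z)
      \<partial>(std_normal_distribution \<Otimes>\<^sub>M std_gaussian))"
  proof (rule nn_integral_cong)
    fix p :: "real \<times> (real^'n^'n)"
    obtain \<xi> Z where p: "p = (\<xi>, Z)" by (cases p)
    let ?M = "perturbed ?s x \<xi> Z"
    have "\<bar>det (?c *\<^sub>R (?D ** ?M ** ?D))\<bar> = ?c ^ CARD('n) / r * \<bar>det ?M\<bar>"
    proof -
      have "\<bar>c ^ CARD('n) * (1 / t * y * (1 / t))\<bar> = c ^ CARD('n) / (t * t) * \<bar>y\<bar>"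
          if "c > 0" "t > 0" for c t y :: real
        using that by (simp add: abs_mult)
      from this[OF c sr(1)] show ?thesis
        by (simp only: det_scaleR det_mul detD sr(2))
    qed
    moreover have "?c *\<^sub>R (?D ** ?M ** ?D) \<in> S \<longleftrightarrow> ?M \<in> S"
    proof -
      have "det ?D \<noteq> 0" unfolding detD using sr(1) by simp
      then show ?thesis using inv c tD unfolding congruence_invariant_def by blast
    qed
    moreover have "ennreal (?k * (?c ^ CARD('n) / r)) * ennreal \<bar>det ?M\<bar>
        = ennreal ?k * ennreal (?c ^ CARD('n) / r * \<bar>det ?M\<bar>)"
      using r c m by (simp add: ennreal_mult[symmetric] mult.assoc less_imp_le)
    ultimately show "ennreal ?k
        * (ennreal \<bar>det (case p of (\<xi>, Z) \<Rightarrow> ?c *\<^sub>R (?D ** perturbed ?s x \<xi> Z ** ?D))\<bar> *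
      indicator S (case p of (\<xi>, Z) \<Rightarrow> ?c *\<^sub>R (?D ** perturbed ?s x \<xi> Z ** ?D))) = ennreal
        (?k * (?c ^ CARD('n) / r)) * (case p of (\<xi>, Z) \<Rightarrow> ?f \<xi> Z)"
      by (simp add: p indicator_def)
  qed
  also have "\<dots> = ennreal (?k * (?c ^ CARD('n) / r))
      * (\<integral>\<^sup>+ p. (case p of (\<xi>, Z) \<Rightarrow> ?f \<xi> Z) \<partial>(std_normal_distribution \<Otimes>\<^sub>M std_gaussian))"
    by (rule nn_integral_cmult[OF fm])
  also have "(\<integral>\<^sup>+ p. (case p of (\<xi>, Z) \<Rightarrow> ?f \<xi> Z) \<partial>(std_normal_distribution \<Otimes>\<^sub>M std_gaussian))
      = perturbed_expectation S ?s x"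
    unfolding perturbed_expectation_def using NG.nn_integral_snd[OF fm] by simp
  also have "?k * (?c ^ CARD('n) / r)
      = ((real d - 1) / (pi * r)) powr (real CARD('n) / 2) / (sqrt r * sqrt m)"
  proof -
    let ?h = "real CARD('n) / 2" and ?q = "r ^ (d - 2)"
    have q: "?q > 0" using r by simp
    have rd: "r ^ (d - 1) = ?q * r" using d by (auto dest!: le_Suc_ex simp: mult.commute)
    have "?c ^ CARD('n) = (2 * real d * (real d - 1) * ?q) powr ?h"
      using c d1 q d by (simp add: powr_half_sqrt[symmetric] powr_realpow[symmetric] powr_powr)
    then have "(2 * pi * real d) powr (- ?h) * (?q * r) powr (- ?h) * ?c ^ CARD('n)
      = (2 * real d * (real d - 1) * ?q) powr ?h / ((2 * pi * real d) powr ?h * (?q * r) powr ?h)"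
      by (simp add: powr_minus_divide)
    also have "\<dots> = ((2 * real d * (real d - 1) * ?q) / ((2 * pi * real d) * (?q * r))) powr ?h"
      using d1 q d r by (simp add: powr_mult powr_divide)
    also have "(2 * real d * (real d - 1) * ?q) / ((2 * pi * real d) * (?q * r))
        = (real d - 1) / (pi * r)"
      using d q r by (simp add: field_simps)
    finally have "(2 * pi * real d) powr (- ?h) * (?q * r) powr (- ?h) * ?c ^ CARD('n)
        = ((real d - 1) / (pi * r)) powr ?h" .
    moreover have "sqrt (r / m) / r = 1 / (sqrt r * sqrt m)"
    proof -
      have "sqrt (r / m) / r = sqrt r / sqrt m / (sqrt r * sqrt r)"
          by (simp only: real_sqrt_divide sr(2))
      also have "\<dots> = 1 / (sqrt r * sqrt m)"
      proof -
        have "t / y / (t * t) = 1 / (t * y)" if "t > 0" for t y :: real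
          using that by (simp add: field_simps)
        then show ?thesis using sr(1) by blast
      qed
      finally show ?thesis .
    qed
    moreover have "?k * (?c ^ CARD('n) / r)
        = ((2 * pi * real d) powr (- ?h) * (?q * r) powr (- ?h) * ?c ^ CARD('n)) *
          (sqrt (r / m) / r)"
      unfolding rd by (simp add: algebra_simps)
    ultimately show ?thesis by simp
  qed
  finally show ?thesis unfolding d1(1) .
qed

subsection \<open>Convexity along rank-one directions\<close>

lemma nn_integral_std_normal_uminus:
  assumes [measurable]: "h \<in> borel_measurable borel"
  shows "(\<integral>\<^sup>+ \<xi>. h (- \<xi>) \<partial>std_normal_distribution) = (\<integral>\<^sup>+ \<xi>. h \<xi> \<partial>std_normal_distribution)"
proof -
  have "(\<integral>\<^sup>+ \<xi>. h \<xi> \<partial>std_normal_distribution)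
      = (\<integral>\<^sup>+ \<xi>. ennreal (std_normal_density \<xi>) * h \<xi> \<partial>lborel)"
    by (subst nn_integral_density) auto
  also have "\<dots> = (\<integral>\<^sup>+ \<xi>. ennreal (std_normal_density \<xi>) * h \<xi> \<partial>distr lborel borel uminus)"
    by (simp add: lborel_distr_uminus)
  also have "\<dots> = (\<integral>\<^sup>+ \<xi>. ennreal (std_normal_density (- \<xi>)) * h (- \<xi>) \<partial>lborel)"
    by (subst nn_integral_distr) auto
  also have "\<dots> = (\<integral>\<^sup>+ \<xi>. h (- \<xi>) \<partial>std_normal_distribution)"
    by (subst nn_integral_density) (auto simp: std_normal_density_def)
  finally show ?thesis ..
qed

text \<open>\<open>s * \<xi>\<close> is a convex combination of \<open>s' * \<xi>\<close> and
  \<open>- s' * \<xi>\<close>, with weight \<open>(1 + s / s') / 2\<close> on the first; by symmetry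
  of the normal law both ends have the same expectation.\<close>

lemma nn_integral_convex_mono:
  fixes h :: "real \<Rightarrow> real"
  assumes h: "convex_on UNIV h" "\<And>t. 0 \<le> h t" and [measurable]: "h \<in> borel_measurable borel"
    and s: "0 \<le> s" "s \<le> s'"
  shows "(\<integral>\<^sup>+ \<xi>. ennreal (h (s * \<xi>)) \<partial>std_normal_distribution)
    \<le> (\<integral>\<^sup>+ \<xi>. ennreal (h (s' * \<xi>)) \<partial>std_normal_distribution)"
proof (cases "s' = 0")
  case True
  then show ?thesis using s by simp
next
  case False
  define u where "u = (1 + s / s') / 2"
  have u: "0 \<le> u" "u \<le> 1" using s False by (auto simp: u_def field_simps)
  have pt: "ennreal (h (s * \<xi>))
      \<le> ennreal u * ennreal (h (s' * \<xi>)) + ennreal (1 - u) * ennreal (h (s' * (- \<xi>)))" for \<xi>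
  proof -
    have "s * \<xi> = (1 - (1 - u)) *\<^sub>R (s' * \<xi>) + (1 - u) *\<^sub>R (s' * (- \<xi>))"
      using False by (simp add: u_def field_simps)
    then have "h (s * \<xi>) \<le> (1 - (1 - u)) * h (s' * \<xi>) + (1 - u) * h (s' * (- \<xi>))"
      using convex_onD[OF h(1), of "1 - u" "s' * \<xi>" "s' * (- \<xi>)"] u by simp
    then show ?thesis
      using u h(2) by (simp add: ennreal_mult[symmetric] ennreal_plus[symmetric] ennreal_leI del:
        ennreal_plus)
  qed
  have "(\<integral>\<^sup>+ \<xi>. ennreal (h (s * \<xi>)) \<partial>std_normal_distribution)
    \<le> (\<integral>\<^sup>+ \<xi>. ennreal u * ennreal (h (s' * \<xi>)) + ennreal (1 - u) * ennreal (h (s' * (- \<xi>)))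
      \<partial>std_normal_distribution)"
    by (intro nn_integral_mono pt)
  also have "\<dots> = ennreal u * (\<integral>\<^sup>+ \<xi>. ennreal (h (s' * \<xi>)) \<partial>std_normal_distribution)
      + ennreal (1 - u) * (\<integral>\<^sup>+ \<xi>. ennreal (h (s' * (- \<xi>))) \<partial>std_normal_distribution)"
    by (subst nn_integral_add) (auto simp: nn_integral_cmult)
  also have "(\<integral>\<^sup>+ \<xi>. ennreal (h (s' * (- \<xi>))) \<partial>std_normal_distribution)
      = (\<integral>\<^sup>+ \<xi>. ennreal (h (s' * \<xi>)) \<partial>std_normal_distribution)"
    by (rule nn_integral_std_normal_uminus) measurable
  also have "ennreal u * (\<integral>\<^sup>+ \<xi>. ennreal (h (s' * \<xi>)) \<partial>std_normal_distribution)
      + ennreal (1 - u) * (\<integral>\<^sup>+ \<xi>. ennreal (h (s' * \<xi>)) \<partial>std_normal_distribution)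
    = (\<integral>\<^sup>+ \<xi>. ennreal (h (s' * \<xi>)) \<partial>std_normal_distribution)"
    using u by (simp add: distrib_right[symmetric] ennreal_plus[symmetric] del: ennreal_plus)
  finally show ?thesis .
qed

lemma possemidef_Cauchy_Schwarz:
  assumes M: "transpose M = M" "M \<in> possemidef" and y: "y \<bullet> (M *v y) > 0"
  shows "(v \<bullet> (M *v y))\<^sup>2 \<le> (v \<bullet> (M *v v)) * (y \<bullet> (M *v y))"
proof -
  define l where "l = (v \<bullet> (M *v y)) / (y \<bullet> (M *v y))"
  have c: "y \<bullet> (M *v v) = v \<bullet> (M *v y)"
    using symmetric_inner[OF M(1), of y v] by (simp add: inner_commute)
  have "0 \<le> (v - l *\<^sub>R y) \<bullet> (M *v (v - l *\<^sub>R y))"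
    using M(2) by (simp add: possemidef_def)
  also have "\<dots> = v \<bullet> (M *v v) - 2 * l * (v \<bullet> (M *v y)) + l * (l * (y \<bullet> (M *v y)))"
    by (simp add: matrix_vector_mult_diff_distrib matrix_vector_mult_scaleR inner_diff_left
      inner_diff_right c algebra_simps)
  also have "l * (y \<bullet> (M *v y)) = v \<bullet> (M *v y)"
    using y by (simp add: l_def)
  finally have "l * (v \<bullet> (M *v y)) \<le> v \<bullet> (M *v v)" by simp
  then have "l * (v \<bullet> (M *v y)) * (y \<bullet> (M *v y)) \<le> (v \<bullet> (M *v v)) * (y \<bullet> (M *v y))"
    using y by (intro mult_right_mono) auto
  then show ?thesis
    using y by (simp add: l_def power2_eq_square)
qed

text \<open>With \<open>y\<close> solving \<open>M *v y = x\<close>, the matrix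
  \<open>M - t *\<^sub>R outer x x\<close> is singular at \<open>t = 1 / (y \<bullet> x)\<close>, so
  its determinant is \<open>a * (1 - t * (y \<bullet> x))\<close>. By the Cauchy-Schwarz inequality
  for the form of \<open>M\<close> it stays semidefinite up to that value; outside the cone the
  determinant has therefore changed sign.\<close>

lemma det_sign_change:
  fixes M :: "real^'n::finite^'n"
  assumes M: "transpose M = M" "positive_definite M" and c: "c > 0"
    and npsd: "M - c *\<^sub>R outer x x \<notin> possemidef" and ab: "\<And>t. det (M + t *\<^sub>R outer x x) = a + b * t"
  shows "a * (a - b * c) \<le> 0"
proof -
  have psd: "M \<in> possemidef"
  proof -
    have "0 \<le> v \<bullet> (M *v v)" for v
      using M(2) by (cases "v = 0") (auto simp: positive_definite_def less_imp_le)
    then show ?thesis by (simp add: possemidef_def)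
  qed
  have a: "a = det M" using ab[of 0] by simp
  have "det M \<noteq> 0"
  proof
    assume "det M = 0"
    then obtain v where "v \<noteq> 0" "M *v v = 0"
      using invertible_det_nz[of M] matrix_left_invertible_ker[of M]
        unfolding invertible_left_inverse by auto
    then show False using M(2) unfolding positive_definite_def by force
  qed
  then obtain M' where M': "M ** M' = mat 1"
    using invertible_det_nz[of M] by (auto simp: invertible_def)
  define y where "y = M' *v x"
  have My: "M *v y = x" by (simp add: y_def matrix_vector_mul_assoc M')
  have "x \<noteq> 0"
  proof
    assume "x = 0"
    then have "outer x x = 0" by (simp add: outer_def vec_eq_iff)
    then show False using npsd psd by simp
  qed
  then have "y \<noteq> 0" using My by auto
  then have k: "y \<bullet> x > 0" using M(2) My unfolding positive_definite_def by metis
  have sing: "det (M - (1 / (y \<bullet> x)) *\<^sub>R outer x x) = 0"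
  proof (rule ccontr)
    assume "det (M - (1 / (y \<bullet> x)) *\<^sub>R outer x x) \<noteq> 0"
    moreover have "(M - (1 / (y \<bullet> x)) *\<^sub>R outer x x) *v y = 0"
      using k by (simp add: matrix_vector_mult_diff_rdistrib scaleR_matrix_vector_assoc[symmetric]
        outer_mult_vec My inner_commute)
    ultimately show False
      using \<open>y \<noteq> 0\<close> invertible_det_nz matrix_left_invertible_ker unfolding invertible_left_inverse
        by metis
  qed
  have b: "a = b / (y \<bullet> x)"
    using ab[of "- (1 / (y \<bullet> x))"] sing by simp
  have "c * (y \<bullet> x) > 1"
  proof (rule ccontr)
    assume "\<not> c * (y \<bullet> x) > 1"
    then have ck: "c * (y \<bullet> x) \<le> 1" by simp
    have "0 \<le> v \<bullet> ((M - c *\<^sub>R outer x x) *v v)" for v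
    proof -
      have "(v \<bullet> x)\<^sup>2 \<le> (v \<bullet> (M *v v)) * (y \<bullet> x)"
        using possemidef_Cauchy_Schwarz[OF M(1) psd, of y v] k by (simp add: My)
      then have "c * (v \<bullet> x)\<^sup>2 \<le> c * ((v \<bullet> (M *v v)) * (y \<bullet> x))"
        using c by (intro mult_left_mono) auto
      also have "\<dots> = (v \<bullet> (M *v v)) * (c * (y \<bullet> x))" by simp
      also have "\<dots> \<le> v \<bullet> (M *v v)"
        using ck psd by (intro mult_left_le) (auto simp: possemidef_def)
      finally show ?thesis
        by (simp add: matrix_vector_mult_diff_rdistrib scaleR_matrix_vector_assoc[symmetric]
          outer_mult_vec inner_diff_right
            power2_eq_square inner_commute)
    qed
    then show False using npsd by (simp add: possemidef_def)
  qed
  then have "1 - c * (y \<bullet> x) \<le> 0" by simp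
  moreover have "a * (a - b * c) = a\<^sup>2 * (1 - c * (y \<bullet> x))"
  proof -
    have "b = a * (y \<bullet> x)" using b k by simp
    then show ?thesis by (simp add: power2_eq_square algebra_simps)
  qed
  ultimately show ?thesis by (simp add: mult_nonneg_nonpos)
qed

lemma convex_on_abs_det:
  "convex_on UNIV (\<lambda>t. \<bar>det (A + t *\<^sub>R outer x x)\<bar> :: real)"
proof -
  obtain a b where ab: "\<And>t. det (A + t *\<^sub>R outer x x) = a + b * t"
    using det_rank_one_affine[of A x] by blast
  show ?thesis
  proof (rule convex_onI)
    fix u s t :: real assume u: "0 < u" "u < 1"
    have "a + b * ((1 - u) *\<^sub>R s + u *\<^sub>R t) = (1 - u) * (a + b * s) + u * (a + b * t)"
        by (simp add: algebra_simps)
    then show "\<bar>det (A + ((1 - u) *\<^sub>R s + u *\<^sub>R t) *\<^sub>R outer x x)\<bar>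
      \<le> (1 - u) * \<bar>det (A + s *\<^sub>R outer x x)\<bar> + u * \<bar>det (A + t *\<^sub>R outer x x)\<bar>"
      unfolding ab using u abs_triangle_ineq[of "(1 - u) * (a + b * s)" "u * (a + b * t)"]
        by (simp only: abs_mult)
  qed simp
qed

text \<open>Along the line the parameters of semidefinite matrices form an up-closed set, and the
  determinant is affine. The critical case is a chord that starts outside the cone and reaches a
  nonsingular point inside: by \<open>det_sign_change\<close> the affine function has no value of
  the same sign at the start, so replacing that value by 0 does no harm.\<close>

lemma convex_on_abs_det_possemidef:
  fixes A :: "real^'n::finite^'n"
  assumes A: "transpose A = A"
  shows "convex_on UNIV (\<lambda>t. \<bar>det (A + t *\<^sub>R outer x x)\<bar>
    * indicator possemidef (A + t *\<^sub>R outer x x) :: real)"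
proof -
  obtain a b where ab: "\<And>t. det (A + t *\<^sub>R outer x x) = a + b * t"
    using det_rank_one_affine[of A x] by blast
  let ?M = "\<lambda>t. A + t *\<^sub>R outer x x"
  let ?h = "\<lambda>t. \<bar>det (?M t)\<bar> * indicator possemidef (?M t) :: real"
  have sym: "transpose (?M t) = ?M t" for t
    by (simp add: A transpose_add transpose_scaleR transpose_outer)
  have up: "?M t \<in> possemidef" if "?M s \<in> possemidef" "s \<le> t" for s t
  proof -
    have "v \<bullet> (?M t *v v) = v \<bullet> (?M s *v v) + (t - s) * (v \<bullet> x)\<^sup>2" for v
      by (simp add: matrix_vector_mult_add_rdistrib scaleR_matrix_vector_assoc[symmetric]
        outer_mult_vec inner_add_right
          power2_eq_square inner_commute algebra_simps)
    then show ?thesis using that by (simp add: possemidef_def)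
  qed
  have *: "?h ((1 - u) * s + u * t) \<le> (1 - u) * ?h s + u * ?h t" if st: "s < t"
      and u: "0 < u" "u < 1" for u s t
  proof -
    let ?w = "(1 - u) * s + u * t"
    have nn: "0 \<le> (1 - u) * ?h s + u * ?h t" using u
        by (intro add_nonneg_nonneg mult_nonneg_nonneg) auto
    have ws: "?w - s = u * (t - s)" "t - ?w = (1 - u) * (t - s)" by (simp_all add: algebra_simps)
    then have w: "s < ?w" "?w < t" using st u by (metis diff_gt_0_iff_gt mult_pos_pos)+
    have lin: "a + b * ?w = (1 - u) * (a + b * s) + u * (a + b * t)" by (simp add: algebra_simps)
    show ?thesis
    proof (cases "?M ?w \<in> possemidef \<and> det (?M ?w) \<noteq> 0")
      case False
      then have h0: "?h ?w = 0" by auto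
      show ?thesis unfolding h0 by (rule nn)
    next
      case True
      then have pd: "positive_definite (?M ?w)"
        using positive_definite_iff_possemidef[OF sym] by blast
      have t: "?M t \<in> possemidef" using up[of ?w t] True w by simp
      show ?thesis
      proof (cases "?M s \<in> possemidef")
        case s: True
        show ?thesis
          using True s t u abs_triangle_ineq[of "(1 - u) * (a + b * s)" "u * (a + b * t)"]
          unfolding ab lin by (simp add: abs_mult)
      next
        case s: False
        have eq: "?M s = ?M ?w - (?w - s) *\<^sub>R outer x x"
          by (simp add: algebra_simps)
        have "(a + b * ?w) * ((a + b * ?w) - b * (?w - s)) \<le> 0"
        proof (rule det_sign_change[OF sym pd])
          show "?w - s > 0" using w by simp
          show "?M ?w - (?w - s) *\<^sub>R outer x x \<notin> possemidef" using s unfolding eq .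
          show "det (?M ?w + t *\<^sub>R outer x x) = a + b * ?w + b * t" for t
            using ab[of "?w + t"] by (simp add: scaleR_add_left algebra_simps)
        qed
        then have sg: "(a + b * ?w) * (a + b * s) \<le> 0" by (simp add: algebra_simps)
        \<comment> \<open>The value at the intermediate point is squared and one copy is expanded as
          a convex combination; the term at \<open>s\<close> is nonpositive by the sign change, and
          cancelling the positive factor gives the bound.\<close>
        have "\<bar>a + b * ?w\<bar> * \<bar>a + b * ?w\<bar> = (a + b * ?w) * (a + b * ?w)" by simp
        also have "\<dots> = (1 - u) * ((a + b * ?w) * (a + b * s)) + u * ((a + b * ?w) * (a + b * t))"
          by (subst (2) lin) (simp only: algebra_simps)
        also have "\<dots> \<le> u * ((a + b * ?w) * (a + b * t))"
          using sg u by (simp add: mult_nonneg_nonpos)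
        also have "\<dots> \<le> u * (\<bar>a + b * ?w\<bar> * \<bar>a + b * t\<bar>)"
          using u by (intro mult_left_mono) (auto simp: abs_mult[symmetric])
        finally have "\<bar>a + b * ?w\<bar> * \<bar>a + b * ?w\<bar> \<le> \<bar>a + b * ?w\<bar> * (u * \<bar>a + b * t\<bar>)"
            by (simp only: mult_ac)
        moreover have "\<bar>a + b * ?w\<bar> > 0" using True unfolding ab by simp
        ultimately have "\<bar>a + b * ?w\<bar> \<le> u * \<bar>a + b * t\<bar>" by (simp only: mult_le_cancel_left_pos)
        then show ?thesis using True s t by (simp add: ab)
      qed
    qed
  qed
  show ?thesis
  proof (rule convex_onI)
    fix u s t :: real assume u: "0 < u" "u < 1"
    consider "s < t" | "s = t" | "t < s" by linarith
    then show "?h ((1 - u) *\<^sub>R s + u *\<^sub>R t) \<le> (1 - u) * ?h s + u * ?h t"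
    proof cases
      case 1 then show ?thesis using *[OF _ u] by simp
    next
      case 2 then show ?thesis by (simp add: algebra_simps)
    next
      case 3 then show ?thesis using *[of t s "1 - u"] u by (simp add: add.commute)
    qed
  qed simp
qed

lemma perturbed_expectation_mono:
  fixes S :: "(real^'n::finite^'n) set"
  assumes S: "S = UNIV \<or> S = possemidef" and s: "0 \<le> s" "s \<le> s'"
  shows "perturbed_expectation S s x \<le> perturbed_expectation S s' x"
  unfolding perturbed_expectation_def
proof (rule nn_integral_mono)
  fix Z :: "real^'n^'n"
  have [measurable]: "S \<in> sets borel" using S borel_closed[OF closed_possemidef] by auto
  let ?h = "\<lambda>t. \<bar>det (sympart Z + t *\<^sub>R outer x x)\<bar>
      * indicator S (sympart Z + t *\<^sub>R outer x x) :: real"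
  have "convex_on UNIV ?h"
    using S convex_on_abs_det[of "sympart Z" x]
      convex_on_abs_det_possemidef[OF transpose_sympart, of Z x] by auto
  moreover have "?h \<in> borel_measurable borel" by measurable
  ultimately have "(\<integral>\<^sup>+ \<xi>. ennreal (?h (s * \<xi>)) \<partial>std_normal_distribution)
      \<le> (\<integral>\<^sup>+ \<xi>. ennreal (?h (s' * \<xi>)) \<partial>std_normal_distribution)"
    by (intro nn_integral_convex_mono s) auto
  moreover have "ennreal (?h t)
      = ennreal \<bar>det (sympart Z + t *\<^sub>R outer x x)\<bar> * indicator S (sympart Z + t *\<^sub>R outer x x)" for
        t
    by (simp add: indicator_def)
  ultimately show "(\<integral>\<^sup>+ \<xi>. ennreal \<bar>det (perturbed s x \<xi> Z)\<bar> * indicator S (perturbed s x \<xi> Z)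
      \<partial>std_normal_distribution)
    \<le> (\<integral>\<^sup>+ \<xi>. ennreal \<bar>det (perturbed s' x \<xi> Z)\<bar> * indicator S (perturbed s' x \<xi> Z)
      \<partial>std_normal_distribution)"
    by (simp only: perturbed_def)
qed

section \<open>Comparison with degree two\<close>

lemma perturbed_expectation_scale:
  "perturbed_expectation S s (c *\<^sub>R y) = perturbed_expectation S (s * c\<^sup>2) y"
proof -
  have "perturbed s (c *\<^sub>R y) \<xi> Z = perturbed (s * c\<^sup>2) y \<xi> Z" for \<xi> Z
    by (simp add: perturbed_def outer_def vec_eq_iff power2_eq_square)
  then show ?thesis by (simp only: perturbed_expectation_def)
qed

lemma nn_integral_scaleR:
  fixes f :: "'a::euclidean_space \<Rightarrow> ennreal"
  assumes [measurable]: "f \<in> borel_measurable borel" and c: "c > 0"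
  shows "(\<integral>\<^sup>+ x. f x \<partial>lborel) = (\<integral>\<^sup>+ y. ennreal (c ^ DIM('a)) * f (c *\<^sub>R y) \<partial>lborel)"
proof -
  have "(\<integral>\<^sup>+ x. f x \<partial>lborel)
      = (\<integral>\<^sup>+ x. f x \<partial>density (distr lborel borel (\<lambda>y :: 'a. 0 + c *\<^sub>R y)) (\<lambda>_. \<bar>c\<bar> ^ DIM('a)))"
    using lborel_affine[of c "0 :: 'a"] c by simp
  also have "\<dots> = (\<integral>\<^sup>+ y. ennreal (c ^ DIM('a)) * f (c *\<^sub>R y) \<partial>lborel)"
    using c by (simp add: nn_integral_density nn_integral_distr)
  finally show ?thesis .
qed

lemma borel_measurable_perturbed_expectation:
  assumes [measurable]: "S \<in> sets borel" "s \<in> borel_measurable borel"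
  shows "(\<lambda>x :: real^'n::finite. perturbed_expectation S (s x) x) \<in> borel_measurable borel"
proof -
  interpret N: prob_space std_normal_distribution by (rule prob_space_std_normal)
  interpret G: prob_space "std_gaussian :: (real^'n^'n) measure" by (rule prob_space_std_gaussian)
  have o [measurable]: "(\<lambda>x :: real^'n. outer x x) \<in> borel_measurable borel"
    unfolding outer_def by (intro borel_measurable_continuous_onI continuous_intros)
  show ?thesis
    unfolding perturbed_expectation_def perturbed_def by measurable
qed

text \<open>The Jacobian of the substitution cancels the factor \<open>(d - 1) powr (n / 2)\<close>
  of the density. The size of the perturbation becomes at most that for degree two, so
  \<open>perturbed_expectation_mono\<close> applies, and \<open>r\<close> and \<open>m\<close> are
  compared with \<open>1 + Y\<close> and \<open>1 + 2 * Y\<close> for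
  \<open>Y = y \<bullet> y\<close>.\<close>

lemma kac_rice_comparison:
  fixes S :: "(real^'n::finite^'n) set"
  assumes d: "d \<ge> 3" and S: "S = UNIV \<or> S = possemidef"
  shows "(\<integral>\<^sup>+ x. kac_rice_density d S x \<partial>lborel)
    \<le> ennreal (sqrt (2 / real d) * (real d - 1) powr ((real CARD('n) + 2) / 2)) *
      (\<integral>\<^sup>+ x. kac_rice_density 2 S x \<partial>lborel)"
proof -
  have [measurable]: "S \<in> sets borel" using S borel_closed[OF closed_possemidef] by auto
  have inv: "congruence_invariant S"
    using S congruence_invariant_UNIV congruence_invariant_possemidef by auto
  let ?J = "\<lambda>d x. ennreal (((real d - 1) / (pi * (1 + x \<bullet> x))) powr (real CARD('n) / 2)
      / (sqrt (1 + x \<bullet> x) * sqrt (1 + real d * (x \<bullet> x)))) *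
    perturbed_expectation S (sqrt (real d * (real d - 1) / (2 * (1 + real d * (x \<bullet> x))))) x"
  have J: "kac_rice_density d S x = ?J d x" if "d \<ge> 2" for d x
    by (rule kac_rice_density_formula[OF that _ inv]) simp
  have Jm: "?J d \<in> borel_measurable borel" for d :: nat
  proof -
    have [measurable]: "(\<lambda>x :: real^'n. perturbed_expectation S (sqrt (real d * (real d - 1)
        / (2 * (1 + real d * (x \<bullet> x))))) x) \<in> borel_measurable borel"
      by (rule borel_measurable_perturbed_expectation) measurable
    show ?thesis by measurable
  qed
  define e where "e = real d - 1"
  have e: "e \<ge> 2" "real d = e + 1" using d by (auto simp: e_def)
  define c where "c = 1 / sqrt e"
  have c: "c > 0" "c\<^sup>2 = 1 / e" using e by (auto simp: c_def power_divide)
  let ?t = "sqrt (2 / real d) * (real d - 1) powr ((real CARD('n) + 2) / 2)"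
  have pt: "ennreal (c ^ CARD('n)) * ?J d (c *\<^sub>R y) \<le> ennreal ?t * ?J 2 y" for y :: "real^'n"
  proof -
    define Y where "Y = y \<bullet> y"
    have Y: "Y \<ge> 0" by (simp add: Y_def)
    define r m where "r = 1 + Y / e" and "m = 1 + (e + 1) * Y / e"
    have xx: "(c *\<^sub>R y) \<bullet> (c *\<^sub>R y) = Y / e"
      using c(2) by (simp add: Y_def power2_eq_square mult.assoc[symmetric])
    have r: "r > 0" and m: "m > 0" using e Y by (auto simp: r_def m_def intro!: add_pos_nonneg)
    let ?n = "real CARD('n) / 2"
    have exp: "perturbed_expectation S (sqrt (real d * (real d - 1) / (2 * m))) (c *\<^sub>R y)
      \<le> perturbed_expectation S (sqrt (real 2 * (real 2 - 1) / (2 * (1 + real 2 * Y)))) y"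
      unfolding perturbed_expectation_scale
    proof (rule perturbed_expectation_mono[OF S])
      show "0 \<le> sqrt (real d * (real d - 1) / (2 * m)) * c\<^sup>2" using e m c by simp
      have "sqrt (real d * (real d - 1) / (2 * m)) * c\<^sup>2
          = sqrt ((e + 1) * e / (2 * m)) * sqrt ((1 / e)\<^sup>2)"
        using e(1) by (simp add: c(2) e(2))
      also have "\<dots> = sqrt ((e + 1) * e / (2 * m) * (1 / e)\<^sup>2)" by (rule real_sqrt_mult[symmetric])
      also have "(e + 1) * e / (2 * m) * (1 / e)\<^sup>2 = (e + 1) / (2 * (m * e))"
        using e m by (simp add: power2_eq_square)
      also have "m * e = e + (e + 1) * Y" using e by (simp add: m_def field_simps)
      \<comment> \<open>After cross-multiplication the terms in \<open>Y\<close> agree and only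
        \<open>e + 1 \<le> 2 * e\<close> is left.\<close>
      also have "sqrt ((e + 1) / (2 * (e + (e + 1) * Y)))
          \<le> sqrt (real 2 * (real 2 - 1) / (2 * (1 + real 2 * Y)))"
      proof (rule real_sqrt_le_mono)
        have "0 < e + (e + 1) * Y" "0 < 1 + 2 * Y" using e Y by (auto intro!: add_pos_nonneg)
        then show "(e + 1) / (2 * (e + (e + 1) * Y))
            \<le> real 2 * (real 2 - 1) / (2 * (1 + real 2 * Y))"
          using e Y by (simp add: frac_le_eq divide_le_eq field_simps)
      qed
      finally show "sqrt (real d * (real d - 1) / (2 * m)) * c\<^sup>2
          \<le> sqrt (real 2 * (real 2 - 1) / (2 * (1 + real 2 * Y)))" .
    qed
    have coef: "c ^ CARD('n) * ((e / (pi * r)) powr ?n / (sqrt r * sqrt m))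
      \<le> ?t * ((1 / (pi * (1 + Y))) powr ?n / (sqrt (1 + Y) * sqrt (1 + 2 * Y)))"
    proof -
      have "c ^ CARD('n) = (1 / e) powr ?n"
        using e by (simp add: c_def powr_half_sqrt[symmetric] powr_divide powr_realpow[symmetric]
          powr_powr power_divide)
      then have 1: "c ^ CARD('n) * (e / (pi * r)) powr ?n = (1 / (pi * r)) powr ?n"
        using e r by (simp add: powr_mult[symmetric])
      have er: "e * r = e + Y" using e by (simp add: r_def field_simps)
      have "(1 / (pi * r)) powr ?n \<le> (e * (1 / (pi * (1 + Y)))) powr ?n"
      proof (rule powr_mono2)
        have "1 + Y \<le> e * r" using e by (simp add: er)
        then have "1 / r \<le> e / (1 + Y)"
          using r Y by (simp add: field_simps)
        then have "1 / pi * (1 / r) \<le> 1 / pi * (e / (1 + Y))"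
          by (intro mult_left_mono) auto
        then show "1 / (pi * r) \<le> e * (1 / (pi * (1 + Y)))" by simp
      qed (use r in auto)
      also have "(e * (1 / (pi * (1 + Y)))) powr ?n = e powr ?n * (1 / (pi * (1 + Y))) powr ?n"
        by (rule powr_mult)
      finally have 2: "(1 / (pi * r)) powr ?n \<le> e powr ?n * (1 / (pi * (1 + Y))) powr ?n" .
      have 3: "1 / sqrt r \<le> sqrt e * (1 / sqrt (1 + Y))"
      proof -
        have "sqrt (1 + Y) \<le> sqrt (e * r)" using e by (simp add: er)
        then show ?thesis using r Y by (simp add: real_sqrt_mult field_simps)
      qed
      have 4: "1 / sqrt m \<le> sqrt (2 * e / (e + 1)) * (1 / sqrt (1 + 2 * Y))"
      proof -
        \<comment> \<open>The factor is dictated by the coefficient of \<open>Y\<close>: in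
          \<open>m\<close> it is \<open>(e + 1) / e\<close> and has to become 2. The constant term
          then leaves slack because \<open>e \<ge> 1\<close>.\<close>
        have "1 + 2 * Y \<le> 2 * e / (e + 1) * m"
        proof -
          have "2 * e / (e + 1) * m = 2 * e / (e + 1) + 2 * Y"
            unfolding m_def distrib_left using e(1) by simp
          moreover have "1 \<le> 2 * e / (e + 1)" using e by simp
          ultimately show ?thesis by linarith
        qed
        then have "sqrt (1 + 2 * Y) \<le> sqrt (2 * e / (e + 1) * m)" by (rule real_sqrt_le_mono)
        then have "sqrt (1 + 2 * Y) \<le> sqrt (2 * e / (e + 1)) * sqrt m"
            by (simp only: real_sqrt_mult)
        then show ?thesis using m Y by (simp add: divide_le_eq le_divide_eq mult.commute)
      qed
      have "c ^ CARD('n) * ((e / (pi * r)) powr ?n / (sqrt r * sqrt m))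
          = (1 / (pi * r)) powr ?n * ((1 / sqrt r) * (1 / sqrt m))"
        using 1 by (simp add: field_simps)
      also have "\<dots> \<le> (e powr ?n * (1 / (pi * (1 + Y))) powr ?n)
          * ((sqrt e * (1 / sqrt (1 + Y))) * (sqrt (2 * e / (e + 1)) * (1 / sqrt (1 + 2 * Y))))"
        using 2 3 4 r m e Y by (intro mult_mono) auto
      also have "\<dots> = (e powr ?n * sqrt e * sqrt (2 * e / (e + 1)))
          * ((1 / (pi * (1 + Y))) powr ?n / (sqrt (1 + Y) * sqrt (1 + 2 * Y)))"
        by (simp add: mult_ac)
      also have "e powr ?n * sqrt e * sqrt (2 * e / (e + 1)) = ?t"
      proof -
        have "e powr ?n * sqrt e * sqrt (2 * e / (e + 1))
            = e powr ?n * (sqrt e * sqrt e) * sqrt (2 / (e + 1))"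
          by (simp add: real_sqrt_mult real_sqrt_divide)
        also have "e powr ?n * (sqrt e * sqrt e) = e powr ((real CARD('n) + 2) / 2)"
        proof -
          have "(real CARD('n) + 2) / 2 = ?n + 1" by simp
          then show ?thesis using e by (simp only: powr_add) simp
        qed
        finally show ?thesis by (simp add: e(2) mult.commute)
      qed
      finally show ?thesis .
    qed
    have "ennreal (c ^ CARD('n)) * ?J d (c *\<^sub>R y)
        = ennreal (c ^ CARD('n) * ((e / (pi * r)) powr ?n / (sqrt r * sqrt m))) *
        perturbed_expectation S (sqrt (real d * (real d - 1) / (2 * m))) (c *\<^sub>R y)"
      unfolding xx using c(1) r m e
      by (subst ennreal_mult) (auto simp: r_def m_def mult.assoc)
    also have "\<dots> \<le> ennreal (?t
        * ((1 / (pi * (1 + Y))) powr ?n / (sqrt (1 + Y) * sqrt (1 + 2 * Y)))) *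
        perturbed_expectation S (sqrt (real 2 * (real 2 - 1) / (2 * (1 + real 2 * Y)))) y"
      by (intro mult_mono ennreal_leI coef exp) auto
    also have "\<dots> = ennreal ?t * ?J 2 y"
      unfolding Y_def[symmetric] using Y e by (subst ennreal_mult) (auto simp: mult.assoc)
    finally show ?thesis .
  qed
  have "(\<integral>\<^sup>+ x. kac_rice_density d S x \<partial>lborel) = (\<integral>\<^sup>+ x. ?J d x \<partial>lborel)"
    using d by (simp only: J)
  also have "\<dots> = (\<integral>\<^sup>+ y. ennreal (c ^ DIM(real^'n)) * ?J d (c *\<^sub>R y) \<partial>lborel)"
    by (rule nn_integral_scaleR[OF Jm c(1)])
  also have "\<dots> \<le> (\<integral>\<^sup>+ y. ennreal ?t * ?J 2 y \<partial>lborel)"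
    using pt by (intro nn_integral_mono) simp
  also have "\<dots> = ennreal ?t * (\<integral>\<^sup>+ y. ?J 2 y \<partial>lborel)"
    by (rule nn_integral_cmult) (use Jm[of 2] in simp)
  also have "(\<integral>\<^sup>+ y. ?J 2 y \<partial>lborel) = (\<integral>\<^sup>+ x. kac_rice_density 2 S x \<partial>lborel)"
    by (simp only: J[OF order_refl])
  finally show ?thesis .
qed

subsection \<open>The Gaussian Orthogonal Ensemble\<close>

lemma index_pairs_eq: "(index_pairs :: 'n::finite set set) = {e. card e = 1} \<union> {e. card e = 2}"
proof (intro set_eqI iffI)
  fix e :: "'n set" assume "e \<in> index_pairs"
  then obtain i j where "e = {i, j}" by (auto simp: index_pairs_def)
  then show "e \<in> {e. card e = 1} \<union> {e. card e = 2}" by (cases "i = j") auto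
next
  fix e :: "'n set" assume "e \<in> {e. card e = 1} \<union> {e. card e = 2}"
  then consider i where "e = {i}" | i j where "e = {i, j}"
    by (auto simp: card_1_singleton_iff card_2_iff)
  then show "e \<in> index_pairs" by cases (auto simp: index_pairs_def)
qed

definition pairs_of :: "'n set \<Rightarrow> ('n \<times> 'n) set" where
  "pairs_of e = {p. {fst p, snd p} = e}"

lemma pairs_of_cases:
  assumes "e \<in> index_pairs"
  obtains i where "e = {i}" "pairs_of e = {(i, i)}" "card e = 1"
  | i j where "i \<noteq> j" "e = {i, j}" "pairs_of e = {(i, j), (j, i)}" "card e = 2"
proof -
  obtain i j where e: "e = {i, j}" using assms by (auto simp: index_pairs_def)
  show thesis
  proof (cases "i = j")
    case True
    then show thesis using e by (intro that(1)[of i]) (auto simp: pairs_of_def)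
  next
    case False
    then show thesis using e by (intro that(2)[of i j]) (auto simp: pairs_of_def doubleton_eq_iff)
  qed
qed

lemma sum_pairs:
  fixes g :: "'n::finite \<Rightarrow> 'n \<Rightarrow> real"
  shows "(\<Sum>i\<in>UNIV. \<Sum>j\<in>UNIV. g i j) = (\<Sum>e\<in>index_pairs. \<Sum>p\<in>pairs_of e. g (fst p) (snd p))"
proof -
  have "(\<Sum>i\<in>UNIV. \<Sum>j\<in>UNIV. g i j) = (\<Sum>p\<in>UNIV. g (fst p) (snd p))"
    by (simp add: sum.cartesian_product split_beta)
  also have "\<dots> = (\<Sum>e\<in>index_pairs. \<Sum>p\<in>{p \<in> UNIV. {fst p, snd p} = e}. g (fst p) (snd p))"
    by (rule sum.group[symmetric]) (auto simp: index_pairs_def)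
  finally show ?thesis by (simp add: pairs_of_def)
qed

text \<open>An off-diagonal entry \<open>s {i, j}\<close> enters the squared Frobenius norm twice, hence the variance \<open>1/2\<close>.\<close>

definition GOE_sd :: "'n set \<Rightarrow> real" where
  "GOE_sd e = (if card e = 2 then 1 / sqrt 2 else 1)"

lemma GOE_sd_pos: "GOE_sd e > 0"
  by (simp add: GOE_sd_def)

text \<open>In the squared Frobenius norm a diagonal entry occurs once and an off-diagonal one
  twice, so the exponent splits into normal exponents of variance 1 and 1/2. The constant collects
  \<open>n\<close> factors \<open>1 / sqrt (2 * pi)\<close> and \<open>n (n - 1) / 2\<close> factors
  \<open>1 / sqrt pi\<close>.\<close>

lemma GOE_density:
  fixes s :: "'n::finite set \<Rightarrow> real"
  shows "exp (- (norm (sym_matrix s :: real^'n^'n))\<^sup>2 / 2)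
    / (2 powr (real CARD('n) / 2) * pi powr (real CARD('n) * (real CARD('n) + 1) / 4))
    = (\<Prod>e\<in>index_pairs. normal_density 0 (GOE_sd e) (s e))"
proof -
  let ?n = "real CARD('n)"
  let ?I1 = "{e :: 'n set. card e = 1}" and ?I2 = "{e :: 'n set. card e = 2}"
  have disj: "?I1 \<inter> ?I2 = {}" by auto
  have c1: "card ?I1 = CARD('n)"
    using n_subsets[of "UNIV :: 'n set" 1] by simp
  have c2: "real (card ?I2) = ?n * (?n - 1) / 2"
    using n_subsets[of "UNIV :: 'n set" 2]
      by (simp add: choose_two real_of_nat_div of_nat_diff Suc_leI)
  have "(norm (sym_matrix s :: real^'n^'n))\<^sup>2 = (\<Sum>i\<in>UNIV. \<Sum>j\<in>UNIV. s {i, j} * s {i, j})"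
    by (simp add: power2_norm_eq_inner inner_vec_def sym_matrix_def)
  also have "\<dots> = (\<Sum>e\<in>index_pairs. \<Sum>p\<in>pairs_of e. s {fst p, snd p} * s {fst p, snd p})"
    by (rule sum_pairs)
  also have "\<dots> = (\<Sum>e\<in>index_pairs. (s e)\<^sup>2 / (GOE_sd e)\<^sup>2)"
  proof (intro sum.cong refl)
    fix e :: "'n set" assume e: "e \<in> index_pairs"
    show "(\<Sum>p\<in>pairs_of e. s {fst p, snd p} * s {fst p, snd p}) = (s e)\<^sup>2 / (GOE_sd e)\<^sup>2"
      by (rule pairs_of_cases[OF e]) (auto simp: GOE_sd_def power2_eq_square insert_commute)
  qed
  finally have nrm: "(norm (sym_matrix s :: real^'n^'n))\<^sup>2
      = (\<Sum>e\<in>index_pairs. (s e)\<^sup>2 / (GOE_sd e)\<^sup>2)" .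
  have "(\<Prod>e\<in>index_pairs. normal_density 0 (GOE_sd e) (s e))
    = (\<Prod>e\<in>index_pairs. (1 / sqrt (2 * pi * (GOE_sd e)\<^sup>2)) * exp (- ((s e)\<^sup>2 / (GOE_sd e)\<^sup>2) / 2))"
    by (intro prod.cong) (auto simp: normal_density_def)
  also have "\<dots> = (\<Prod>e\<in>(index_pairs :: 'n set set). 1 / sqrt (2 * pi * (GOE_sd e)\<^sup>2))
      * exp (- (norm (sym_matrix s :: real^'n^'n))\<^sup>2 / 2)"
    unfolding prod.distrib nrm by (simp add: exp_sum[symmetric] sum_negf sum_divide_distrib)
  also have "(\<Prod>e\<in>(index_pairs :: 'n set set). 1 / sqrt (2 * pi * (GOE_sd e)\<^sup>2))
    = (1 / sqrt (2 * pi)) ^ CARD('n) * (1 / sqrt pi) ^ card ?I2"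
    unfolding index_pairs_eq by (subst prod.union_disjoint)
      (auto simp: GOE_sd_def power_divide c1 disj simp del: One_nat_def)
  also have "\<dots> = 1 / (2 powr (?n / 2) * pi powr (?n * (?n + 1) / 4))"
  proof -
    have "(1 / sqrt (2 * pi)) ^ CARD('n) = 1 / (2 * pi) powr (?n / 2)"
      by (simp add: powr_half_sqrt[symmetric] powr_realpow[symmetric] powr_powr power_divide)
    moreover have "(1 / sqrt pi) ^ card ?I2 = 1 / pi powr (?n * (?n - 1) / 4)"
      by (simp add: powr_half_sqrt[symmetric] powr_realpow[symmetric] powr_powr power_divide c2)
    moreover have "pi powr (?n / 2) * pi powr (?n * (?n - 1) / 4) = pi powr (?n * (?n + 1) / 4)"
      unfolding powr_add[symmetric] by (rule arg_cong2[where f = "(powr)"]) (auto simp: field_simps)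
    ultimately show ?thesis by (simp add: powr_mult mult.assoc)
  qed
  finally show ?thesis by simp
qed

lemma borel_measurable_vec_lambda:
  fixes f :: "'a \<Rightarrow> 'n::finite \<Rightarrow> 'b::euclidean_space"
  assumes "\<And>i. (\<lambda>x. f x i) \<in> borel_measurable M"
  shows "(\<lambda>x. (\<chi> i. f x i) :: 'b^'n) \<in> borel_measurable M"
proof (subst borel_measurable_euclidean_space, intro ballI)
  fix b :: "'b^'n" assume "b \<in> Basis"
  then obtain i u where "b = axis i u" by (auto simp: Basis_vec_def)
  then show "(\<lambda>x. (\<chi> i. f x i) \<bullet> b) \<in> borel_measurable M"
    using assms[of i] by (simp add: inner_axis)
qed

lemma measurable_sym_matrix:
  "(sym_matrix :: ('n::finite set \<Rightarrow> real) \<Rightarrow> real^'n^'n)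
    \<in> borel_measurable (PiM index_pairs (\<lambda>e. density lborel (normal_density 0 (GOE_sd e))))"
  unfolding sym_matrix_def
proof (intro borel_measurable_vec_lambda)
  fix i j :: 'n
  have "{i, j} \<in> index_pairs" by (auto simp: index_pairs_def)
  from measurable_component_singleton[OF this, of "\<lambda>e. density lborel
      (normal_density 0 (GOE_sd e))"]
  show "(\<lambda>s. s {i, j}) \<in> borel_measurable
      (PiM index_pairs (\<lambda>e. density lborel (normal_density 0 (GOE_sd e))))"
    by (simp add: measurable_cong_sets[OF refl sets_density])
qed

lemma GOE_eq_PiM:
  "(GOE :: (real^'n::finite^'n) measure)
    = distr (PiM index_pairs (\<lambda>e. density lborel (normal_density 0 (GOE_sd e)))) borel sym_matrix"
proof -
  have "PiM (index_pairs :: 'n set set) (\<lambda>e. density lborel (normal_density 0 (GOE_sd e)))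
    = density (PiM index_pairs (\<lambda>_. lborel))
      (\<lambda>s. \<Prod>e\<in>index_pairs. normal_density 0 (GOE_sd e) (s e))"
    by (rule PiM_density_lborel)
      (auto intro!: prob_space_imp_sigma_finite prob_space_normal_density GOE_sd_pos)
  then show ?thesis
    unfolding GOE_def GOE_density by simp
qed

text \<open>For \<open>i \<noteq> j\<close> the entry at \<open>{i, j}\<close> has weight
  \<open>2 * T $ i $ j\<close> and variance 1/2, which contributes
  \<open>2 * (T $ i $ j)\<^sup>2\<close>, just as the two positions do in
  \<open>T \<bullet> T\<close>.\<close>

lemma cis_GOE:
  assumes T: "transpose T = (T :: real^'n::finite^'n)"
  shows "(\<integral>S. cis (T \<bullet> S) \<partial>GOE) = of_real (exp (- (T \<bullet> T) / 2))"
proof -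
  let ?c = "\<lambda>e. \<Sum>p\<in>pairs_of e. T $ fst p $ snd p"
  have Ts: "T $ i $ j = T $ j $ i" for i j
    using T by (metis (no_types, lifting) transpose_def vec_lambda_beta)
  note m = measurable_sym_matrix
  have lin: "T \<bullet> sym_matrix s = (\<Sum>e\<in>index_pairs. ?c e * s e)" for s
  proof -
    have "T \<bullet> sym_matrix s = (\<Sum>i\<in>UNIV. \<Sum>j\<in>UNIV. T $ i $ j * s {i, j})"
      by (simp add: inner_vec_def sym_matrix_def)
    also have "\<dots> = (\<Sum>e\<in>index_pairs. \<Sum>p\<in>pairs_of e. T $ fst p $ snd p * s {fst p, snd p})"
      by (rule sum_pairs)
    also have "\<dots> = (\<Sum>e\<in>index_pairs. ?c e * s e)"
      unfolding sum_distrib_right by (intro sum.cong refl) (simp add: pairs_of_def)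
    finally show ?thesis .
  qed
  have "T \<bullet> T = (\<Sum>e\<in>index_pairs. \<Sum>p\<in>pairs_of e. T $ fst p $ snd p * T $ fst p $ snd p)"
    unfolding sum_pairs[of "\<lambda>i j. T $ i $ j * T $ i $ j", symmetric] by (simp add: inner_vec_def)
  also have "\<dots> = (\<Sum>e\<in>index_pairs. (GOE_sd e)\<^sup>2 * (?c e)\<^sup>2)"
  proof (intro sum.cong refl)
    fix e :: "'n set" assume e: "e \<in> index_pairs"
    show "(\<Sum>p\<in>pairs_of e. T $ fst p $ snd p * T $ fst p $ snd p) = (GOE_sd e)\<^sup>2 * (?c e)\<^sup>2"
    proof (rule pairs_of_cases[OF e])
      fix i j assume ij: "i \<noteq> j" "pairs_of e = {(i, j), (j, i)}" "card e = 2"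
      then show ?thesis using Ts[of j i]
        by (simp add: GOE_sd_def power2_eq_square power_divide algebra_simps)
    qed (simp add: GOE_sd_def power2_eq_square)
  qed
  finally have TT: "T \<bullet> T = (\<Sum>e\<in>index_pairs. (GOE_sd e)\<^sup>2 * (?c e)\<^sup>2)" .
  have "(\<integral>S. cis (T \<bullet> S) \<partial>GOE)
    = (\<integral>s. cis (\<Sum>e\<in>index_pairs. ?c e * s e) \<partial>PiM index_pairs
      (\<lambda>e. density lborel (normal_density 0 (GOE_sd e))))"
    unfolding GOE_eq_PiM by (subst integral_distr[OF m]) (auto simp: lin)
  also have "\<dots> = of_real (exp (- (\<Sum>e\<in>index_pairs. (GOE_sd e)\<^sup>2 * (?c e)\<^sup>2) / 2))"
    by (rule cis_PiM_normal) (auto simp: GOE_sd_pos)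
  finally show ?thesis by (simp only: TT)
qed

lemma measure_eqI_cis_symmetric:
  fixes M N :: "(real^'n::finite^'n) measure"
  assumes M: "finite_measure M" "sets M = sets borel" "AE H in M. transpose H = H"
    and N: "finite_measure N" "sets N = sets borel" "AE H in N. transpose H = H"
    and eq: "\<And>T. transpose T = T \<Longrightarrow> (\<integral>H. cis (T \<bullet> H) \<partial>M) = (\<integral>H. cis (T \<bullet> H) \<partial>N)"
  shows "M = N"
proof (rule measure_eqI_cis[OF M(1,2) N(1,2)])
  fix T :: "real^'n^'n"
  show "(\<integral>H. cis (T \<bullet> H) \<partial>M) = (\<integral>H. cis (T \<bullet> H) \<partial>N)"
    using integral_cong_symmetric[OF M(2,3), of T] integral_cong_symmetric[OF N(2,3), of T]
      eq[OF transpose_sympart, of T] by (simp only:)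
qed

text \<open>Both measures live on symmetric matrices, and for symmetric \<open>T\<close> both
  characteristic functions are \<open>exp (- (T \<bullet> T) / 2)\<close>.\<close>

lemma GOE_eq_sympart: "(GOE :: (real^'n::finite^'n) measure) = distr std_gaussian borel sympart"
proof (rule measure_eqI_cis_symmetric)
  interpret G: prob_space "std_gaussian :: (real^'n^'n) measure" by (rule prob_space_std_gaussian)
  have sym [measurable]: "{H :: real^'n^'n. transpose H = H} \<in> sets borel"
    by (rule borel_closed[OF closed_symmetric])
  note m = measurable_sym_matrix
  have "prob_space (PiM index_pairs (\<lambda>e :: 'n set. density lborel (normal_density 0 (GOE_sd e))))"
    by (intro prob_space_PiM prob_space_normal_density GOE_sd_pos)
  then show "finite_measure (GOE :: (real^'n^'n) measure)"
    unfolding GOE_eq_PiM using prob_space.prob_space_distr[OF _ m] prob_space.finite_measure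
      by blast
  show "sets (GOE :: (real^'n^'n) measure) = sets borel" by (simp add: GOE_def)
  show "AE H in (GOE :: (real^'n^'n) measure). transpose H = H"
    unfolding GOE_eq_PiM using m
  proof (subst AE_distr_iff)
    have "transpose (sym_matrix s) = (sym_matrix s :: real^'n^'n)" for s
      by (simp add: sym_matrix_def transpose_def vec_eq_iff insert_commute)
    then show "AE s in PiM index_pairs (\<lambda>e :: 'n set. density lborel (normal_density 0 (GOE_sd e))).
        transpose (sym_matrix s) = (sym_matrix s :: real^'n^'n)"
      by simp
  qed simp_all
  show "finite_measure (distr std_gaussian borel (sympart :: real^'n^'n \<Rightarrow> _))"
    by (rule G.finite_measure_distr) measurable
  show "AE H in distr std_gaussian borel (sympart :: real^'n^'n \<Rightarrow> _). transpose H = H"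
    by (subst AE_distr_iff) (auto simp: transpose_sympart)
  fix T :: "real^'n^'n" assume T: "transpose T = T"
  have "(\<integral>H. cis (T \<bullet> H) \<partial>distr std_gaussian borel sympart) = (\<integral>Z. cis (T \<bullet> Z) \<partial>std_gaussian)"
    by (subst integral_distr) (auto simp: inner_sympart sympart_id[OF T])
  then show "(\<integral>H. cis (T \<bullet> H) \<partial>GOE) = (\<integral>H. cis (T \<bullet> H) \<partial>distr std_gaussian borel sympart)"
    by (simp add: cis_GOE[OF T] cis_std_gaussian dot_square_norm)
qed simp

text \<open>The determinant is a polynomial in \<open>t\<close>, and it is not the zero polynomial
  because \<open>A + t *\<^sub>R mat 1\<close> is injective once \<open>t\<close> exceeds the
  operator norm of \<open>A\<close>.\<close>

lemma finite_zeros_det_shift: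
  fixes A :: "real^'n::finite^'n"
  shows "finite {t. det (A + t *\<^sub>R mat 1) = 0}"
proof -
  define p :: "real poly" where "p
      = (\<Sum>q | q permutes (UNIV :: 'n set). of_int (sign q) *
        (\<Prod>i\<in>UNIV. [:A $ i $ q i, mat 1 $ i $ q i:]))"
  have p: "poly p t = det (A + t *\<^sub>R mat 1)" for t
    by (simp add: p_def det_def poly_sum poly_prod)
  have "p \<noteq> 0"
  proof
    assume "p = 0"
    then have z: "det (A + t *\<^sub>R mat 1) = 0" for t using p[of t] by simp
    define t where "t = onorm ((*v) A) + 1"
    obtain v where v: "v \<noteq> 0" "(A + t *\<^sub>R mat 1) *v v = 0"
      using z[of t] invertible_det_nz[of "A + t *\<^sub>R mat 1"] matrix_left_invertible_ker[of "A
        + t *\<^sub>R mat 1"]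
      unfolding invertible_left_inverse by auto
    have bl: "bounded_linear ((*v) A)" by (rule matrix_vector_mul_bounded_linear)
    have "A *v v = - (t *\<^sub>R v)"
      using v(2) by (simp add: matrix_vector_mult_add_rdistrib scaleR_matrix_vector_assoc[symmetric]
        eq_neg_iff_add_eq_0)
    then have "t * norm v = norm (A *v v)"
      using onorm_pos_le[OF bl] by (simp add: t_def)
    also have "\<dots> \<le> onorm ((*v) A) * norm v" by (rule onorm[OF bl])
    finally show False using v(1) by (simp add: t_def mult_le_cancel_right)
  qed
  then show ?thesis
    using poly_roots_finite[of p] by (simp add: p)
qed

text \<open>Lebesgue measure is invariant under the shifts \<open>Z + t *\<^sub>R mat 1\<close>, so
  the measure of the singular set may be averaged over a normal \<open>t\<close>; by Fubini it is
  enough that for each \<open>Z\<close> only finitely many \<open>t\<close> are bad.\<close>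

lemma AE_std_gaussian_det_sympart: "AE Z in (std_gaussian :: (real^'n::finite^'n) measure). det
    (sympart Z) \<noteq> 0"
proof -
  interpret N: prob_space std_normal_distribution by (rule prob_space_std_normal)
  let ?N = "{Z :: real^'n^'n. det (sympart Z) = 0}"
  interpret P: pair_sigma_finite std_normal_distribution "lborel :: (real^'n^'n) measure"
    by (simp add: pair_sigma_finite.intro N.sigma_finite_measure_axioms sigma_finite_lborel)
  have [measurable]: "?N \<in> sets borel" by measurable
  have sh: "sympart (Z + t *\<^sub>R mat 1) = sympart Z + t *\<^sub>R mat 1" for Z :: "real^'n^'n" and t
    by (simp add: sympart_def transpose_add transpose_scaleR scaleR_add_right scaleR_2[symmetric]
      add.assoc add.left_commute)
  have "emeasure lborel ?N = (\<integral>\<^sup>+ t. emeasure lborel ?N \<partial>std_normal_distribution)"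
    by (simp only: nn_integral_const N.emeasure_space_1 mult_1_right)
  also have "\<dots> = (\<integral>\<^sup>+ t. (\<integral>\<^sup>+ Z. indicator ?N (Z + t *\<^sub>R mat 1) \<partial>lborel) \<partial>std_normal_distribution)"
  proof (rule nn_integral_cong)
    fix t
    have "emeasure lborel ?N = (\<integral>\<^sup>+ Z. indicator ?N Z \<partial>distr lborel borel ((+) (t *\<^sub>R mat 1)))"
      by (simp add: lborel_distr_plus)
    also have "\<dots> = (\<integral>\<^sup>+ Z. indicator ?N (Z + t *\<^sub>R mat 1) \<partial>lborel)"
      by (subst nn_integral_distr) (auto simp: add.commute)
    finally show "emeasure lborel ?N = (\<integral>\<^sup>+ Z. indicator ?N (Z + t *\<^sub>R mat 1) \<partial>lborel)" .
  qed
  also have "\<dots> = (\<integral>\<^sup>+ Z. (\<integral>\<^sup>+ t. indicator ?N (Z + t *\<^sub>R mat 1) \<partial>std_normal_distribution) \<partial>lborel)"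
    by (rule P.Fubini'[symmetric]) measurable
  also have "\<dots> = (\<integral>\<^sup>+ Z. 0 \<partial>(lborel :: (real^'n^'n) measure))"
  proof (rule nn_integral_cong)
    fix Z :: "real^'n^'n"
    let ?F = "{t. det (sympart Z + t *\<^sub>R mat 1) = 0}"
    have fin: "finite ?F" by (rule finite_zeros_det_shift)
    have "emeasure lborel ?F = 0"
        by (rule emeasure_lborel_countable) (use fin countable_finite in blast)
    then have "AE t in lborel. t \<notin> ?F" using fin
        by (intro AE_not_in) (auto simp: null_sets_def finite_imp_closed)
    then have "AE t in std_normal_distribution. t \<notin> ?F"
      by (subst AE_density) auto
    then have "AE t in std_normal_distribution. (indicator ?N (Z + t *\<^sub>R mat 1) :: ennreal) = 0"
      by eventually_elim (simp add: sh)
    then show "(\<integral>\<^sup>+ t. indicator ?N (Z + t *\<^sub>R mat 1) \<partial>std_normal_distribution) = 0"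
      using nn_integral_cong_AE by fastforce
  qed
  finally have "emeasure lborel ?N = 0" by simp
  then have "AE Z in lborel. Z \<notin> ?N" by (intro AE_not_in) (auto simp: null_sets_def)
  then show ?thesis
    unfolding std_gaussian_def by (subst AE_density) auto
qed

subsection \<open>Quadratic polynomials\<close>

text \<open>A Hessian entry with nonzero coefficient lowers the exponent twice, and from degree at
  most 2 only the constant monomial is left.\<close>

lemma monom_hess_quadratic:
  assumes "\<alpha> \<in> multi_indices 2"
  shows "monom_hess \<alpha> x = monom_hess \<alpha> (0 :: real^'n::finite)"
proof -
  have "real (\<alpha> i) * (real (\<beta> j) * monom_fun (\<beta>(j := \<beta> j - 1)) x)
      = real (\<alpha> i) * (real (\<beta> j) * monom_fun (\<beta>(j := \<beta> j - 1)) 0)"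
    if \<beta>: "\<beta> = \<alpha>(i := \<alpha> i - 1)" for i j \<beta>
  proof (cases "\<alpha> i = 0 \<or> \<beta> j = 0")
    case False
    have upd: "(\<Sum>k\<in>UNIV. (\<gamma>(i := \<gamma> i - 1)) k) + 1 = (\<Sum>k\<in>UNIV. \<gamma> k)" if "\<gamma> i \<noteq> 0" for \<gamma> :: "'n \<Rightarrow> nat"
        and i
      using that by (simp add: sum.remove[of UNIV i])
    have "(\<Sum>k\<in>UNIV. (\<beta>(j := \<beta> j - 1)) k) + 2 \<le> 2"
      using upd[of \<alpha> i] upd[of \<beta> j] False assms unfolding \<beta>[symmetric]
        by (simp add: multi_indices_def)
    then have "\<beta>(j := \<beta> j - 1) = (\<lambda>_. 0)"
      by (auto simp: fun_eq_iff)
    then show ?thesis by (simp add: monom_fun_def)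
  qed auto
  then show ?thesis
    by (simp add: monom_hess_def monom_grad_def vec_eq_iff)
qed

lemma poly_hess_quadratic: "poly_hess 2 f x = poly_hess 2 f (0 :: real^'n::finite)"
  unfolding poly_hess_def by
    (intro sum.cong refl arg_cong[where f = "(*\<^sub>R) _"] monom_hess_quadratic)

lemma poly_grad_quadratic: "poly_grad 2 f x
    = poly_grad 2 f 0 + poly_hess 2 f 0 *v (x :: real^'n::finite)"
proof -
  let ?h = "\<lambda>x. poly_grad 2 f x - poly_hess 2 f 0 *v x"
  have "(?h has_derivative (\<lambda>h. 0)) (at y within UNIV)" for y
  proof -
    have "(?h has_derivative (\<lambda>h. poly_hess 2 f y *v h - poly_hess 2 f 0 *v h)) (at y)"
      by (intro has_derivative_diff poly_grad_derivative bounded_linear_imp_has_derivative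
        matrix_vector_mul_bounded_linear)
    then show ?thesis by (simp add: poly_hess_quadratic[of f y])
  qed
  from has_derivative_zero_unique[OF convex_UNIV this, of x 0]
  have "?h x = ?h 0" by simp
  then show ?thesis by (simp add: algebra_simps)
qed

text \<open>At \<open>x = 0\<close>, \<open>z = 0\<close> and \<open>d = 2\<close>,
  \<open>functional_variance\<close> gives the variance \<open>4 * (T \<bullet> T)\<close>, which is
  that of \<open>(2 *\<^sub>R T) \<bullet> Z\<close> for a standard Gaussian matrix
  \<open>Z\<close>.\<close>

lemma quadratic_hessian_law:
  "distr (random_coeffs 2) borel (\<lambda>f. poly_hess 2 f (0 :: real^'n::finite))
    = distr std_gaussian borel (\<lambda>Z. 2 *\<^sub>R sympart Z)"
proof (rule measure_eqI_cis_symmetric)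
  interpret R: prob_space "random_coeffs 2 :: (('n \<Rightarrow> nat) \<Rightarrow> real) measure"
    by (rule prob_space_random_coeffs)
  interpret G: prob_space "std_gaussian :: (real^'n^'n) measure" by (rule prob_space_std_gaussian)
  note m [measurable] = measurable_poly_hess[of 2 "0 :: real^'n"]
  have sym [measurable]: "{H :: real^'n^'n. transpose H = H} \<in> sets borel"
    by (rule borel_closed[OF closed_symmetric])
  show "finite_measure (distr (random_coeffs 2) borel (\<lambda>f. poly_hess 2 f (0 :: real^'n)))"
    by (rule R.finite_measure_distr) simp
  show "finite_measure (distr std_gaussian borel (\<lambda>Z :: real^'n^'n. 2 *\<^sub>R sympart Z))"
    by (rule G.finite_measure_distr) simp
  show "AE H in distr (random_coeffs 2) borel (\<lambda>f. poly_hess 2 f (0 :: real^'n)). transpose H = H"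
    by (subst AE_distr_iff) (auto simp: transpose_poly_hess)
  show "AE H in distr std_gaussian borel (\<lambda>Z :: real^'n^'n. 2 *\<^sub>R sympart Z). transpose H = H"
    by (subst AE_distr_iff) (auto simp: transpose_sympart transpose_scaleR)
  fix T :: "real^'n^'n" assume T: "transpose T = T"
  have "(\<integral>H. cis (T \<bullet> H) \<partial>distr (random_coeffs 2) borel (\<lambda>f. poly_hess 2 f (0 :: real^'n)))
    = (\<integral>f. cis (\<Sum>\<alpha>\<in>multi_indices 2 - {}. (T \<bullet> monom_hess \<alpha> 0) * f \<alpha>) \<partial>random_coeffs 2)"
  proof -
    have "T \<bullet> poly_hess 2 f (0 :: real^'n) = (\<Sum>\<alpha>\<in>multi_indices 2 - {}. (T \<bullet> monom_hess \<alpha> 0) * f \<alpha>)"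
        for f
      by (simp add: poly_hess_def inner_sum_right mult.commute)
    then show ?thesis by (subst integral_distr) auto
  qed
  also have "\<dots> = of_real (exp (- (\<Sum>\<alpha>\<in>multi_indices 2 - {}. multinomial 2 \<alpha> * (T \<bullet> monom_hess \<alpha> 0)\<^sup>2)
      / 2))"
    by (rule cis_random_coeffs)
  also have "(\<Sum>\<alpha>\<in>multi_indices 2 - {}. multinomial 2 \<alpha> * (T \<bullet> monom_hess \<alpha> (0 :: real^'n))\<^sup>2)
      = 4 * (T \<bullet> T)"
    using functional_variance[OF T, of 2 0 0] by simp
  also have "of_real (exp (- (4 * (T \<bullet> T)) / 2)) = (\<integral>Z. cis ((2 *\<^sub>R T) \<bullet> Z) \<partial>std_gaussian)"
    unfolding cis_std_gaussian by (simp add: power_mult_distrib dot_square_norm)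
  also have "\<dots> = (\<integral>H. cis (T \<bullet> H) \<partial>distr std_gaussian borel (\<lambda>Z. 2 *\<^sub>R sympart Z))"
    by (subst integral_distr) (auto simp: inner_sympart sympart_id[OF T])
  finally show "(\<integral>H. cis (T \<bullet> H) \<partial>distr (random_coeffs 2) borel (\<lambda>f. poly_hess 2 f (0 :: real^'n)))
    = (\<integral>H. cis (T \<bullet> H) \<partial>distr std_gaussian borel (\<lambda>Z. 2 *\<^sub>R sympart Z))" .
qed simp_all

text \<open>Expresses definiteness by two closed conditions and a nonvanishing determinant, which
  makes the set of definite matrices visibly Borel.\<close>

lemma positive_definite_iff_det: "positive_definite S \<longleftrightarrow> transpose S
    = S \<and> S \<in> possemidef \<and> det S \<noteq> 0"
proof
  assume S: "positive_definite S"
  then have sym: "transpose S = S" by (simp add: positive_definite_def)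
  have "det S \<noteq> 0"
  proof
    assume "det S = 0"
    then obtain v where "v \<noteq> 0" "S *v v = 0"
      using invertible_det_nz[of S] matrix_left_invertible_ker[of S]
        unfolding invertible_left_inverse by auto
    then show False using S unfolding positive_definite_def by force
  qed
  then show "transpose S = S \<and> S \<in> possemidef \<and> det S \<noteq> 0"
    using S sym positive_definite_iff_possemidef by blast
qed (use positive_definite_iff_possemidef in blast)

lemma sets_positive_definite [measurable]: "{S :: real^'n::finite^'n. positive_definite S}
    \<in> sets borel"
proof -
  have [measurable]: "{H :: real^'n^'n. transpose H
      = H} \<in> sets borel" "(possemidef :: (real^'n^'n) set) \<in> sets borel"
    by (rule borel_closed[OF closed_symmetric]) (rule borel_closed[OF closed_possemidef])
  have "{S :: real^'n^'n. positive_definite S} = {H. transpose H = H} \<inter> possemidef \<inter> {S. det S \<noteq> 0}"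
    by (auto simp: positive_definite_iff_det)
  also have "\<dots> \<in> sets borel" by measurable
  finally show ?thesis .
qed

lemma positive_definite_scaleR: "c > 0 \<Longrightarrow> positive_definite (c *\<^sub>R S) \<longleftrightarrow> positive_definite S"
  by (simp add: positive_definite_def transpose_scaleR scaleR_matrix_vector_assoc[symmetric]
    zero_less_mult_iff)

lemma AE_quadratic_hessian_det: "AE f in random_coeffs 2. det (poly_hess 2 f (0 :: real^'n::finite))
    \<noteq> 0"
proof -
  note m [measurable] = measurable_poly_hess[of 2 "0 :: real^'n"]
  have "AE Z in (std_gaussian :: (real^'n^'n) measure). det (2 *\<^sub>R sympart Z) \<noteq> 0"
    using AE_std_gaussian_det_sympart by eventually_elim (simp add: det_scaleR)
  then have "AE H in distr std_gaussian borel (\<lambda>Z :: real^'n^'n. 2 *\<^sub>R sympart Z). det H \<noteq> 0"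
    by (subst AE_distr_iff) auto
  then show ?thesis
    unfolding quadratic_hessian_law[symmetric] by (subst (asm) AE_distr_iff) auto
qed

lemma unique_critical_point:
  assumes "det (poly_hess 2 f (0 :: real^'n::finite)) \<noteq> 0"
  shows "\<exists>x0. {x :: real^'n. poly_grad 2 f x = 0} = {x0}"
proof -
  let ?H = "poly_hess 2 f (0 :: real^'n)" and ?b = "poly_grad 2 f (0 :: real^'n)"
  obtain R where R: "R ** ?H = mat 1" "?H ** R = mat 1"
    using assms invertible_det_nz[of ?H] by (auto simp: invertible_def)
  have "poly_grad 2 f x = 0 \<longleftrightarrow> x = R *v (- ?b)" for x :: "real^'n"
    unfolding poly_grad_quadratic[of f x]
  proof
    assume "?b + ?H *v x = 0"
    then have "?H *v x = - ?b" by (simp add: add_eq_0_iff)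
    then have "R *v (?H *v x) = R *v (- ?b)" by simp
    then show "x = R *v (- ?b)" by (simp only: matrix_vector_mul_assoc R(1) matrix_vector_mul_lid)
  next
    assume "x = R *v (- ?b)"
    then show "?b + ?H *v x = 0"
      by (simp only: matrix_vector_mul_assoc R(2) matrix_vector_mul_lid) simp
  qed
  then show ?thesis by auto
qed

lemma expected_critical_points_quadratic: "expected_critical_points TYPE('n::finite) 2 = 1"
proof -
  interpret R: prob_space "random_coeffs 2 :: (('n \<Rightarrow> nat) \<Rightarrow> real) measure"
    by (rule prob_space_random_coeffs)
  have "expected_critical_points TYPE('n) 2
      = (\<integral>\<^sup>+ f. 1 \<partial>(random_coeffs 2 :: (('n \<Rightarrow> nat) \<Rightarrow> real) measure))"
    unfolding expected_critical_points_def
      critical_point_iff_gradient[OF poly_fun_derivative poly_grad_derivative]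
  proof (rule nn_integral_cong_AE)
    show "AE f in random_coeffs 2. emeasure (count_space UNIV) {x :: real^'n. poly_grad 2 f x = 0}
        = 1"
      using AE_quadratic_hessian_det by eventually_elim (auto dest!: unique_critical_point)
  qed
  then show ?thesis using R.emeasure_space_1 by simp
qed

text \<open>The Hessian of a quadratic polynomial is constant, so its unique critical point is a
  minimum iff this one matrix is positive definite, and doubling a GOE matrix does not affect
  definiteness.\<close>

lemma expected_local_minima_quadratic:
  "expected_local_minima TYPE('n::finite) 2 = ennreal (GOE_positive_definite_prob TYPE('n))"
proof -
  interpret R: prob_space "random_coeffs 2 :: (('n \<Rightarrow> nat) \<Rightarrow> real) measure"
    by (rule prob_space_random_coeffs)
  interpret G: prob_space "std_gaussian :: (real^'n^'n) measure" by (rule prob_space_std_gaussian)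
  note m [measurable] = measurable_poly_hess[of 2 "0 :: real^'n"]
  let ?P = "{S :: real^'n^'n. positive_definite S}"
  have "expected_local_minima TYPE('n) 2
      = (\<integral>\<^sup>+ f. indicator ?P (poly_hess 2 f (0 :: real^'n)) \<partial>random_coeffs 2)"
    unfolding expected_local_minima_def
  proof (rule nn_integral_cong_AE)
    show "AE f in random_coeffs 2. emeasure (count_space UNIV)
        {x :: real^'n. local_minimum (poly_fun 2 f) x}
       = indicator ?P (poly_hess 2 f (0 :: real^'n))"
      using AE_quadratic_hessian_det
    proof eventually_elim
      case (elim f)
      from unique_critical_point[OF elim] obtain x0
          where x0: "{x :: real^'n. poly_grad 2 f x = 0} = {x0}" ..
      have "local_minimum (poly_fun 2 f) x \<longleftrightarrow> x = x0 \<and> positive_definite (poly_hess 2 f 0)"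
          for x :: "real^'n"
      proof -
        have "det (poly_hess 2 f y) \<noteq> 0" for y :: "real^'n"
          unfolding poly_hess_quadratic[of f y] by (rule elim)
        then have "local_minimum (poly_fun 2 f) x \<longleftrightarrow> poly_grad 2 f x
            = 0 \<and> poly_hess 2 f x \<in> possemidef"
          by (intro local_minimum_iff) blast
        also have "poly_hess 2 f x = poly_hess 2 f (0 :: real^'n)" by (rule poly_hess_quadratic)
        also have "poly_grad 2 f x = 0 \<longleftrightarrow> x \<in> {x0}" unfolding x0[symmetric] by simp
        finally show ?thesis
          by (simp only: positive_definite_iff_possemidef[OF transpose_poly_hess elim]
            singleton_iff)
      qed
      then have "{x :: real^'n. local_minimum (poly_fun 2 f) x}
          = (if positive_definite (poly_hess 2 f (0 :: real^'n)) then {x0} else {})"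
        by auto
      then show ?case by simp
    qed
  qed
  also have "\<dots> = (\<integral>\<^sup>+ H. indicator ?P H
      \<partial>distr (random_coeffs 2) borel (\<lambda>f. poly_hess 2 f (0 :: real^'n)))"
    by (subst nn_integral_distr) auto
  also have "\<dots> = (\<integral>\<^sup>+ Z. indicator ?P (2 *\<^sub>R sympart Z) \<partial>std_gaussian)"
    unfolding quadratic_hessian_law by (subst nn_integral_distr) auto
  also have "\<dots> = (\<integral>\<^sup>+ Z. indicator ?P (sympart Z) \<partial>std_gaussian)"
    by (simp add: indicator_def positive_definite_scaleR)
  also have "\<dots> = (\<integral>\<^sup>+ S. indicator ?P S \<partial>GOE)"
    unfolding GOE_eq_sympart by (subst nn_integral_distr) auto
  also have "\<dots> = emeasure GOE ?P"
    by (rule nn_integral_indicator) (simp add: GOE_def)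
  also have "\<dots> = ennreal (GOE_positive_definite_prob TYPE('n))"
  proof -
    interpret Q: prob_space "GOE :: (real^'n^'n) measure"
      unfolding GOE_eq_sympart by (rule G.prob_space_distr) simp
    show ?thesis by (simp add: GOE_positive_definite_prob_def Q.emeasure_eq_measure)
  qed
  finally show ?thesis .
qed

subsection \<open>One variable\<close>

lemma
  fixes A :: "real^'n::finite^'n"
  assumes "CARD('n) = 1"
  shows one_dim_matrix: "A = det A *\<^sub>R mat 1"
    and one_dim_possemidef: "A \<in> possemidef \<longleftrightarrow> 0 \<le> det A"
proof -
  obtain i :: 'n where i: "UNIV = {i}" using assms card_1_singletonE by blast
  have all: "j = i" for j using i by blast
  have A: "A = (A $ i $ i) *\<^sub>R mat 1"
    using all by (auto simp: vec_eq_iff mat_def) (metis all)+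
  have "det A = A $ i $ i"
    by (subst A) (simp only: det_scaleR det_I assms power_one_right mult_1_right)
  then show 1: "A = det A *\<^sub>R mat 1" using A by simp
  have v: "v \<bullet> (A *v v) = det A * (v \<bullet> v)" for v
    by (subst 1) (simp add: scaleR_matrix_vector_assoc[symmetric])
  have "\<exists>v :: real^'n. v \<bullet> v = 1"
    by (rule exI[of _ "axis i 1"]) (simp add: inner_axis_axis)
  then show "A \<in> possemidef \<longleftrightarrow> 0 \<le> det A"
    unfolding possemidef_def mem_Collect_eq v
    by (metis inner_ge_zero mult_1_right mult_nonneg_nonneg)
qed

text \<open>In one variable the determinant is the linear functional
  \<open>mat 1 \<bullet> H\<close>, so its law can be read off from
  \<open>cis_perturbed_measure\<close>; the variance is 1 from the GOE entry plus
  \<open>s\<^sup>2 * (x \<bullet> x)\<^sup>2\<close> from the rank-one part.\<close>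

lemma one_dim_perturbed_law:
  fixes x :: "real^'n::finite"
  assumes n: "CARD('n) = 1"
  shows "distr (perturbed_measure 1 1 (mat 1) s x) borel det
    = density lborel (normal_density 0 (sqrt (1 + s\<^sup>2 * (x \<bullet> x)\<^sup>2)))" (is "?L = ?R")
proof (rule measure_eqI_cis)
  have pos: "1 + s\<^sup>2 * (x \<bullet> x)\<^sup>2 > 0" by (intro add_pos_nonneg) auto
  interpret P: finite_measure "perturbed_measure 1 1 (mat 1) s x" by (rule finite_perturbed_measure)
  have [measurable_cong]: "sets (perturbed_measure 1 1 (mat 1) s x) = sets borel"
    by (simp add: perturbed_measure_def)
  have m: "det \<in> borel_measurable (perturbed_measure 1 1 (mat 1) s x)" by measurable
  show "finite_measure ?L" by (rule P.finite_measure_distr[OF m])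
  show "finite_measure ?R"
    using prob_space.finite_measure prob_space_normal_density pos by (metis real_sqrt_gt_0_iff)
  fix t :: real
  obtain i :: 'n where i: "UNIV = {i}" using n card_1_singletonE by blast
  have mm: "mat 1 \<bullet> (mat 1 :: real^'n^'n) = 1"
    unfolding inner_vec_def i by (simp add: mat_def)
  have mx: "mat 1 \<bullet> outer x x = x \<bullet> x"
    by (simp add: inner_outer)
  have td: "t * det H = (t *\<^sub>R mat 1) \<bullet> H" for H :: "real^'n^'n"
  proof -
    have "(t *\<^sub>R mat 1) \<bullet> H = (t *\<^sub>R mat 1) \<bullet> (det H *\<^sub>R (mat 1 :: real^'n^'n))"
      using arg_cong[OF one_dim_matrix[OF n, of H], of "\<lambda>A. (t *\<^sub>R mat 1) \<bullet> A"] .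
    also have "\<dots> = t * det H * (mat 1 \<bullet> (mat 1 :: real^'n^'n))" by simp
    finally show ?thesis by (simp only: mm mult_1_right)
  qed
  have t1: "transpose (mat 1) = (mat 1 :: real^'n^'n)"
      and t2: "transpose (t *\<^sub>R mat 1) = (t *\<^sub>R mat 1 :: real^'n^'n)"
    by (simp_all add: transpose_scaleR)
  have "(\<integral>y. cis (t \<bullet> y) \<partial>?L) = (\<integral>H. cis ((t *\<^sub>R mat 1) \<bullet> H) \<partial>perturbed_measure 1 1 (mat 1) s x)"
    by (subst integral_distr[OF m]) (auto simp: td)
  also have "\<dots> = of_real (exp (- ((1 + s\<^sup>2 * (x \<bullet> x)\<^sup>2) * t\<^sup>2) / 2))"
    unfolding cis_perturbed_measure[OF t1 t2 zero_le_one]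
    by (simp add: mm mx power_mult_distrib algebra_simps power2_eq_square)
  also have "\<dots> = (\<integral>y. cis (t * y) \<partial>?R)"
    using cis_normal[of "sqrt (1 + s\<^sup>2 * (x \<bullet> x)\<^sup>2)" t] pos by simp
  finally show "(\<integral>y. cis (t \<bullet> y) \<partial>?L) = (\<integral>y. cis (t \<bullet> y) \<partial>?R)" by simp
qed simp_all

lemma perturbed_expectation_eq:
  fixes x :: "real^'n::finite"
  assumes [measurable]: "S \<in> sets borel"
  shows "perturbed_expectation S s x
    = (\<integral>\<^sup>+ H. ennreal \<bar>det H\<bar> * indicator S H \<partial>perturbed_measure 1 1 (mat 1) s x)"
proof -
  interpret N: prob_space std_normal_distribution by (rule prob_space_std_normal)
  interpret G: prob_space "std_gaussian :: (real^'n^'n) measure" by (rule prob_space_std_gaussian)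
  interpret NG: pair_sigma_finite std_normal_distribution "std_gaussian :: (real^'n^'n) measure"
    by (simp add: pair_sigma_finite.intro N.sigma_finite_measure_axioms
      G.sigma_finite_measure_axioms)
  let ?f = "\<lambda>\<xi> Z. ennreal \<bar>det (perturbed s x \<xi> Z)\<bar> * indicator S (perturbed s x \<xi> Z)"
  have fm: "(\<lambda>(\<xi>, Z). ?f \<xi> Z) \<in> borel_measurable (std_normal_distribution \<Otimes>\<^sub>M std_gaussian)"
  proof -
    have "(\<lambda>p. ?f (fst p) (snd p)) \<in> borel_measurable (borel \<Otimes>\<^sub>M borel)" by measurable
    then show ?thesis by (simp add: split_beta' cong: measurable_cong_sets)
  qed
  have "(\<integral>\<^sup>+ H. ennreal \<bar>det H\<bar> * indicator S H \<partial>perturbed_measure 1 1 (mat 1) s x)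
    = (\<integral>\<^sup>+ H. ennreal 1 * (ennreal \<bar>det H\<bar> * indicator S H) \<partial>distr
      (std_normal_distribution \<Otimes>\<^sub>M std_gaussian) borel
     (\<lambda>(\<xi>, Z). 1 *\<^sub>R (mat 1 ** perturbed s x \<xi> Z ** mat 1)))"
    unfolding perturbed_measure_def by (rule nn_integral_density) auto
  also have "\<dots> = (\<integral>\<^sup>+ p. ennreal 1
      * (ennreal \<bar>det (case p of (\<xi>, Z) \<Rightarrow> 1 *\<^sub>R (mat 1 ** perturbed s x \<xi> Z ** mat 1))\<bar> *
      indicator S (case p of (\<xi>, Z) \<Rightarrow> 1 *\<^sub>R (mat 1 ** perturbed s x \<xi> Z ** mat 1)))
        \<partial>(std_normal_distribution \<Otimes>\<^sub>M std_gaussian))"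
    by (rule nn_integral_distr[OF measurable_perturbed_congruence]) auto
  also have "\<dots> = (\<integral>\<^sup>+ p. (case p of (\<xi>, Z) \<Rightarrow> ?f \<xi> Z) \<partial>(std_normal_distribution \<Otimes>\<^sub>M std_gaussian))"
    by (intro nn_integral_cong) (simp add: split_beta)
  also have "\<dots> = perturbed_expectation S s x"
    unfolding perturbed_expectation_def using NG.nn_integral_snd[OF fm] by simp
  finally show ?thesis ..
qed

lemma nn_integral_even_function:
  assumes [measurable]: "f \<in> borel_measurable borel" and even: "\<And>x. f (- x) = f x"
  shows "(\<integral>\<^sup>+ x. f x \<partial>lborel) = 2 * (\<integral>\<^sup>+ x\<in>{0..}. f x \<partial>(lborel :: real measure))"
proof -
  have "(\<integral>\<^sup>+ x. f x \<partial>lborel) = (\<integral>\<^sup>+ x. f x * indicator {0..} x + f x * indicator {..0} x \<partial>lborel)"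
  proof (rule nn_integral_cong_AE)
    \<comment> \<open>The two closed half-lines overlap in 0, a null set.\<close>
    have "AE x in lborel. x \<noteq> (0 :: real)" by (rule AE_lborel_singleton)
    then show "AE x in lborel. f x = f x * indicator {0..} x + f x * indicator {..0} x"
      by eventually_elim (auto simp: indicator_def)
  qed
  also have "\<dots> = (\<integral>\<^sup>+ x\<in>{0..}. f x \<partial>lborel) + (\<integral>\<^sup>+ x\<in>{..0}. f x \<partial>lborel)"
    by (rule nn_integral_add) auto
  also have "(\<integral>\<^sup>+ x\<in>{..0}. f x \<partial>lborel)
      = (\<integral>\<^sup>+ x. f x * indicator {..0} x \<partial>distr lborel borel uminus)"
    by (simp add: lborel_distr_uminus)
  also have "\<dots> = (\<integral>\<^sup>+ x\<in>{0..}. f x \<partial>lborel)"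
    by (subst nn_integral_distr) (auto simp: even indicator_def intro!: nn_integral_cong)
  finally show ?thesis by (simp add: mult_2)
qed

lemma nn_integral_abs_normal:
  assumes \<sigma>: "\<sigma> > 0"
  shows "(\<integral>\<^sup>+ y. ennreal \<bar>y\<bar> \<partial>density lborel (normal_density 0 \<sigma>)) = ennreal (sqrt (2 / pi) * \<sigma>)"
    and "(\<integral>\<^sup>+ y. ennreal \<bar>y\<bar> \<partial>density lborel (normal_density 0 \<sigma>))
      = 2 * (\<integral>\<^sup>+ y. ennreal \<bar>y\<bar> * indicator {0..} y \<partial>density lborel (normal_density 0 \<sigma>))"
proof -
  have "(\<integral>\<^sup>+ y. ennreal \<bar>y\<bar> \<partial>std_normal_distribution) = ennreal (sqrt (2 / pi))"
  proof -
    have "(\<integral>\<^sup>+ y. ennreal \<bar>y\<bar> \<partial>std_normal_distribution)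
        = (\<integral>\<^sup>+ y. ennreal (std_normal_density y * \<bar>y\<bar>) \<partial>lborel)"
      by (subst nn_integral_density) (auto simp: ennreal_mult)
    also have "\<dots> = ennreal (\<integral>y. std_normal_density y * \<bar>y\<bar> \<partial>lborel)"
      using std_normal_moment_abs_odd[of 0]
        by (intro nn_integral_eq_integral) (auto simp: has_bochner_integral_iff)
    also have "(\<integral>y. std_normal_density y * \<bar>y\<bar> \<partial>lborel) = sqrt (2 / pi)"
      using std_normal_moment_abs_odd[of 0] by (simp add: has_bochner_integral_iff)
    finally show ?thesis .
  qed
  moreover have "(\<integral>\<^sup>+ y. ennreal \<bar>y\<bar> \<partial>density lborel (normal_density 0 \<sigma>))
      = (\<integral>\<^sup>+ y. ennreal \<sigma> * ennreal \<bar>y\<bar> \<partial>std_normal_distribution)"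
    unfolding normal_density_scale[OF \<sigma>] using \<sigma>
      by (subst nn_integral_distr) (auto simp: abs_mult ennreal_mult)
  ultimately show "(\<integral>\<^sup>+ y. ennreal \<bar>y\<bar> \<partial>density lborel (normal_density 0 \<sigma>))
      = ennreal (sqrt (2 / pi) * \<sigma>)"
    using \<sigma> by (simp only:) (subst nn_integral_cmult, auto simp: ennreal_mult[symmetric]
      mult.commute)
  have "(\<integral>\<^sup>+ y. ennreal \<bar>y\<bar> \<partial>density lborel (normal_density 0 \<sigma>))
      = (\<integral>\<^sup>+ y. ennreal (normal_density 0 \<sigma> y) * ennreal \<bar>y\<bar> \<partial>lborel)"
    by (subst nn_integral_density) auto
  also have "\<dots> = 2 * (\<integral>\<^sup>+ y\<in>{0..}. ennreal (normal_density 0 \<sigma> y) * ennreal \<bar>y\<bar> \<partial>lborel)"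
    by (rule nn_integral_even_function) (auto simp: normal_density_def)
  also have "(\<integral>\<^sup>+ y\<in>{0..}. ennreal (normal_density 0 \<sigma> y) * ennreal \<bar>y\<bar> \<partial>lborel)
    = (\<integral>\<^sup>+ y. ennreal \<bar>y\<bar> * indicator {0..} y \<partial>density lborel (normal_density 0 \<sigma>))"
    by (subst nn_integral_density) (auto simp: mult.assoc)
  finally show "(\<integral>\<^sup>+ y. ennreal \<bar>y\<bar> \<partial>density lborel (normal_density 0 \<sigma>))
      = 2 * (\<integral>\<^sup>+ y. ennreal \<bar>y\<bar> * indicator {0..} y \<partial>density lborel (normal_density 0 \<sigma>))" .
qed

lemma
  fixes x :: "real^'n::finite"
  assumes n: "CARD('n) = 1"
  shows one_dim_perturbed_expectation: "perturbed_expectation UNIV s x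
    = ennreal (sqrt (2 / pi) * sqrt (1 + s\<^sup>2 * (x \<bullet> x)\<^sup>2))"
    and one_dim_perturbed_expectation_possemidef: "perturbed_expectation UNIV s x
      = 2 * perturbed_expectation possemidef s x"
proof -
  let ?\<sigma> = "sqrt (1 + s\<^sup>2 * (x \<bullet> x)\<^sup>2)"
  have pos: "?\<sigma> > 0" by (auto intro!: add_pos_nonneg)
  have [measurable_cong]: "sets (perturbed_measure 1 1 (mat 1) s x) = sets borel"
    by (simp add: perturbed_measure_def)
  have m: "det \<in> borel_measurable (perturbed_measure 1 1 (mat 1) s x)" by measurable
  have 1: "perturbed_expectation UNIV s x
      = (\<integral>\<^sup>+ y. ennreal \<bar>y\<bar> \<partial>density lborel (normal_density 0 ?\<sigma>))"
    unfolding one_dim_perturbed_law[OF n, symmetric]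
    by (subst nn_integral_distr[OF m]) (simp_all add: perturbed_expectation_eq)
  have 2: "perturbed_expectation possemidef s x
      = (\<integral>\<^sup>+ y. ennreal \<bar>y\<bar> * indicator {0..} y \<partial>density lborel (normal_density 0 ?\<sigma>))"
    unfolding one_dim_perturbed_law[OF n, symmetric]
      perturbed_expectation_eq[OF borel_closed[OF closed_possemidef]]
    by (subst nn_integral_distr[OF m]) (auto simp: indicator_def one_dim_possemidef[OF n])
  show "perturbed_expectation UNIV s x = ennreal (sqrt (2 / pi) * ?\<sigma>)"
    unfolding 1 by (rule nn_integral_abs_normal(1)[OF pos])
  show "perturbed_expectation UNIV s x = 2 * perturbed_expectation possemidef s x"
    unfolding 1 2 by (rule nn_integral_abs_normal(2)[OF pos])
qed

section \<open>The explicit integral in one variable\<close>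

lemma distr_lborel_one_dim:
  assumes n: "CARD('n::finite) = 1"
  shows "distr lborel borel (\<lambda>t. (\<chi> i. t) :: real^'n) = lborel"
proof (rule lborel_eqI[symmetric])
  obtain i :: 'n where i: "UNIV = {i}" using n card_1_singletonE by blast
  fix l u :: "real^'n" assume lu: "\<And>b. b \<in> Basis \<Longrightarrow> l \<bullet> b \<le> u \<bullet> b"
  have le: "l $ i \<le> u $ i" using lu[of "axis i 1"] by (simp add: inner_axis)
  have all: "(\<forall>j. P j) \<longleftrightarrow> P i" for P using i by (metis UNIV_I singletonD)
  have m: "(\<lambda>t. (\<chi> i. t) :: real^'n) \<in> borel_measurable lborel"
    by (intro borel_measurable_vec_lambda) simp
  have "(\<lambda>t. (\<chi> i. t) :: real^'n) -` box l u = {l $ i <..< u $ i}"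
    by (auto simp: mem_box_cart all)
  then have "emeasure (distr lborel borel (\<lambda>t. (\<chi> i. t) :: real^'n)) (box l u)
      = ennreal (u $ i - l $ i)"
    using le by (simp add: emeasure_distr[OF m])
  also have "u $ i - l $ i = (\<Prod>b\<in>Basis. (u - l) \<bullet> b)"
    by (simp add: prod_Basis_cart i inner_axis)
  finally show "emeasure (distr lborel borel (\<lambda>t. (\<chi> i. t) :: real^'n)) (box l u)
      = ennreal (\<Prod>b\<in>Basis. (u - l) \<bullet> b)" .
qed simp

definition critical_density :: "nat \<Rightarrow> real \<Rightarrow> real" where
  "critical_density d r = sqrt (real d * (real d - 1) * r ^ 4 + 2 * real d * r\<^sup>2 + 2)
    / ((real d * r\<^sup>2 + 1) * (r\<^sup>2 + 1))"

lemma borel_measurable_critical_density [measurable]: "critical_density d \<in> borel_measurable borel"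
  unfolding critical_density_def by measurable

lemma critical_density_nonneg: "d \<ge> 1 \<Longrightarrow> 0 \<le> critical_density d r"
  unfolding critical_density_def
    by (intro divide_nonneg_nonneg mult_nonneg_nonneg add_nonneg_nonneg real_sqrt_ge_zero) auto

lemma one_dim_kac_rice_density:
  fixes x :: "real^'n::finite"
  assumes n: "CARD('n) = 1" and d: "d \<ge> 2" and x: "x \<bullet> x = t\<^sup>2"
  shows "kac_rice_density d UNIV x = ennreal (sqrt (real d - 1) / pi * critical_density d t)"
proof -
  define r m where "r = 1 + t\<^sup>2" and "m = 1 + real d * t\<^sup>2"
  have r: "r > 0" and m: "m > 0" by (auto simp: r_def m_def intro!: add_pos_nonneg)
  let ?s = "sqrt (real d * (real d - 1) / (2 * m))"
  have d1: "real d - 1 > 0" using d by simp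
  have s2: "?s\<^sup>2 = real d * (real d - 1) / (2 * m)" using d1 m by simp
  \<comment> \<open>The variance of the one-by-one determinant over the common denominator
    \<open>2 * m\<close>; its numerator is the radicand of the final integrand.\<close>
  have num: "1 + ?s\<^sup>2 * (t\<^sup>2)\<^sup>2 = (real d * (real d - 1) * t ^ 4 + 2 * real d * t\<^sup>2 + 2) / (2 * m)"
    unfolding s2 using m by (simp add: m_def field_simps)
  let ?N = "real d * (real d - 1) * t ^ 4 + 2 * real d * t\<^sup>2 + 2"
  have "((real d - 1) / (pi * r)) powr (1 / 2) / (sqrt r * sqrt m)
      * (sqrt (2 / pi) * sqrt (?N / (2 * m)))
    = sqrt (real d - 1) / pi * (sqrt ?N / (m * r))"
  proof -
    have "((real d - 1) / (pi * r)) powr (1 / 2) = sqrt (real d - 1) / (sqrt pi * sqrt r)"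
      using d1 r by (simp add: powr_half_sqrt real_sqrt_divide real_sqrt_mult)
    moreover have "sqrt (2 / pi) * sqrt (?N / (2 * m)) = sqrt ?N / (sqrt pi * sqrt m)"
      by (simp add: real_sqrt_divide real_sqrt_mult)
    ultimately have "((real d - 1) / (pi * r)) powr (1 / 2) / (sqrt r * sqrt m)
        * (sqrt (2 / pi) * sqrt (?N / (2 * m)))
      = sqrt (real d - 1) * sqrt ?N / ((sqrt pi * sqrt pi) * (sqrt m * sqrt m) * (sqrt r * sqrt r))"
      by (simp add: mult_ac)
    also have "\<dots> = sqrt (real d - 1) / pi * (sqrt ?N / (m * r))"
      using r m by simp
    finally show ?thesis .
  qed
  moreover have "m = real d * t\<^sup>2 + 1" "r = t\<^sup>2 + 1" by (simp_all add: m_def r_def)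
  ultimately have eq: "((real d - 1) / (pi * r)) powr (1 / 2) / (sqrt r * sqrt m)
      * (sqrt (2 / pi) * sqrt (1 + ?s\<^sup>2 * (t\<^sup>2)\<^sup>2))
    = sqrt (real d - 1) / pi * critical_density d t"
    unfolding num critical_density_def by simp
  have "kac_rice_density d UNIV x
      = ennreal (((real d - 1) / (pi * r)) powr (1 / 2) / (sqrt r * sqrt m)) *
     ennreal (sqrt (2 / pi) * sqrt (1 + ?s\<^sup>2 * (t\<^sup>2)\<^sup>2))"
    using kac_rice_density_formula[OF d _ congruence_invariant_UNIV, of x] n
    unfolding one_dim_perturbed_expectation[OF n] x r_def m_def by simp
  also have "\<dots> = ennreal (sqrt (real d - 1) / pi * critical_density d t)"
    unfolding eq[symmetric] using r m by (intro ennreal_mult[symmetric]) auto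
  finally show ?thesis .
qed

lemma one_dim_expected_critical_points:
  assumes n: "CARD('n::finite) = 1" and d: "d \<ge> 2"
  shows "expected_critical_points TYPE('n) d
    = ennreal (2 * sqrt (real d - 1) / pi) * (\<integral>\<^sup>+ r\<in>{0..}. ennreal (critical_density d r) \<partial>lborel)"
proof -
  have d1: "d \<ge> 1" using d by simp
  obtain i :: 'n where i: "UNIV = {i}" using n card_1_singletonE by blast
  have m: "(\<lambda>t. (\<chi> i. t) :: real^'n) \<in> borel_measurable lborel"
    by (intro borel_measurable_vec_lambda) simp
  let ?f = "\<lambda>t. ennreal (sqrt (real d - 1) / pi * critical_density d t)"
  have K: "kac_rice_density d UNIV x = ?f (x $ i)" for x :: "real^'n"
    using one_dim_kac_rice_density[OF n d, of x "x $ i"]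
      by (simp add: inner_vec_def i power2_eq_square)
  have "expected_critical_points TYPE('n) d
      = (\<integral>\<^sup>+ x. kac_rice_density d UNIV x \<partial>distr lborel borel (\<lambda>t. (\<chi> i. t) :: real^'n))"
    unfolding distr_lborel_one_dim[OF n] by (rule expected_critical_points_kac_rice[OF d1])
  also have "\<dots> = (\<integral>\<^sup>+ t. ?f t \<partial>lborel)"
    unfolding K by (subst nn_integral_distr[OF m]) auto
  also have "\<dots> = 2 * (\<integral>\<^sup>+ t\<in>{0..}. ?f t \<partial>lborel)"
    by (rule nn_integral_even_function) (auto simp: critical_density_def)
  also have "(\<integral>\<^sup>+ t\<in>{0..}. ?f t \<partial>lborel)
      = (\<integral>\<^sup>+ t. ennreal (sqrt (real d - 1) / pi) *
        (ennreal (critical_density d t) * indicator {0..} t) \<partial>lborel)"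
    using d1 by (intro nn_integral_cong)
      (simp add: ennreal_mult[symmetric] critical_density_nonneg mult.assoc[symmetric])
  also have "\<dots> = ennreal (sqrt (real d - 1) / pi)
      * (\<integral>\<^sup>+ r\<in>{0..}. ennreal (critical_density d r) \<partial>lborel)"
    by (rule nn_integral_cmult) auto
  also have "2 * (ennreal (sqrt (real d - 1) / pi)
      * (\<integral>\<^sup>+ r\<in>{0..}. ennreal (critical_density d r) \<partial>lborel))
    = ennreal (2 * sqrt (real d - 1) / pi) * (\<integral>\<^sup>+ r\<in>{0..}. ennreal (critical_density d r) \<partial>lborel)"
  proof -
    have "2 * ennreal (sqrt (real d - 1) / pi) = ennreal (2 * (sqrt (real d - 1) / pi))"
      using d1 by (subst ennreal_mult) auto
    then show ?thesis by (simp add: mult.assoc[symmetric])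
  qed
  finally show ?thesis .
qed

lemma one_dim_critical_points_eq_twice_minima:
  assumes n: "CARD('n::finite) = 1" and d: "d \<ge> 2"
  shows "expected_critical_points TYPE('n) d = 2 * expected_local_minima TYPE('n) d"
proof -
  have d1: "d \<ge> 1" using d by simp
  note F = kac_rice_density_formula[OF d]
  have [measurable]: "(possemidef :: (real^'n^'n) set) \<in> sets borel"
      by (rule borel_closed[OF closed_possemidef])
  have eq: "kac_rice_density d UNIV x = 2 * kac_rice_density d possemidef x" for x :: "real^'n"
    using F[OF _ congruence_invariant_UNIV, of x] F[OF _ congruence_invariant_possemidef, of x]
    by (simp add: one_dim_perturbed_expectation_possemidef[OF n] mult.left_commute)
  have "(\<lambda>x :: real^'n. kac_rice_density d possemidef x) \<in> borel_measurable borel"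
  proof -
    have [measurable]: "(\<lambda>x :: real^'n. perturbed_expectation possemidef (sqrt (real d
        * (real d - 1) / (2 * (1 + real d * (x \<bullet> x))))) x) \<in> borel_measurable borel"
      by (rule borel_measurable_perturbed_expectation) measurable
    show ?thesis
      by (subst F[OF _ congruence_invariant_possemidef]) measurable
  qed
  then show ?thesis
    unfolding expected_critical_points_kac_rice[OF d1] expected_local_minima_kac_rice[OF d1] eq
    by (intro nn_integral_cmult) simp
qed

section \<open>Bounds and asymptotics in one variable\<close>

lemma nn_integral_arctan:
  assumes "a > 0" "c \<ge> 0"
  shows "(\<integral>\<^sup>+ r\<in>{0..}. ennreal (c / (a\<^sup>2 * r\<^sup>2 + 1)) \<partial>lborel) = ennreal (c * pi / (2 * a))"
proof -
  have "(\<integral>\<^sup>+ r\<in>{0..}. ennreal (c / (a\<^sup>2 * r\<^sup>2 + 1)) \<partial>lborel)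
      = ennreal (c / a * (pi / 2) - c / a * arctan (a * 0))"
  proof (rule nn_integral_FTC_atLeast)
    fix r :: real
    have "((\<lambda>r. c / a * arctan (a * r)) has_real_derivative c / a
        * (inverse (1 + (a * r)\<^sup>2) * a)) (at r)"
      by (auto intro!: derivative_eq_intros)
    then show "((\<lambda>r. c / a * arctan (a * r)) has_real_derivative c / (a\<^sup>2 * r\<^sup>2 + 1)) (at r)"
    proof -
      have "c / a * (inverse (1 + (a * r)\<^sup>2) * a) = c / (a\<^sup>2 * r\<^sup>2 + 1)"
        using assms by (simp add: power_mult_distrib inverse_eq_divide add.commute)
      with \<open>((\<lambda>r. c / a * arctan (a * r)) has_real_derivative c / a * (inverse (1 + (a * r)\<^sup>2) * a))
          (at r)\<close>
      show ?thesis by (simp only:)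
    qed
    show "0 \<le> c / (a\<^sup>2 * r\<^sup>2 + 1)" using assms
        by (intro divide_nonneg_nonneg add_nonneg_nonneg) auto
  next
    have "filterlim (\<lambda>r. a * r) at_top at_top"
      using assms by (intro filterlim_tendsto_pos_mult_at_top[OF tendsto_const _ filterlim_ident])
        auto
    then show "((\<lambda>r. c / a * arctan (a * r)) \<longlongrightarrow> c / a * (pi / 2)) at_top"
      by (intro tendsto_mult tendsto_const filterlim_compose[OF tendsto_arctan_at_top])
  qed simp
  then show ?thesis by (simp add: mult.commute)
qed

text \<open>With \<open>u = d r^2 + 1\<close> and \<open>v = r^2 + 1\<close>, the radicand times
  \<open>d - 1\<close> equals \<open>d v^2 + (d - 2) u^2\<close>; division by \<open>(u v)^2\<close>
  separates it into two squares, whence \<open>A\<close> and \<open>B\<close>. The bounds are then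
  those of a Euclidean norm by one entry and by the sum of its entries.\<close>

lemma critical_density_bounds:
  assumes d: "d \<ge> 2"
  defines "A \<equiv> sqrt (real d / (real d - 1))" and "B \<equiv> sqrt ((real d - 2) / (real d - 1))"
  shows "critical_density d r \<le> A / ((sqrt (real d))\<^sup>2 * r\<^sup>2 + 1) + B / (1\<^sup>2 * r\<^sup>2 + 1)"
    and "B / (1\<^sup>2 * r\<^sup>2 + 1) \<le> critical_density d r"
proof -
  define u v where "u = real d * r\<^sup>2 + 1" and "v = r\<^sup>2 + 1"
  have uv: "u > 0" "v > 0" by (auto simp: u_def v_def intro!: add_nonneg_pos)
  have d1: "real d - 1 > 0" "real d - 2 \<ge> 0" using d by simp_all
  have A: "A \<ge> 0" "A\<^sup>2 = real d / (real d - 1)" and B: "B \<ge> 0" "B\<^sup>2 = (real d - 2) / (real d - 1)"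
    using d1 by (simp_all add: A_def B_def)
  have "(real d - 1) * (A\<^sup>2 * v\<^sup>2 + B\<^sup>2 * u\<^sup>2) = real d * v\<^sup>2 + (real d - 2) * u\<^sup>2"
    using d1 unfolding A B by (simp add: distrib_left)
  also have "\<dots> = (real d - 1) * (real d * (real d - 1) * r ^ 4 + 2 * real d * r\<^sup>2 + 2)"
    by (simp add: u_def v_def power2_eq_square power4_eq_xxxx algebra_simps)
  finally have N: "real d * (real d - 1) * r ^ 4 + 2 * real d * r\<^sup>2 + 2 = (A * v)\<^sup>2 + (B * u)\<^sup>2"
    using d1 by (simp add: power_mult_distrib)
  have c: "critical_density d r = sqrt ((A * v)\<^sup>2 + (B * u)\<^sup>2) / (u * v)"
    unfolding critical_density_def N u_def v_def ..
  have "sqrt ((A * v)\<^sup>2 + (B * u)\<^sup>2) \<le> A * v + B * u"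
    using A B uv by (intro sqrt_sum_squares_le_sum) auto
  then have "critical_density d r \<le> (A * v + B * u) / (u * v)"
    unfolding c using uv by (intro divide_right_mono) auto
  also have "\<dots> = A / u + B / v" using uv by (simp add: field_simps)
  finally show "critical_density d r \<le> A / ((sqrt (real d))\<^sup>2 * r\<^sup>2 + 1) + B / (1\<^sup>2 * r\<^sup>2 + 1)"
    by (simp add: u_def v_def)
  have "B * u \<le> sqrt ((A * v)\<^sup>2 + (B * u)\<^sup>2)" by (rule real_sqrt_sum_squares_ge2)
  then have "B * u / (u * v) \<le> critical_density d r"
    unfolding c using uv by (intro divide_right_mono) auto
  then show "B / (1\<^sup>2 * r\<^sup>2 + 1) \<le> critical_density d r"
    using uv by (simp add: v_def)
qed

lemma one_dim_critical_points_bounds: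
  assumes n: "CARD('n::finite) = 1" and d: "d \<ge> 2"
  shows "expected_critical_points TYPE('n) d \<le> ennreal (1 + sqrt (real d - 2))"
    and "ennreal (sqrt (real d - 2)) \<le> expected_critical_points TYPE('n) d"
proof -
  let ?A = "sqrt (real d / (real d - 1))" and ?B = "sqrt ((real d - 2) / (real d - 1))"
      and ?k = "2 * sqrt (real d - 1) / pi"
  let ?I = "\<integral>\<^sup>+ r\<in>{0..}. ennreal (critical_density d r) \<partial>lborel"
  have d1: "real d - 1 > 0" "real d - 2 \<ge> 0" "sqrt (real d) > 0" using d by simp_all
  have IA: "(\<integral>\<^sup>+ r\<in>{0..}. ennreal (?A / ((sqrt (real d))\<^sup>2 * r\<^sup>2 + 1)) \<partial>lborel)
      = ennreal (?A * pi / (2 * sqrt (real d)))"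
    using d1 by (intro nn_integral_arctan) auto
  have IB: "(\<integral>\<^sup>+ r\<in>{0..}. ennreal (?B / (1\<^sup>2 * r\<^sup>2 + 1)) \<partial>lborel) = ennreal (?B * pi / (2 * 1))"
    using d1 by (intro nn_integral_arctan) auto
  have kB: "?k * (?B * pi / (2 * 1)) = sqrt (real d - 2)"
      and kA: "?k * (?A * pi / (2 * sqrt (real d))) = 1"
    using d1 by (simp_all add: real_sqrt_divide)
  have "?I \<le> (\<integral>\<^sup>+ r. ennreal (?A / ((sqrt (real d))\<^sup>2 * r\<^sup>2 + 1)) * indicator {0..} r
      + ennreal (?B / (1\<^sup>2 * r\<^sup>2 + 1)) * indicator {0..} r \<partial>lborel)"
  proof (rule nn_integral_mono)
    fix r :: real
    have "0 \<le> ?A / ((sqrt (real d))\<^sup>2 * r\<^sup>2 + 1)" "0 \<le> ?B / (1\<^sup>2 * r\<^sup>2 + 1)"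
      using d1 by (auto intro!: divide_nonneg_nonneg add_nonneg_nonneg)
    then have "ennreal (critical_density d r)
        \<le> ennreal (?A / ((sqrt (real d))\<^sup>2 * r\<^sup>2 + 1)) + ennreal (?B / (1\<^sup>2 * r\<^sup>2 + 1))"
      by (simp only: ennreal_plus[symmetric] ennreal_leI critical_density_bounds(1)[OF d, of r])
    then show "ennreal (critical_density d r) * indicator {0..} r
      \<le> ennreal (?A / ((sqrt (real d))\<^sup>2 * r\<^sup>2 + 1)) * indicator {0..} r + ennreal
        (?B / (1\<^sup>2 * r\<^sup>2 + 1)) * indicator {0..} r"
      by (simp only: distrib_right[symmetric] mult_right_mono zero_le)
  qed
  also have "\<dots> = ennreal (?A * pi / (2 * sqrt (real d))) + ennreal (?B * pi / (2 * 1))"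
    by (subst nn_integral_add) (auto simp only: IA IB, measurable)
  also have "\<dots> = ennreal (?A * pi / (2 * sqrt (real d)) + ?B * pi / (2 * 1))"
    using d1 by (intro ennreal_plus[symmetric]) auto
  finally have "ennreal ?k * ?I
      \<le> ennreal ?k * ennreal (?A * pi / (2 * sqrt (real d)) + ?B * pi / (2 * 1))"
    by (rule mult_left_mono) simp
  also have "\<dots> = ennreal (?k * (?A * pi / (2 * sqrt (real d)) + ?B * pi / (2 * 1)))"
    using d1 by (intro ennreal_mult[symmetric]) auto
  also have "?k * (?A * pi / (2 * sqrt (real d)) + ?B * pi / (2 * 1)) = 1 + sqrt (real d - 2)"
    by (simp only: distrib_left kA kB)
  finally show "expected_critical_points TYPE('n) d \<le> ennreal (1 + sqrt (real d - 2))"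
    unfolding one_dim_expected_critical_points[OF n d] .
  have "ennreal (?k * (?B * pi / (2 * 1))) = ennreal ?k * ennreal (?B * pi / (2 * 1))"
    using d1 by (intro ennreal_mult) auto
  then have "ennreal (sqrt (real d - 2)) = ennreal ?k * ennreal (?B * pi / (2 * 1))"
    by (simp only: kB)
  also have "\<dots> \<le> ennreal ?k * ?I"
    unfolding IB[symmetric]
    by (intro mult_left_mono nn_integral_mono mult_right_mono ennreal_leI
      critical_density_bounds(2)[OF d]) auto
  finally show "ennreal (sqrt (real d - 2)) \<le> expected_critical_points TYPE('n) d"
    unfolding one_dim_expected_critical_points[OF n d] .
qed

text \<open>The upper and the lower bound differ by exactly 1, which is negligible against
  \<open>sqrt (real d - 2)\<close>.\<close>

lemma one_dim_critical_points_asymptotics: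
  assumes n: "CARD('n::finite) = 1"
  shows "(\<lambda>d. expected_critical_points TYPE('n) d / ennreal (1 + sqrt (real d - 2))) \<longlonglongrightarrow> 1"
proof (rule tendsto_sandwich)
  have lim: "(\<lambda>d. 1 - inverse (1 + sqrt (real d - 2))) \<longlonglongrightarrow> 1 - 0"
  proof (intro tendsto_diff tendsto_const tendsto_inverse_0_at_top)
    have "filterlim (\<lambda>d. real d + - 2) at_top sequentially"
      by (subst add.commute) (intro filterlim_tendsto_add_at_top[OF tendsto_const]
        filterlim_real_sequentially)
    then have "filterlim (\<lambda>d. sqrt (real d - 2)) at_top sequentially"
      by (intro filterlim_compose[OF sqrt_at_top]) simp
    then show "filterlim (\<lambda>d. 1 + sqrt (real d - 2)) at_top sequentially"
      by (intro filterlim_tendsto_add_at_top[OF tendsto_const])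
  qed
  show "(\<lambda>d. ennreal (1 - inverse (1 + sqrt (real d - 2)))) \<longlonglongrightarrow> 1"
    using tendsto_ennrealI[OF lim] by simp
  show "\<forall>\<^sub>F d in sequentially. ennreal (1 - inverse (1 + sqrt (real d - 2)))
      \<le> expected_critical_points TYPE('n) d / ennreal (1 + sqrt (real d - 2))"
    using eventually_ge_at_top[of 2]
  proof eventually_elim
    case (elim d)
    have p: "1 + sqrt (real d - 2) > 0" "sqrt (real d - 2) \<ge> 0" using elim
        by (auto intro: add_pos_nonneg)
    have "1 - inverse (1 + sqrt (real d - 2)) = sqrt (real d - 2) / (1 + sqrt (real d - 2))"
      using p(1) by (simp add: field_simps)
    then have "ennreal (1 - inverse (1 + sqrt (real d - 2)))
        = ennreal (sqrt (real d - 2)) / ennreal (1 + sqrt (real d - 2))"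
      using divide_ennreal[OF p(2,1)] by (simp only:)
    also have "\<dots> \<le> expected_critical_points TYPE('n) d / ennreal (1 + sqrt (real d - 2))"
      by (intro divide_right_mono_ennreal one_dim_critical_points_bounds(2)[OF n elim])
    finally show ?case .
  qed
  show "\<forall>\<^sub>F d in sequentially. expected_critical_points TYPE('n) d / ennreal (1 + sqrt (real d - 2))
      \<le> 1"
    using eventually_ge_at_top[of 2]
  proof eventually_elim
    case (elim d)
    have p: "1 + sqrt (real d - 2) > 0" "sqrt (real d - 2) \<ge> 0" using elim
        by (auto intro: add_pos_nonneg)
    have "expected_critical_points TYPE('n) d / ennreal (1 + sqrt (real d - 2))
        \<le> ennreal (1 + sqrt (real d - 2)) / ennreal (1 + sqrt (real d - 2))"
      by (intro divide_right_mono_ennreal one_dim_critical_points_bounds(1)[OF n elim])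
    also have "\<dots> = 1"
      unfolding divide_ennreal[OF less_imp_le[OF p(1)] p(1)] using p(1) by simp
    finally show ?case .
  qed
qed simp

theorem theorem1:
  defines "C \<equiv> expected_critical_points TYPE('n::finite)"
    and "E \<equiv> expected_local_minima TYPE('n)"
    and "P \<equiv> GOE_positive_definite_prob TYPE('n)"
  shows "(CARD('n) \<ge> 2 \<longrightarrow> C 2 = 1 \<and> E 2 = ennreal P) \<and>
    (CARD('n) \<ge> 2 \<longrightarrow> (\<forall>d::nat. d \<ge> 3 \<longrightarrow>
        C d \<le> ennreal (sqrt (2 / real d) * (real d - 1) powr ((real CARD('n) + 2) / 2)) \<and>
        E d \<le> ennreal (sqrt (2 / real d) * (real d - 1) powr ((real CARD('n) + 2) / 2) * P))) \<and>
    (CARD('n) = 1 \<longrightarrow>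
        (\<forall>d::nat. d \<ge> 2 \<longrightarrow>
          C d = 2 * E d \<and>
          C d = ennreal (2 * sqrt (real d - 1) / pi) *
            (\<integral>\<^sup>+ r\<in>{0..}. ennreal (sqrt (real d * (real d - 1) * r ^ 4 + 2 * real d * r\<^sup>2 + 2) /
                               ((real d * r\<^sup>2 + 1) * (r\<^sup>2 + 1))) \<partial>lborel) \<and>
          C d \<le> ennreal (1 + sqrt (real d - 2))) \<and>
        (\<lambda>d. C d / ennreal (1 + sqrt (real d - 2))) \<longlonglongrightarrow> 1)"
proof (intro conjI impI allI)
  show "C 2 = 1"
    unfolding C_def by (rule expected_critical_points_quadratic)
  show "E 2 = ennreal P"
    unfolding E_def P_def by (rule expected_local_minima_quadratic)
next
  fix d :: nat assume d: "d \<ge> 3"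
  let ?t = "sqrt (2 / real d) * (real d - 1) powr ((real CARD('n) + 2) / 2)"
  have d1: "d \<ge> 1" using d by simp
  \<comment> \<open>The comparison integral for degree two is \<open>C 2\<close>, whose value 1 is
    known without integrating; \<open>E 2\<close> plays the same role for the minima below.\<close>
  have "C d \<le> ennreal ?t * C 2"
    unfolding C_def using kac_rice_comparison[OF d, of "UNIV :: (real^'n^'n) set"]
    by (simp only: expected_critical_points_kac_rice[OF d1] expected_critical_points_kac_rice[of 2, OF one_le_numeral]
        simp_thms)
  then show "C d \<le> ennreal ?t"
    by (simp add: C_def expected_critical_points_quadratic)
  have "E d \<le> ennreal ?t * E 2"
    unfolding E_def using kac_rice_comparison[OF d, of "possemidef :: (real^'n^'n) set"]
    by (simp only: expected_local_minima_kac_rice[OF d1] expected_local_minima_kac_rice[of 2, OF one_le_numeral]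
        simp_thms)
  also have "\<dots> = ennreal (?t * P)"
    by (simp add: E_def P_def expected_local_minima_quadratic ennreal_mult GOE_positive_definite_prob_def)
  finally show "E d \<le> ennreal (?t * P)" .
next
  fix d :: nat assume n: "CARD('n) = 1" and d: "d \<ge> 2"
  show "C d = 2 * E d"
    unfolding C_def E_def by (rule one_dim_critical_points_eq_twice_minima[OF n d])
  show "C d = ennreal (2 * sqrt (real d - 1) / pi) *
      (\<integral>\<^sup>+ r\<in>{0..}. ennreal (sqrt (real d * (real d - 1) * r ^ 4 + 2 * real d * r\<^sup>2 + 2) /
                         ((real d * r\<^sup>2 + 1) * (r\<^sup>2 + 1))) \<partial>lborel)"
    unfolding C_def one_dim_expected_critical_points[OF n d] critical_density_def ..
  show "C d \<le> ennreal (1 + sqrt (real d - 2))"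
    unfolding C_def by (rule one_dim_critical_points_bounds(1)[OF n d])
next
  assume n: "CARD('n) = 1"
  show "(\<lambda>d. C d / ennreal (1 + sqrt (real d - 2))) \<longlonglongrightarrow> 1"
    unfolding C_def by (rule one_dim_critical_points_asymptotics[OF n])
qed

end
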